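(* Let $n\geqslant 2$, $\lambda>0$ and $p,r\in(0,1)$ satisfy $\frac{n-1}{n}\frac1p+\frac1r-\frac{\lambda}{n}=2-\frac1n$, and let $q=\frac{r}{r-1}<0$. Consider the minimization problem $$C^+:=\inf_f\Big\{\|E_\lambda f\|_{L^q(\mathbb{R}^n_+)}:\ f\geqslant 0,\ \|f\|_{L^p(\partial\mathbb{R}^n_+)}=1\Big\}.$$ Then there exists a function $f\in L^p(\partial\mathbb{R}^n_+)$ such that $f\geqslant 0$, $\|f\|_{L^p(\partial\mathbb{R}^n_+)}=1$ and $\|E_\lambda f\|_{L^q(\mathbb{R}^n_+)}=C^+$. Moreover, if $f$ is a minimizer of this problem, then there exist a nonnegative, strictly decreasing function $h$ on $[0,+\infty)$ and a point $x_0\in\partial\mathbb{R}^n_+$ such that $f(x)=h(|x+x_0|)$ for a.e. $x\in\partial\mathbb{R}^n_+$.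
   Context: $\mathbb{R}^n_+=\{y=(y',y_n)\in\mathbb{R}^n: y'\in\mathbb{R}^{n-1},\ y_n>0\}$, and its boundary $\partial\mathbb{R}^n_+$ is identified with $\mathbb{R}^{n-1}$ (with $(n-1)$-dimensional Lebesgue measure); for $x\in\partial\mathbb{R}^n_+$ and $y=(y',y_n)\in\mathbb{R}^n_+$, $|x-y|=\sqrt{|y'-x|^2+y_n^2}$. For a function $f$ on $\partial\mathbb{R}^n_+$, $(E_\lambda f)(y)=\int_{\partial\mathbb{R}^n_+}|x-y|^\lambda f(x)\,dx$ for $y\in\mathbb{R}^n_+$. For any exponent $\vartheta<1$, $\vartheta\ne0$ (possibly negative), $\|\phi\|_{L^\vartheta(\Omega)}$ denotes $\big(\int_\Omega|\phi|^\vartheta\big)^{1/\vartheta}$ (not a norm), and $\phi\in L^\vartheta(\Omega)$ means $\int_\Omega|\phi|^\vartheta<+\infty$. *)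

theory Defs
  imports "HOL-Analysis.Analysis"
begin

text \<open>
  Half-space and boundary: with \<open>CARD('m) = n - 1\<close>, the boundary is \<open>real^'m\<close> and a point
  \<open>y = (y', y\<^sub>n)\<close> of the ambient space is an element of \<open>real^'m \<times> real\<close>, whose product norm is
  the Euclidean one. A boundary point \<open>x\<close> is embedded as \<open>(x, 0)\<close>.
\<close>

definition half_space :: "((real^'m) \<times> real) set" where
  "half_space = {y. 0 < snd y}"

text \<open>
  Real powers of extended nonnegative numbers, with the usual conventions
  \<open>0\<^sup>a = \<infinity>\<close> and \<open>\<infinity>\<^sup>a = 0\<close> for \<open>a < 0\<close>. (The real power \<open>0 powr a\<close> is \<open>0\<close> for every \<open>a\<close>, which would be
  wrong for negative exponents.)
\<close>

definition epowr :: "ennreal \<Rightarrow> real \<Rightarrow> ennreal" where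
  "epowr x a =
     (if a = 0 then 1
      else if x = 0 then (if a < 0 then \<infinity> else 0)
      else if x = \<infinity> then (if a < 0 then 0 else \<infinity>)
      else ennreal (enn2real x powr a))"

text \<open>
  The \<open>L\<^sup>\<theta>\<close> functional of a nonnegative function, for \<open>\<theta> \<noteq> 0\<close> possibly negative. It takes
  extended values because \<open>E\<^sub>\<lambda> f\<close> may be infinite.
\<close>

definition Lnorm :: "real \<Rightarrow> 'a measure \<Rightarrow> ('a \<Rightarrow> ennreal) \<Rightarrow> ennreal" where
  "Lnorm \<theta> M \<phi> = epowr (\<integral>\<^sup>+ x. epowr (\<phi> x) \<theta> \<partial>M) (1 / \<theta>)"

definition Lspace :: "real \<Rightarrow> 'a measure \<Rightarrow> ('a \<Rightarrow> real) set" where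
  "Lspace \<theta> M = {f \<in> borel_measurable M. (\<integral>\<^sup>+ x. epowr (ennreal \<bar>f x\<bar>) \<theta> \<partial>M) < \<infinity>}"

definition ext_op :: "real \<Rightarrow> (real^'m \<Rightarrow> ennreal) \<Rightarrow> (real^'m) \<times> real \<Rightarrow> ennreal" where
  "ext_op l f y = (\<integral>\<^sup>+ x. ennreal (norm ((x, 0) - y) powr l) * f x \<partial>lebesgue)"

definition admissible :: "real \<Rightarrow> (real^'m \<Rightarrow> real) set" where
  "admissible p = {f \<in> Lspace p lebesgue. (\<forall>x. 0 \<le> f x) \<and> Lnorm p lebesgue (\<lambda>x. ennreal \<bar>f x\<bar>) = 1}"

definition objective :: "real \<Rightarrow> real \<Rightarrow> (real^'m \<Rightarrow> real) \<Rightarrow> ennreal" where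
  "objective l q f = Lnorm q (lebesgue_on half_space) (ext_op l (\<lambda>x. ennreal (f x)))"

definition is_minimizer :: "real \<Rightarrow> real \<Rightarrow> real \<Rightarrow> (real^'m \<Rightarrow> real) \<Rightarrow> bool" where
  "is_minimizer l p q f \<longleftrightarrow>
     f \<in> admissible p \<and>
     objective l q f = (INF g \<in> (admissible p :: (real^'m \<Rightarrow> real) set). objective l q g)"

end

theory Submission
  imports Defs "HOL-Complex_Analysis.Great_Picard"
begin

text \<open>
  Put \<open>s = - q > 0\<close>, \<open>u = E\<^sub>\<lambda> f\<close> and \<open>I(f) = \<integral> u\<^sup>-\<^sup>s\<close> over the half-space, so that minimizers are the maximizers of
  \<open>I\<close> under \<open>\<integral> f\<^sup>p = 1\<close>. No rearrangement is needed. Let \<open>\<phi>(x) = \<integral> |x - y|\<^sup>\<lambda> u(y)\<^sup>-\<^sup>s\<^sup>-\<^sup>1 dy\<close> and let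
  \<open>T f\<close> be the multiple of \<open>\<phi>\<close> to the power \<open>-1/(1-p)\<close> with unit \<open>L\<^sup>p\<close> functional. The tangent inequalities
  of the convex \<open>t\<^sup>-\<^sup>s\<close> and of the concave \<open>t\<^sup>p\<close> give \<open>I(f) \<le> I(T f)\<close>, with equality only if \<open>f = T f\<close> a.e.

  Existence: after a translation and a dilation, the minimum of \<open>u\<close> is attained at the origin and equals
  \<open>\<integral> f\<close>; then \<open>u\<close> and \<open>\<phi>\<close>, suitably normalised, are comparable with \<open>(1 + |y|)\<^sup>\<lambda>\<close> with constants that do not
  depend on \<open>f\<close>. Hence along a maximizing sequence \<open>f\<^sub>j\<close> the functions \<open>\<phi>\<^sub>j\<close> are equicontinuous, a
  subsequence converges pointwise, and the limit of \<open>T f\<^sub>j\<close> is a maximizer by dominated convergence.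

  Symmetry: a maximizer \<open>f = T f\<close> is continuous. Polarizing it with respect to any hyperplane cannot
  decrease \<open>I\<close>, so \<open>I\<close> is unchanged, and strict convexity then forces \<open>f\<close> to be ordered by the
  reflection: it is symmetric, or larger on one side throughout, strictly so because \<open>f = T f\<close>. A continuous function
  that vanishes at infinity and is ordered by all reflections is radial and strictly decreasing about its unique maximum.
\<close>

text \<open>Translations and dilations of the boundary preserve the constraint and \<open>I\<close>,
  so a maximizing sequence may escape or concentrate; even when these are divided out,
  \<open>\<integral> f\<^sup>p = 1\<close> with \<open>p < 1\<close> gives no compactness for the
  sequence itself. \<open>T\<close> supplies it: \<open>T f\<close> depends on \<open>f\<close> only
  through the smoother \<open>\<phi>\<close> and, for centred \<open>f\<close>, lies between fixed
  multiples of one decaying profile. Its form comes from linearising \<open>I\<close> at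
  \<open>f\<close>: convexity gives \<open>I(g) \<ge> I(f) + s (\<integral> f \<phi> - \<integral> g
  \<phi>)\<close>, and \<open>T f\<close> is the minimizer of \<open>\<integral> g \<phi>\<close>
  under \<open>\<integral> g\<^sup>p = 1\<close>, the equality case of the reverse Hoelder
  inequality. Since \<open>T f\<close> is unchanged when \<open>\<phi>\<close> is multiplied by a
  constant, \<open>\<phi>\<close> may be normalised at will. With \<open>m\<close> the dimension of
  the boundary, the relation between the exponents reads \<open>s (l - m (1/p - 1)) = m + 1\<close>.
  It expresses the invariance under dilations, and it also yields \<open>l p / (1 - p) > m\<close>
  and \<open>l s > m + 1\<close>, which make the powers of \<open>1 + |y|\<close> that occur
  integrable.\<close>

section \<open>Polynomial weights\<close>

definition wgt :: "real \<Rightarrow> 'a::real_normed_vector \<Rightarrow> real" where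
  "wgt a z = (1 + norm z) powr a"

lemma wgt_pos [simp]: "wgt a z > 0"
  unfolding wgt_def using norm_ge_zero[of z] by (metis add_pos_nonneg order_less_irrefl powr_gt_zero zero_less_one)

lemma wgt_nonneg [simp]: "wgt a z \<ge> 0" and wgt_nonzero [simp]: "wgt a z \<noteq> 0"
  using wgt_pos[of a z] by linarith+

lemma wgt_ge_1: "a \<ge> 0 \<Longrightarrow> wgt a z \<ge> 1"
  unfolding wgt_def by (simp add: ge_one_powr_ge_zero)

lemma wgt_mult: "wgt a z * wgt b z = wgt (a + b) z"
  unfolding wgt_def by (simp add: powr_add)

lemma wgt_powr: "wgt a z powr b = wgt (a * b) z"
  unfolding wgt_def by (simp add: powr_powr)

lemma continuous_on_wgt [continuous_intros]:
  "continuous_on S f \<Longrightarrow> continuous_on S (\<lambda>x. wgt a (f x))"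
  unfolding wgt_def
  by (intro continuous_intros) (auto simp: add_nonneg_eq_0_iff)

lemma borel_measurable_wgt [measurable]:
  fixes f :: "'b \<Rightarrow> 'a::{real_normed_vector, second_countable_topology}"
  assumes [measurable]: "f \<in> borel_measurable M"
  shows "(\<lambda>x. wgt a (f x)) \<in> borel_measurable M"
  unfolding wgt_def by measurable

text \<open>Splits the kernel into a product, so that a single weighted integral of a density
  controls its potential at every point. The summand 1 in the weight is what permits it.\<close>

lemma norm_diff_powr_le_wgt:
  assumes "l \<ge> 0" shows "norm (x - z) powr l \<le> wgt l x * wgt l z"
proof -
  have "norm (x - z) \<le> norm x + norm z" by (rule norm_triangle_ineq4)
  also have "\<dots> \<le> (1 + norm x) * (1 + norm z)" by (simp add: algebra_simps)
  finally have "norm (x - z) powr l \<le> ((1 + norm x) * (1 + norm z)) powr l"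
    using assms by (intro powr_mono2) auto
  also have "\<dots> = wgt l x * wgt l z"
    unfolding wgt_def by (simp add: powr_mult)
  finally show ?thesis .
qed

text \<open>A sum is at most twice the larger term; this treats exponents below and above 1
  alike.\<close>

lemma add_powr_le:
  fixes a b :: real
  assumes "l \<ge> 0" "a \<ge> 0" "b \<ge> 0"
  shows "(a + b) powr l \<le> 2 powr l * (a powr l + b powr l)"
proof -
  have "(a + b) powr l \<le> (2 * max a b) powr l"
    using assms by (intro powr_mono2) auto
  also have "\<dots> = 2 powr l * max a b powr l"
    using assms by (intro powr_mult)
  also have "\<dots> \<le> 2 powr l * (a powr l + b powr l)"
    by (intro mult_left_mono) (auto simp: max_def)
  finally show ?thesis .
qed

lemma norm_powr_quasi_triangle:
  assumes "l \<ge> 0"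
  shows "norm (a - b) powr l \<le> 2 powr l * (norm (c - a) powr l + norm (c - b) powr l)"
proof -
  have "norm (a - b) \<le> norm (c - a) + norm (c - b)"
    by (metis dist_norm dist_triangle3)
  then have "norm (a - b) powr l \<le> (norm (c - a) + norm (c - b)) powr l"
    using assms by (intro powr_mono2) auto
  also have "\<dots> \<le> 2 powr l * (norm (c - a) powr l + norm (c - b) powr l)"
    using assms by (intro add_powr_le) auto
  finally show ?thesis .
qed

lemma wgt_le_norm_powr:
  assumes "l \<ge> 0" shows "wgt l z \<le> 2 powr l * (1 + norm z powr l)"
  unfolding wgt_def using add_powr_le[of l 1 "norm z"] assms by simp

text \<open>Keeps weighted integrability of a density intact under translation and dilation.\<close>

lemma wgt_affine_le:
  fixes x z :: "'a::real_normed_vector"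
  assumes "a \<ge> 0"
  shows "wgt a (z + t *\<^sub>R x) \<le> ((1 + norm z) * (1 + \<bar>t\<bar>)) powr a * wgt a x"
proof -
  have "norm (z + t *\<^sub>R x) \<le> norm z + \<bar>t\<bar> * norm x"
    by (metis norm_scaleR norm_triangle_ineq)
  then have "1 + norm (z + t *\<^sub>R x) \<le> (1 + norm z) * (1 + \<bar>t\<bar>) * (1 + norm x)"
    by (simp add: algebra_simps) (smt (verit) abs_ge_zero mult_nonneg_nonneg norm_ge_zero)
  then have "wgt a (z + t *\<^sub>R x) \<le> ((1 + norm z) * (1 + \<bar>t\<bar>) * (1 + norm x)) powr a"
    unfolding wgt_def using assms by (intro powr_mono2) (auto simp: add_nonneg_nonneg)
  also have "\<dots> = ((1 + norm z) * (1 + \<bar>t\<bar>)) powr a * wgt a x"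
    unfolding wgt_def by (intro powr_mult)
  finally show ?thesis .
qed

lemma norm_Pair_zero: "norm (x, 0) = norm x"
  by (simp add: norm_Pair)

lemma wgt_Pair_zero [simp]: "wgt a (x, 0) = wgt a x"
  by (simp add: wgt_def norm_Pair_zero)

text \<open>Dyadic decomposition: where \<open>1 + norm x\<close> lies between \<open>2 ^ k\<close>
  and \<open>2 ^ Suc k\<close> the weight is at most \<open>(2 ^ k) powr (-a)\<close>, and enlarging
  each shell to a ball leaves a geometric series of ratio \<open>2 powr (d - a)\<close>.\<close>

lemma wgt_integrable:
  fixes a :: real
  assumes "a > DIM('a::euclidean_space)"
  shows "integrable lborel (\<lambda>x::'a. wgt (-a) x)"
proof (rule integrableI_nonneg)
  show "(\<integral>\<^sup>+x. ennreal (wgt (-a) (x::'a)) \<partial>lborel) < \<infinity>"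
  proof -
    define d where "d = DIM('a)"
    define V where "V = unit_ball_vol (real d)"
    have V: "V \<ge> 0" unfolding V_def by (simp add: unit_ball_vol_nonneg)
    define t :: "nat \<Rightarrow> 'a \<Rightarrow> ennreal" where
      "t k x = ennreal ((2 ^ k) powr (-a)) * indicator (ball 0 (2 ^ Suc k)) x" for k x
    have tm: "t k \<in> borel_measurable lborel" for k
    proof -
      have "t k = (\<lambda>x. ennreal ((2 ^ k) powr (-a)) * indicator (ball 0 (2 ^ Suc k)) x)"
        by (rule ext) (rule t_def)
      moreover have "(ball 0 (2 ^ Suc k) :: 'a set) \<in> sets lborel"
        unfolding sets_lborel by (intro borel_open open_ball)
      ultimately show ?thesis
        by (simp only: borel_measurable_times_ennreal borel_measurable_const borel_measurable_indicator)
    qed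
    have le: "ennreal (wgt (-a) x) \<le> (\<Sum>k. t k x)" for x :: 'a
    proof -
      have "\<exists>k::nat. 1 + norm x < 2 ^ k" by (rule real_arch_pow) simp
      \<comment> \<open>The least such exponent locates the dyadic shell of \<open>x\<close>. It is
        not 0 because \<open>1 + norm x\<close> is at least 1, so its predecessor \<open>k\<close>
        exists.\<close>
      then obtain k0 where k0: "1 + norm x < 2 ^ k0" "\<And>i. i < k0 \<Longrightarrow> \<not> 1 + norm x < 2 ^ i"
        using exists_least_iff[of "\<lambda>k. 1 + norm x < 2 ^ k"] by auto
      have "k0 \<noteq> 0"
      proof
        assume "k0 = 0"
        then show False using k0(1) norm_ge_zero[of x] by simp
      qed
      then obtain k where k: "k0 = Suc k" using not0_implies_Suc by blast
      have k1: "2 ^ k \<le> 1 + norm x" using k0(2)[of k] k by simp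
      have "ennreal (wgt (-a) x) \<le> t k x"
      proof -
        have "wgt (-a) x \<le> (2 ^ k) powr (-a)"
          unfolding wgt_def using k1 assms by (intro powr_mono2') auto
        moreover have "x \<in> ball 0 (2 ^ Suc k)"
          using k0(1) norm_ge_zero[of x] unfolding k by simp
        ultimately show ?thesis
          unfolding t_def by (simp add: ennreal_leI)
      qed
      also have "t k x \<le> (\<Sum>k. t k x)"
        using sum_le_suminf[OF summableI, of "{k}" "\<lambda>k. t k x"] by simp
      finally show ?thesis .
    qed
    have "(\<integral>\<^sup>+x. ennreal (wgt (-a) (x::'a)) \<partial>lborel) \<le> nn_integral lborel (\<lambda>x. suminf (\<lambda>k. t k x))"
      by (rule nn_integral_mono) (rule le)
    also have "\<dots> = (\<Sum>k. nn_integral lborel (t k))"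
      by (rule nn_integral_suminf[OF tm])
    also have "\<dots> = (\<Sum>k. ennreal (V * 2 ^ d * ((2 powr (d - a)) ^ k)))"
    proof (intro suminf_cong)
      fix k
      have "nn_integral lborel (t k) = ennreal ((2 ^ k) powr (-a)) * ennreal (V * (2 ^ Suc k) ^ d)"
      proof -
        have "t k = (\<lambda>x. ennreal ((2 ^ k) powr (-a)) * indicator (ball 0 (2 ^ Suc k)) x)"
          by (rule ext) (rule t_def)
        then have "nn_integral lborel (t k) = ennreal ((2 ^ k) powr (-a)) * emeasure lborel (ball 0 (2 ^ Suc k) :: 'a set)"
          by (simp only: nn_integral_cmult_indicator sets_lborel borel_open open_ball)
        also have "emeasure lborel (ball 0 (2 ^ Suc k) :: 'a set) = ennreal (V * (2 ^ Suc k) ^ d)"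
          unfolding V_def d_def by (rule emeasure_ball) simp
        finally show ?thesis .
      qed
      also have "\<dots> = ennreal ((2 ^ k) powr (-a) * (V * (2 ^ Suc k) ^ d))"
        using V by (simp add: ennreal_mult)
      also have "(2 ^ k) powr (-a) * (V * (2 ^ Suc k) ^ d) = V * 2 ^ d * ((2 powr (d - a)) ^ k)"
      proof -
        have pk: "(x::real) ^ j = x powr real j" if "x > 0" for x j
          using that by (simp add: powr_realpow)
        have pp: "(0::real) < 2 powr y" for y :: real by simp
        have 1: "((2::real) ^ k) powr (-a) = 2 powr (- (real k * a))"
          unfolding pk[OF zero_less_numeral] powr_powr by simp
        have 2: "((2::real) powr (d - a)) ^ k = 2 powr (real k * real d) * 2 powr (- (real k * a))"
          unfolding pk[OF pp] powr_powr powr_add[symmetric]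
          by (intro arg_cong2[where f = "(powr)"] refl) (simp add: algebra_simps)
        have 3: "((2::real) ^ k) ^ d = 2 powr (real k * real d)"
          unfolding pk[OF zero_less_numeral] pk[OF pp] powr_powr by (simp add: mult.commute)
        show ?thesis
          unfolding 1 2 power_Suc power_mult_distrib 3 by (simp only: mult_ac)
      qed
      finally show "nn_integral lborel (t k) = ennreal (V * 2 ^ d * ((2 powr (d - a)) ^ k))" .
    qed
    also have "\<dots> < \<infinity>"
    proof -
      have "(2::real) powr (d - a) < 1"
        using powr_less_mono[of "d - a" 0 2] assms unfolding d_def by simp
      then have "summable (\<lambda>k. V * 2 ^ d * ((2 powr (d - a)) ^ k))"
        by (intro summable_mult summable_geometric) auto
      then show ?thesis
        using V by (simp add: suminf_ennreal2 ennreal_less_top)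
    qed
    finally show ?thesis .
  qed
  show "AE x in lborel. 0 \<le> wgt (-a) (x::'a)"
    by (rule AE_I2) (rule wgt_nonneg)
qed measurable

subsection \<open>Potentials of weights\<close>

text \<open>The map \<open>X\<close> lets one definition serve both operators: the extension from
  the boundary, with \<open>X\<close> the embedding of the boundary, and its adjoint, with
  \<open>X\<close> the identity of the half-space.\<close>

definition pot :: "real \<Rightarrow> 'b measure \<Rightarrow> ('b \<Rightarrow> 'a::real_normed_vector) \<Rightarrow> ('b \<Rightarrow> real) \<Rightarrow> 'a \<Rightarrow> real" where
  "pot l M X w z = (\<integral>\<omega>. norm (X \<omega> - z) powr l * w \<omega> \<partial>M)"

locale potential =
  fixes l :: real and M :: "'b measure" and X :: "'b \<Rightarrow> 'a::euclidean_space" and w :: "'b \<Rightarrow> real"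
  assumes l_pos: "0 < l"
    and X_meas [measurable]: "X \<in> borel_measurable M"
    and w_meas [measurable]: "w \<in> borel_measurable M"
    and w_int: "integrable M (\<lambda>\<omega>. wgt l (X \<omega>) * w \<omega>)"
begin

lemma pot_integrable: "integrable M (\<lambda>\<omega>. norm (X \<omega> - z) powr l * w \<omega>)"
proof (rule Bochner_Integration.integrable_bound)
  show "integrable M (\<lambda>\<omega>. wgt l z * (wgt l (X \<omega>) * w \<omega>))"
    using w_int by (rule integrable_mult_right)
  show "AE \<omega> in M. norm (norm (X \<omega> - z) powr l * w \<omega>) \<le> norm (wgt l z * (wgt l (X \<omega>) * w \<omega>))"
  proof (rule AE_I2)
    fix \<omega>
    have "norm (X \<omega> - z) powr l * \<bar>w \<omega>\<bar> \<le> (wgt l (X \<omega>) * wgt l z) * \<bar>w \<omega>\<bar>"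
      using l_pos by (intro mult_right_mono norm_diff_powr_le_wgt) auto
    then show "norm (norm (X \<omega> - z) powr l * w \<omega>) \<le> norm (wgt l z * (wgt l (X \<omega>) * w \<omega>))"
      by (simp add: abs_mult mult_ac)
  qed
qed measurable

lemma w_integrable: "integrable M w"
proof (rule Bochner_Integration.integrable_bound[OF w_int])
  show "AE \<omega> in M. norm (w \<omega>) \<le> norm (wgt l (X \<omega>) * w \<omega>)"
  proof (rule AE_I2)
    fix \<omega>
    have "1 * \<bar>w \<omega>\<bar> \<le> wgt l (X \<omega>) * \<bar>w \<omega>\<bar>"
      using l_pos by (intro mult_right_mono wgt_ge_1) auto
    then show "norm (w \<omega>) \<le> norm (wgt l (X \<omega>) * w \<omega>)" by (simp add: abs_mult)
  qed
qed measurable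

text \<open>Depends on \<open>w\<close> alone, hence is a common modulus of continuity at
  \<open>z\<close> for the potentials of all densities dominated by \<open>w\<close>.\<close>

definition modulus :: "'a \<Rightarrow> 'a \<Rightarrow> real" where
  "modulus z z' = (\<integral>\<omega>. \<bar>norm (X \<omega> - z') powr l - norm (X \<omega> - z) powr l\<bar> * \<bar>w \<omega>\<bar> \<partial>M)"

lemma modulus_integrable:
  "integrable M (\<lambda>\<omega>. \<bar>norm (X \<omega> - z') powr l - norm (X \<omega> - z) powr l\<bar> * \<bar>w \<omega>\<bar>)"
proof -
  have "integrable M (\<lambda>\<omega>. \<bar>norm (X \<omega> - z') powr l * w \<omega> - norm (X \<omega> - z) powr l * w \<omega>\<bar>)"
    by (intro integrable_abs Bochner_Integration.integrable_diff pot_integrable)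
  then show ?thesis
    by (simp add: abs_mult[symmetric] left_diff_distrib)
qed


text \<open>Dominated convergence along sequences: a convergent sequence stays in a ball, on which
  the kernel differences are bounded by a constant times \<open>wgt l (X \<omega>)\<close>.\<close>

lemma modulus_tendsto_0: "(modulus z \<longlongrightarrow> 0) (at z)"
  unfolding tendsto_at_iff_sequentially comp_def
proof (intro allI impI)
  fix Z :: "nat \<Rightarrow> 'a" assume Z: "Z \<longlonglongrightarrow> z"
  then have "Bseq Z" by (rule convergent_imp_Bseq[OF convergentI])
  then obtain B where B: "B > 0" "\<And>n. norm (Z n) \<le> B" by (auto simp: Bseq_def)
  define C where "C = (1 + B) powr l + wgt l z"
  have C: "wgt l (Z n) + wgt l z \<le> C" for n
    unfolding C_def wgt_def using B(2)[of n] l_pos by (auto intro!: powr_mono2)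
  have "(\<lambda>n. modulus z (Z n)) \<longlonglongrightarrow> (\<integral>\<omega>. 0 \<partial>M)"
    unfolding modulus_def
  proof (rule integral_dominated_convergence[where w = "\<lambda>\<omega>. C * \<bar>wgt l (X \<omega>) * w \<omega>\<bar>"])
    show "integrable M (\<lambda>\<omega>. C * \<bar>wgt l (X \<omega>) * w \<omega>\<bar>)"
      using w_int by (intro integrable_mult_right integrable_abs)
    show "AE \<omega> in M. (\<lambda>n. \<bar>norm (X \<omega> - Z n) powr l - norm (X \<omega> - z) powr l\<bar> * \<bar>w \<omega>\<bar>) \<longlonglongrightarrow> 0"
    proof (rule AE_I2)
      fix \<omega>
      have "(\<lambda>n. norm (X \<omega> - Z n)) \<longlonglongrightarrow> norm (X \<omega> - z)"
        by (intro tendsto_intros Z)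
      then have "(\<lambda>n. norm (X \<omega> - Z n) powr l) \<longlonglongrightarrow> norm (X \<omega> - z) powr l"
        by (rule tendsto_powr'[OF _ tendsto_const]) (use l_pos in auto)
      then have "(\<lambda>n. \<bar>norm (X \<omega> - Z n) powr l - norm (X \<omega> - z) powr l\<bar> * \<bar>w \<omega>\<bar>)
          \<longlonglongrightarrow> \<bar>norm (X \<omega> - z) powr l - norm (X \<omega> - z) powr l\<bar> * \<bar>w \<omega>\<bar>"
        by (rule tendsto_mult[OF tendsto_rabs[OF tendsto_diff[OF _ tendsto_const]] tendsto_const])
      then show "(\<lambda>n. \<bar>norm (X \<omega> - Z n) powr l - norm (X \<omega> - z) powr l\<bar> * \<bar>w \<omega>\<bar>) \<longlonglongrightarrow> 0"
        by simp
    qed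
    show "AE \<omega> in M. norm (\<bar>norm (X \<omega> - Z n) powr l - norm (X \<omega> - z) powr l\<bar> * \<bar>w \<omega>\<bar>)
        \<le> C * \<bar>wgt l (X \<omega>) * w \<omega>\<bar>" for n
    proof (rule AE_I2)
      fix \<omega>
      have "\<bar>norm (X \<omega> - Z n) powr l - norm (X \<omega> - z) powr l\<bar>
          \<le> norm (X \<omega> - Z n) powr l + norm (X \<omega> - z) powr l"
        using powr_ge_zero[of "norm (X \<omega> - Z n)" l] powr_ge_zero[of "norm (X \<omega> - z)" l] by linarith
      also have "\<dots> \<le> wgt l (X \<omega>) * wgt l (Z n) + wgt l (X \<omega>) * wgt l z"
        using l_pos by (intro add_mono norm_diff_powr_le_wgt) auto
      also have "\<dots> = wgt l (X \<omega>) * (wgt l (Z n) + wgt l z)"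
        by (simp add: algebra_simps)
      also have "\<dots> \<le> wgt l (X \<omega>) * C"
        by (intro mult_left_mono C) simp
      finally have "\<bar>norm (X \<omega> - Z n) powr l - norm (X \<omega> - z) powr l\<bar> * \<bar>w \<omega>\<bar> \<le> wgt l (X \<omega>) * C * \<bar>w \<omega>\<bar>"
        by (rule mult_right_mono) simp
      then show "norm (\<bar>norm (X \<omega> - Z n) powr l - norm (X \<omega> - z) powr l\<bar> * \<bar>w \<omega>\<bar>)
          \<le> C * \<bar>wgt l (X \<omega>) * w \<omega>\<bar>"
        by (simp add: abs_mult mult_ac)
    qed
  qed measurable
  then show "(\<lambda>n. modulus z (Z n)) \<longlonglongrightarrow> 0" by simp
qed

text \<open>The source of equicontinuity: the right-hand side does not involve
  \<open>v\<close>.\<close>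

lemma pot_diff_le_modulus:
  assumes [measurable]: "v \<in> borel_measurable M" and le: "AE \<omega> in M. \<bar>v \<omega>\<bar> \<le> w \<omega>"
  shows "\<bar>pot l M X v z' - pot l M X v z\<bar> \<le> modulus z z'"
proof -
  have I: "integrable M (\<lambda>\<omega>. norm (X \<omega> - z) powr l * v \<omega>)" for z
  proof (rule Bochner_Integration.integrable_bound[OF pot_integrable[of z]])
    show "AE \<omega> in M. norm (norm (X \<omega> - z) powr l * v \<omega>) \<le> norm (norm (X \<omega> - z) powr l * w \<omega>)"
      using le
    proof eventually_elim
      case (elim \<omega>)
      then have "norm (X \<omega> - z) powr l * \<bar>v \<omega>\<bar> \<le> norm (X \<omega> - z) powr l * \<bar>w \<omega>\<bar>"
        by (intro mult_left_mono) auto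
      then show ?case by (simp add: abs_mult)
    qed
  qed measurable
  have "pot l M X v z' - pot l M X v z = (\<integral>\<omega>. norm (X \<omega> - z') powr l * v \<omega> - norm (X \<omega> - z) powr l * v \<omega> \<partial>M)"
    unfolding pot_def using I by simp
  also have "\<bar>\<dots>\<bar> \<le> (\<integral>\<omega>. \<bar>norm (X \<omega> - z') powr l * v \<omega> - norm (X \<omega> - z) powr l * v \<omega>\<bar> \<partial>M)"
    by (rule integral_abs_bound)
  also have "\<dots> \<le> modulus z z'"
    unfolding modulus_def
  proof (rule integral_mono_AE)
    show "AE \<omega> in M. \<bar>norm (X \<omega> - z') powr l * v \<omega> - norm (X \<omega> - z) powr l * v \<omega>\<bar>
      \<le> \<bar>norm (X \<omega> - z') powr l - norm (X \<omega> - z) powr l\<bar> * \<bar>w \<omega>\<bar>"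
      using le
    proof eventually_elim
      case (elim \<omega>)
      have "\<bar>norm (X \<omega> - z') powr l * v \<omega> - norm (X \<omega> - z) powr l * v \<omega>\<bar>
          = \<bar>norm (X \<omega> - z') powr l - norm (X \<omega> - z) powr l\<bar> * \<bar>v \<omega>\<bar>"
        by (simp add: abs_mult[symmetric] left_diff_distrib)
      also have "\<dots> \<le> \<bar>norm (X \<omega> - z') powr l - norm (X \<omega> - z) powr l\<bar> * \<bar>w \<omega>\<bar>"
        using elim by (intro mult_left_mono) auto
      finally show ?case .
    qed
  qed (intro integrable_abs Bochner_Integration.integrable_diff I modulus_integrable)+
  finally show ?thesis .
qed

end

context potential
begin

lemma potential_abs: "potential l M X (\<lambda>\<omega>. \<bar>w \<omega>\<bar>)"
proof
  have "integrable M (\<lambda>\<omega>. \<bar>wgt l (X \<omega>) * w \<omega>\<bar>)" using w_int by (rule integrable_abs)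
  then show "integrable M (\<lambda>\<omega>. wgt l (X \<omega>) * \<bar>w \<omega>\<bar>)" by (simp add: abs_mult)
qed (use l_pos in measurable)

lemma isCont_pot: "isCont (pot l M X w) z"
proof -
  interpret A: potential l M X "\<lambda>\<omega>. \<bar>w \<omega>\<bar>" by (rule potential_abs)
  have "((\<lambda>z'. pot l M X w z' - pot l M X w z) \<longlongrightarrow> 0) (at z)"
  proof (rule tendsto_rabs_zero_cancel, rule tendsto_sandwich[OF _ _ tendsto_const A.modulus_tendsto_0[of z]])
    show "\<forall>\<^sub>F z' in at z. \<bar>pot l M X w z' - pot l M X w z\<bar> \<le> A.modulus z z'"
      by (intro always_eventually allI A.pot_diff_le_modulus) auto
  qed auto
  then show ?thesis
    unfolding isCont_def using LIM_zero_cancel by blast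
qed

lemma continuous_on_pot: "continuous_on S (pot l M X w)"
  by (intro continuous_at_imp_continuous_on ballI isCont_pot)

lemma borel_measurable_pot [measurable]: "pot l M X w \<in> borel_measurable borel"
  by (rule borel_measurable_continuous_onI[OF continuous_on_pot])

lemma pot_le:
  assumes "AE \<omega> in M. 0 \<le> w \<omega>"
  shows "pot l M X w z \<le> wgt l z * (\<integral>\<omega>. wgt l (X \<omega>) * w \<omega> \<partial>M)"
proof -
  have "pot l M X w z \<le> (\<integral>\<omega>. wgt l z * (wgt l (X \<omega>) * w \<omega>) \<partial>M)"
    unfolding pot_def
  proof (rule integral_mono_AE[OF pot_integrable integrable_mult_right[OF w_int]])
    show "AE \<omega> in M. norm (X \<omega> - z) powr l * w \<omega> \<le> wgt l z * (wgt l (X \<omega>) * w \<omega>)"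
      using assms
    proof eventually_elim
      case (elim \<omega>)
      then have "norm (X \<omega> - z) powr l * w \<omega> \<le> (wgt l (X \<omega>) * wgt l z) * w \<omega>"
        using l_pos by (intro mult_right_mono norm_diff_powr_le_wgt) auto
      then show ?case by (simp add: mult_ac)
    qed
  qed
  then show ?thesis by simp
qed

end

section \<open>Pointwise compactness and almost-everywhere arguments\<close>

text \<open>The pointwise half of Arzela-Ascoli: a diagonal sequence converges on a countable dense
  set, and equicontinuity makes it Cauchy everywhere else.\<close>

lemma equicontinuous_pointwise_convergent_subsequence:
  fixes F :: "nat \<Rightarrow> 'a::euclidean_space \<Rightarrow> real"
  assumes bdd: "\<And>n x. \<bar>F n x\<bar> \<le> B x"
    and equi: "\<And>x e. e > 0 \<Longrightarrow> \<exists>d>0. \<forall>n y. dist y x < d \<longrightarrow> \<bar>F n y - F n x\<bar> < e"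
  obtains k :: "nat \<Rightarrow> nat" where "strict_mono k" "\<And>x. convergent (\<lambda>n. F (k n) x)"
proof -
  obtain D :: "'a set" where D: "countable D" "\<And>X. open X \<Longrightarrow> X \<noteq> {} \<Longrightarrow> \<exists>d\<in>D. d \<in> X"
    using countable_dense_setE by blast
  \<comment> \<open>\<open>function_convergent_subsequence\<close> takes one bound for all points,
    whereas \<open>B\<close> varies with \<open>x\<close>; dividing by
    \<open>1 + \<bar>B x\<bar>\<close> gives the bound 1 without affecting convergence.\<close>
  define G where "G n x = F n x / (1 + \<bar>B x\<bar>)" for n x
  have "norm (G n x) \<le> 1" for n x
  proof -
    have "\<bar>F n x\<bar> \<le> 1 + \<bar>B x\<bar>" using bdd[of n x] by linarith
    moreover have "\<bar>1 + \<bar>B x\<bar>\<bar> = 1 + \<bar>B x\<bar>" by simp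
    ultimately show ?thesis unfolding G_def real_norm_def abs_divide
      by (metis abs_ge_zero add_pos_nonneg divide_le_eq_1_pos zero_less_one)
  qed
  then obtain k where k: "strict_mono (k::nat\<Rightarrow>nat)" "\<And>x. x \<in> D \<Longrightarrow> \<exists>l. (\<lambda>n. G (k n) x) \<longlonglongrightarrow> l"
    using function_convergent_subsequence[OF D(1), of G 1] by metis
  have conv: "convergent (\<lambda>n. F (k n) x)" if xD: "x \<in> D" for x
  proof -
    obtain c where "(\<lambda>n. G (k n) x) \<longlonglongrightarrow> c" using k(2)[OF xD] by blast
    then have "(\<lambda>n. (1 + \<bar>B x\<bar>) * G (k n) x) \<longlonglongrightarrow> (1 + \<bar>B x\<bar>) * c" by (intro tendsto_intros)
    moreover have "(1 + \<bar>B x\<bar>) * G (k n) x = F (k n) x" for n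
      unfolding G_def by (simp add: add_nonneg_eq_0_iff)
    ultimately show ?thesis unfolding convergent_def by auto
  qed
  have "convergent (\<lambda>n. F (k n) x)" for x
    unfolding Cauchy_convergent_iff[symmetric]
  proof (rule CauchyI)
    fix e :: real assume e: "e > 0"
    obtain d where d: "d > 0" "\<And>n y. dist y x < d \<Longrightarrow> \<bar>F n y - F n x\<bar> < e / 3"
      using equi[of "e/3" x] e by auto
    have "ball x d \<noteq> {}" using d(1) by simp
    then obtain y where y: "y \<in> D" "y \<in> ball x d" using D(2)[of "ball x d"] by auto
    have yd: "dist y x < d" using y(2) by (simp add: dist_commute)
    have "Cauchy (\<lambda>n. F (k n) y)" using conv[OF y(1)] Cauchy_convergent_iff by blast
    then obtain N where N: "\<And>m n. m \<ge> N \<Longrightarrow> n \<ge> N \<Longrightarrow> norm (F (k m) y - F (k n) y) < e / 3"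
      using CauchyD[of "\<lambda>n. F (k n) y" "e/3"] e by auto
    have "norm (F (k m) x - F (k n) x) < e" if "m \<ge> N" "n \<ge> N" for m n
      using N[OF that] d(2)[OF yd, of "k m"] d(2)[OF yd, of "k n"] by (auto simp: abs_if split: if_splits)
    then show "\<exists>N. \<forall>m\<ge>N. \<forall>n\<ge>N. norm (F (k m) x - F (k n) x) < e" by blast
  qed
  then show ?thesis using that k(1) by blast
qed

text \<open>The points of \<open>S\<close> where \<open>f\<close> is nonzero form an open set, and a
  nonempty open set is not negligible.\<close>

lemma AE_lborel_continuous_eq_0D:
  fixes f :: "'a::euclidean_space \<Rightarrow> real"
  assumes "AE x in lborel. x \<in> S \<longrightarrow> f x = 0" "open S" "continuous_on S f" "x \<in> S"
  shows "f x = 0"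
proof (rule ccontr)
  assume nz: "f x \<noteq> 0"
  have o: "open {x \<in> S. f x \<noteq> 0}"
  proof -
    have "open (S \<inter> f -` (- {0}))"
      using assms(2,3) continuous_open_preimage[of S f "- {0}"] by auto
    also have "S \<inter> f -` (- {0}) = {x \<in> S. f x \<noteq> 0}" by auto
    finally show ?thesis .
  qed
  obtain N where N: "N \<in> null_sets lborel" "{x \<in> space lborel. \<not> (x \<in> S \<longrightarrow> f x = 0)} \<subseteq> N"
    using assms(1) unfolding eventually_ae_filter by auto
  have "{x \<in> S. f x \<noteq> 0} \<subseteq> N" using N(2) by auto
  moreover have "negligible N"
    using N(1) by (simp add: negligible_iff_null_sets null_sets_completionI)
  ultimately have "negligible {x \<in> S. f x \<noteq> 0}" by (rule negligible_subset[rotated])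
  then show False using open_not_negligible[OF o] nz assms(4) by blast
qed

lemma AE_lborel_notin_openD:
  fixes S :: "'a::euclidean_space set"
  assumes "AE x in lborel. x \<notin> S" "open S"
  shows "S = {}"
proof (rule ccontr)
  assume "S \<noteq> {}"
  then obtain x where x: "x \<in> S" by blast
  have "(1::real) = 0"
  proof (rule AE_lborel_continuous_eq_0D[of S "\<lambda>_. 1" x])
    show "AE x in lborel. x \<in> S \<longrightarrow> (1::real) = 0"
      using assms(1) by eventually_elim simp
  qed (use x assms(2) in auto)
  then show False by simp
qed

lemma integrable_real_boundI:
  fixes f g :: "'b \<Rightarrow> real"
  assumes "integrable M g" "f \<in> borel_measurable M" "\<And>x. x \<in> space M \<Longrightarrow> \<bar>f x\<bar> \<le> g x"
  shows "integrable M f"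
  using assms(1,2)
proof (rule Bochner_Integration.integrable_bound)
  show "AE x in M. norm (f x) \<le> norm (g x)"
  proof (rule AE_I2)
    fix x assume "x \<in> space M"
    then show "norm (f x) \<le> norm (g x)" using assms(3)[of x] by simp
  qed
qed

section \<open>Lebesgue measure on the half-space\<close>

text \<open>Built on \<open>lborel\<close> so that continuous and Borel functions are measurable at
  once and products fit Fubini. The passage to \<open>lebesgue_on half_space\<close> is made only
  when the original problem is reached.\<close>

definition hs :: "((real^'m) \<times> real) measure" where
  "hs = restrict_space lborel half_space"

lemma open_half_space: "open (half_space :: ((real^'m) \<times> real) set)"
  unfolding half_space_def by (intro open_Collect_less continuous_intros)

lemma space_hs [simp]: "space hs = half_space"
  unfolding hs_def by (simp add: space_restrict_space)

lemma borel_measurable_hs: "f \<in> borel_measurable borel \<Longrightarrow> f \<in> borel_measurable hs"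
  unfolding hs_def by (rule measurable_restrict_space1) simp

lemma sets_hs_Int: "half_space \<inter> space lborel \<in> sets lborel"
  using borel_open[OF open_half_space] by simp

lemma AE_hs_iff: "(AE y in hs. P y) \<longleftrightarrow> (AE y in lborel. y \<in> half_space \<longrightarrow> P y)"
  unfolding hs_def by (rule AE_restrict_space_iff[OF sets_hs_Int])

lemma sigma_finite_hs: "sigma_finite_measure (hs :: ((real^'m) \<times> real) measure)"
  unfolding hs_def
  by (rule sigma_finite_measure_restrict_space) (use borel_open[OF open_half_space] sigma_finite_lborel in auto)

lemma integrable_hs: 
  fixes f :: "(real^'m) \<times> real \<Rightarrow> real"
  assumes "integrable lborel f" shows "integrable hs f"
  unfolding hs_def integrable_restrict_space[OF sets_hs_Int]
  by (rule integrable_mult_indicator[OF _ assms]) (use borel_open[OF open_half_space] in simp)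

text \<open>A ball so far from the boundary that \<open>|y - x| \<ge> (1 + |x|) / 3\<close> for its points \<open>y\<close> and all boundary points \<open>x\<close>.\<close>

lemma half_space_ball: "ball (0, 4) 1 \<subseteq> (half_space :: ((real^'m) \<times> real) set)"
  and ball_norm_less: "y \<in> ball (0, 4) 1 \<Longrightarrow> norm (y :: (real^'m) \<times> real) < 5"
  and ball_snd_gt: "y \<in> ball (0, 4) 1 \<Longrightarrow> 3 < snd (y :: (real^'m) \<times> real)"
proof -
  have 1: "3 < snd y" if "y \<in> ball (0, 4) 1" for y :: "(real^'m) \<times> real"
  proof -
    have "dist (snd y) 4 < 1"
      using that dist_snd_le[of y "(0,4)"] by (simp add: dist_commute)
    then show ?thesis by (simp add: dist_real_def)
  qed
  then show "y \<in> ball (0, 4) 1 \<Longrightarrow> 3 < snd (y :: (real^'m) \<times> real)" .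
  show "ball (0, 4) 1 \<subseteq> (half_space :: ((real^'m) \<times> real) set)"
    unfolding half_space_def using 1 by fastforce
  assume y: "y \<in> ball (0, 4) 1"
  have "norm y \<le> norm ((0::real^'m, 4::real)) + norm (y - (0, 4))"
    using norm_triangle_sub by blast
  also have "\<dots> < 4 + 1" using y by (intro add_le_less_mono) (auto simp: norm_Pair dist_norm norm_minus_commute)
  finally show "norm y < 5" by simp
qed

lemma hs_integral_pos:
  fixes f :: "(real^'m) \<times> real \<Rightarrow> real"
  assumes "integrable hs f" "\<And>y. y \<in> half_space \<Longrightarrow> 0 \<le> f y"
    and "open B" "B \<noteq> {}" "B \<subseteq> half_space" "\<And>y. y \<in> B \<Longrightarrow> 0 < f y"
  shows "0 < integral\<^sup>L hs f"
proof (rule ccontr)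
  assume "\<not> 0 < integral\<^sup>L hs f"
  moreover have nn: "AE y in hs. 0 \<le> f y" using assms(2) by (intro AE_I2) simp
  ultimately have "integral\<^sup>L hs f = 0"
    using integral_nonneg_AE[OF nn] by linarith
  then have "AE y in hs. f y = 0"
    using integral_nonneg_eq_0_iff_AE[OF assms(1) nn] by simp
  then have "AE y in lborel. y \<notin> B"
    unfolding AE_hs_iff using assms(5,6) by (auto elim!: eventually_mono) (metis less_irrefl subsetD)
  then show False using AE_lborel_notin_openD[OF _ assms(3)] assms(4) by blast
qed

subsection \<open>Extension of boundary densities\<close>

definition bpot :: "real \<Rightarrow> (real^'m \<Rightarrow> real) \<Rightarrow> (real^'m) \<times> real \<Rightarrow> real" where
  "bpot l f = pot l lborel (\<lambda>x. (x, 0)) f"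

text \<open>The adjoint of \<open>bpot\<close>: the same kernel, integrated over the half-space and
  evaluated on the boundary. The function \<open>\<phi>\<close> of the overview is of this
  form.\<close>

definition hpot :: "real \<Rightarrow> ((real^'m) \<times> real \<Rightarrow> real) \<Rightarrow> real^'m \<Rightarrow> real" where
  "hpot l w x = pot l hs (\<lambda>y. y) w (x, 0)"

text \<open>These are the densities whose extension is finite and positive everywhere. That
  finiteness at one point of the half-space already forces the weighted integrability is shown in
  \<open>admissible_cases\<close>.\<close>

definition dens :: "real \<Rightarrow> (real^'m \<Rightarrow> real) \<Rightarrow> bool" where
  "dens l f \<longleftrightarrow> l > 0 \<and> f \<in> borel_measurable borel \<and> (\<forall>x. 0 \<le> f x) \<and>
     integrable lborel (\<lambda>x. wgt l x * f x) \<and> 0 < integral\<^sup>L lborel f"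

lemma bpot_eq: "bpot l f z = (\<integral>x. norm ((x, 0) - z) powr l * f x \<partial>lborel)"
  unfolding bpot_def pot_def ..

lemma borel_measurable_Pair_zero [measurable]:
  "(\<lambda>x::real^'m. (x, 0::real)) \<in> borel_measurable borel"
  by (intro borel_measurable_continuous_onI continuous_intros)

locale boundary_density =
  fixes l :: real and f :: "real^'m \<Rightarrow> real"
  assumes dens: "dens l f"
begin

lemma l_gt_0: "l > 0" and f_borel [measurable]: "f \<in> borel_measurable borel"
  and f_nonneg: "0 \<le> f x" and f_int: "integrable lborel (\<lambda>x. wgt l x * f x)"
  and mass_pos: "0 < integral\<^sup>L lborel f"
  using dens unfolding dens_def by auto

sublocale P: potential l lborel "\<lambda>x. (x, 0)" f
  using l_gt_0 f_int by unfold_locales (auto simp: measurable_lborel1)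

lemmas bpot_integrable = P.pot_integrable
lemmas mass_integrable = P.w_integrable

lemma continuous_on_bpot: "continuous_on S (bpot l f)"
  unfolding bpot_def by (rule P.continuous_on_pot)

lemma borel_measurable_bpot [measurable]: "bpot l f \<in> borel_measurable borel"
  unfolding bpot_def by (rule P.borel_measurable_pot)

lemma bpot_le: "bpot l f z \<le> wgt l z * (\<integral>x. wgt l x * f x \<partial>lborel)"
  unfolding bpot_def using P.pot_le[of z] f_nonneg by simp

text \<open>For fixed \<open>z\<close> the kernel vanishes at one boundary point at most, a null
  set, so a zero potential would force zero mass.\<close>

lemma bpot_pos: "0 < bpot l f z"
proof (rule ccontr)
  assume "\<not> 0 < bpot l f z"
  have nn: "AE x in lborel. 0 \<le> norm ((x, 0) - z) powr l * f x"
    using f_nonneg by simp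
  have "bpot l f z = 0"
    using \<open>\<not> 0 < bpot l f z\<close> integral_nonneg_AE[OF nn] unfolding bpot_eq by linarith
  then have "AE x in lborel. norm ((x, 0) - z) powr l * f x = 0"
    unfolding bpot_eq using integral_nonneg_eq_0_iff_AE[OF bpot_integrable nn] by simp
  moreover have "AE x in lborel. x \<noteq> fst z" by (rule AE_lborel_singleton)
  ultimately have "AE x in lborel. f x = 0"
    by eventually_elim (auto simp: prod_eq_iff)
  then have "integral\<^sup>L lborel f = (\<integral>x. 0 \<partial>(lborel :: (real^'m) measure))"
    by (intro integral_cong_AE) auto
  then show False using mass_pos by simp
qed

text \<open>The quasi-triangle inequality for \<open>z\<close> and 0 through the boundary point
  \<open>(x, 0)\<close>, integrated against \<open>f\<close>.\<close>

lemma bpot_coercive: "norm z powr l * integral\<^sup>L lborel f \<le> 2 powr l * (bpot l f z + bpot l f 0)"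
proof -
  have "norm z powr l * integral\<^sup>L lborel f = (\<integral>x. norm z powr l * f x \<partial>lborel)" by simp
  also have "\<dots> \<le> (\<integral>x. 2 powr l * (norm ((x, 0) - z) powr l * f x + norm ((x, 0) - (0 :: (real^'m) \<times> real)) powr l * f x) \<partial>lborel)"
  proof (rule integral_mono)
    fix x
    have "norm (z - 0) powr l * f x \<le> 2 powr l * (norm ((x, 0) - z) powr l + norm ((x, 0) - (0 :: (real^'m) \<times> real)) powr l) * f x"
      using l_gt_0 f_nonneg by (intro mult_right_mono norm_powr_quasi_triangle) auto
    then show "norm z powr l * f x \<le> 2 powr l * (norm ((x, 0) - z) powr l * f x + norm ((x, 0) - (0 :: (real^'m) \<times> real)) powr l * f x)"
      by (simp add: algebra_simps)
  qed (intro integrable_mult_right Bochner_Integration.integrable_add bpot_integrable mass_integrable)+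
  also have "\<dots> = 2 powr l * (bpot l f z + bpot l f 0)"
    unfolding bpot_eq
    by (simp only: integral_mult_right_zero Bochner_Integration.integral_add[OF bpot_integrable bpot_integrable])
  finally show ?thesis .
qed

lemma bpot_le_quasi: "bpot l f z \<le> 2 powr l * (norm z powr l * integral\<^sup>L lborel f + bpot l f 0)"
proof -
  have "bpot l f z \<le> (\<integral>x. 2 powr l * (norm ((x, 0) - (0 :: (real^'m) \<times> real)) powr l * f x + norm z powr l * f x) \<partial>lborel)"
    unfolding bpot_eq
  proof (rule integral_mono)
    fix x
    have "norm ((x, 0) - z) powr l * f x \<le> 2 powr l * (norm (0 - (x, 0::real)) powr l + norm (0 - z) powr l) * f x"
      using l_gt_0 f_nonneg by (intro mult_right_mono norm_powr_quasi_triangle) auto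
    then show "norm ((x, 0) - z) powr l * f x \<le> 2 powr l * (norm ((x, 0) - (0 :: (real^'m) \<times> real)) powr l * f x + norm z powr l * f x)"
      by (simp add: algebra_simps norm_Pair)
  qed (intro integrable_mult_right Bochner_Integration.integrable_add bpot_integrable mass_integrable)+
  also have "\<dots> = 2 powr l * (bpot l f 0 + norm z powr l * integral\<^sup>L lborel f)"
    unfolding bpot_eq
    by (simp only: integral_mult_right_zero Bochner_Integration.integral_add[OF bpot_integrable integrable_mult_right[OF mass_integrable]])
  finally show ?thesis by (simp add: add.commute)
qed

text \<open>Moving vertically to the boundary brings a point closer to every boundary point; a
  global minimum may therefore be sought on the boundary.\<close>

lemma bpot_boundary_le: "bpot l f (x, 0) \<le> bpot l f (x, t)"
  unfolding bpot_eq
proof (rule integral_mono)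
  fix x'
  have "norm ((x', 0) - (x, 0::real)) \<le> norm ((x', 0) - (x, t))"
    by (simp add: norm_Pair)
  then show "norm ((x', 0) - (x, 0::real)) powr l * f x' \<le> norm ((x', 0) - (x, t)) powr l * f x'"
    using l_gt_0 f_nonneg by (intro mult_right_mono powr_mono2) auto
qed (rule bpot_integrable)+

lemma bpot_attains_min:
  obtains x0 where "\<And>z. bpot l f (x0, 0) \<le> bpot l f z"
proof -
  define M where "M = integral\<^sup>L lborel f"
  have M: "M > 0" unfolding M_def by (rule mass_pos)
  \<comment> \<open>Chosen so that \<open>bpot_coercive\<close> gives at least
    \<open>bpot l f 0\<close> outside the ball of radius \<open>R\<close>, which confines the
    minimization to a compact set.\<close>
  define R where "R = (2 * 2 powr l * bpot l f 0 / M) powr (1 / l)"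
  have Rl: "R powr l = 2 * 2 powr l * bpot l f 0 / M"
    unfolding R_def using l_gt_0 M bpot_pos[of 0] by (simp add: powr_powr)
  have R: "R \<ge> 0" unfolding R_def by simp
  have out: "bpot l f 0 \<le> bpot l f (x, 0)" if "norm x > R" for x
  proof -
    have "R powr l \<le> norm x powr l" using that R l_gt_0 by (intro powr_mono2) auto
    then have "2 * 2 powr l * bpot l f 0 \<le> norm x powr l * M"
      unfolding Rl using M by (simp add: divide_simps)
    also have "\<dots> \<le> 2 powr l * (bpot l f (x, 0) + bpot l f 0)"
      using bpot_coercive[of "(x, 0)"] unfolding M_def by (simp add: norm_Pair)
    finally have "2 powr l * (2 * bpot l f 0) \<le> 2 powr l * (bpot l f (x, 0) + bpot l f 0)" by simp
    then show ?thesis by simp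
  qed
  have "continuous_on (cball 0 R) (\<lambda>x. bpot l f (x, 0))"
    by (rule continuous_on_compose2[OF continuous_on_bpot[of UNIV]]) (auto intro!: continuous_intros)
  moreover have "compact (cball 0 R :: (real^'m) set)" "cball 0 R \<noteq> ({} :: (real^'m) set)" using R by auto
  ultimately obtain x0 where x0: "x0 \<in> cball 0 R" "\<And>x. x \<in> cball 0 R \<Longrightarrow> bpot l f (x0, 0) \<le> bpot l f (x, 0)"
    using continuous_attains_inf by metis
  have min: "bpot l f (x0, 0) \<le> bpot l f (x, 0)" for x
  proof (cases "norm x > R")
    case True
    have "bpot l f (x0, 0) \<le> bpot l f (0, 0)" using x0(2)[of 0] R by simp
    also have "\<dots> \<le> bpot l f (x, 0)" using out[OF True] by (simp add: zero_prod_def)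
    finally show ?thesis .
  qed (use x0(2)[of x] in simp)
  have "bpot l f (x0, 0) \<le> bpot l f z" for z
    using min[of "fst z"] bpot_boundary_le[of "fst z" "snd z"] by simp
  then show ?thesis using that by blast
qed

text \<open>Coercivity bounds \<open>norm z powr l\<close>, and the lower bound \<open>A\<close>
  absorbs the constant terms into \<open>u\<close>. The constant is kept explicit because, for
  centred densities, it becomes a number depending on \<open>l\<close> only, divided by the
  mass.\<close>

lemma bpot_ge_aux:
  assumes "A > 0" "\<And>z. A \<le> bpot l f z"
  shows "wgt l z \<le> 2 powr l * (1 / A + 2 powr l * (1 + bpot l f 0 / A) / integral\<^sup>L lborel f) * bpot l f z"
proof -
  define M where "M = integral\<^sup>L lborel f"
  have M: "M > 0" unfolding M_def by (rule mass_pos)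
  define u where "u = bpot l f z"
  have u: "A \<le> u" unfolding u_def by (rule assms)
  define u0 where "u0 = bpot l f 0"
  have u0: "u0 > 0" unfolding u0_def by (rule bpot_pos)
  have "norm z powr l * M \<le> 2 powr l * (u + u0)"
    unfolding u_def u0_def M_def by (rule bpot_coercive)
  also have "u + u0 \<le> (1 + u0 / A) * u"
    using assms(1) u0 u by (simp add: field_simps)
  finally have "norm z powr l * M \<le> 2 powr l * ((1 + u0 / A) * u)" by simp
  then have 1: "norm z powr l \<le> 2 powr l * (1 + u0 / A) / M * u"
    using M by (simp add: field_simps)
  have 2: "1 \<le> 1 / A * u" using assms(1) u by (simp add: field_simps)
  have "wgt l z \<le> 2 powr l * (1 + norm z powr l)"
    using l_gt_0 by (intro wgt_le_norm_powr) simp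
  also have "\<dots> \<le> 2 powr l * (1 / A * u + 2 powr l * (1 + u0 / A) / M * u)"
    using 1 2 by (intro mult_left_mono add_mono) auto
  also have "\<dots> = 2 powr l * (1 / A + 2 powr l * (1 + u0 / A) / M) * u"
    by (simp add: algebra_simps)
  finally show ?thesis unfolding u_def u0_def M_def .
qed

text \<open>With \<open>bpot_le\<close> this makes the potential comparable with
  \<open>wgt l\<close>, so its negative powers inherit the integrability of weights.\<close>

lemma bpot_ge:
  obtains c where "c > 0" "\<And>z. c * wgt l z \<le> bpot l f z"
proof -
  obtain x0 where x0: "\<And>z. bpot l f (x0, 0) \<le> bpot l f z" using bpot_attains_min by blast
  define A where "A = bpot l f (x0, 0)"
  define C where "C = 2 powr l * (1 / A + 2 powr l * (1 + bpot l f 0 / A) / integral\<^sup>L lborel f)"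
  have A: "A > 0" unfolding A_def by (rule bpot_pos)
  have C: "C > 0" unfolding C_def using A bpot_pos[of 0] mass_pos
    by (intro mult_pos_pos add_pos_nonneg divide_pos_pos divide_nonneg_nonneg mult_nonneg_nonneg add_nonneg_nonneg) auto
  have "wgt l z \<le> C * bpot l f z" for z
    unfolding C_def using A x0 by (intro bpot_ge_aux) (auto simp: A_def)
  then have "1 / C * wgt l z \<le> bpot l f z" for z
    using C by (simp add: field_simps)
  then show ?thesis using that[of "1 / C"] C by simp
qed

end

subsection \<open>Potentials of half-space weights\<close>

lemma hpot_eq: "hpot l w x = (\<integral>y. norm (y - (x, 0)) powr l * w y \<partial>hs)"
  unfolding hpot_def pot_def ..

lemma wgt_integrable_hs:
  assumes "a > real CARD('m) + 1"
  shows "integrable hs (\<lambda>y :: (real^'m) \<times> real. wgt (- a) y)"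
  by (rule integrable_hs, rule wgt_integrable) (use assms in simp)

text \<open>\<open>b\<close> is the rate of decay. Its excess over the growth \<open>l\<close> of
  the kernel must exceed the dimension of the half-space for the potential of \<open>w\<close> to
  converge.\<close>

locale half_space_weight =
  fixes l b hi :: real and w :: "(real^'m) \<times> real \<Rightarrow> real"
  assumes l0: "l > 0" and bl: "b - l > real CARD('m) + 1" and w_borel [measurable]: "w \<in> borel_measurable borel"
    and w_nonneg: "0 \<le> w y" and w_le: "w y \<le> hi * wgt (- b) y"
begin

lemma wgt_w_le: "wgt l y * w y \<le> hi * wgt (- (b - l)) y"
proof -
  have "wgt l y * w y \<le> wgt l y * (hi * wgt (- b) y)"
    by (intro mult_left_mono w_le) simp
  also have "\<dots> = hi * (wgt l y * wgt (- b) y)" by simp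
  also have "\<dots> = hi * wgt (- (b - l)) y" unfolding wgt_mult by simp
  finally show ?thesis .
qed

lemma wgt_w_integrable: "integrable hs (\<lambda>y. wgt l y * w y)"
proof (rule integrable_real_boundI)
  show "integrable hs (\<lambda>y :: (real^'m) \<times> real. hi * wgt (- (b - l)) y)"
    by (intro integrable_mult_right wgt_integrable_hs bl)
  show "(\<lambda>y. wgt l y * w y) \<in> borel_measurable hs"
    by (rule borel_measurable_hs) measurable
  show "\<bar>wgt l y * w y\<bar> \<le> hi * wgt (- (b - l)) y" for y
    using wgt_w_le[of y] w_nonneg[of y] by simp
qed

sublocale Q: potential l hs "\<lambda>y. y" w
proof
  show "(\<lambda>y. y) \<in> borel_measurable hs" "w \<in> borel_measurable hs"
    by (intro borel_measurable_hs; measurable)+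
qed (use l0 wgt_w_integrable in auto)

lemma hpot_integrable: "integrable hs (\<lambda>y. norm (y - (x, 0)) powr l * w y)"
  by (rule Q.pot_integrable)

lemma continuous_on_hpot: "continuous_on S (hpot l w)"
proof -
  have "continuous_on S (\<lambda>x. pot l hs (\<lambda>y. y) w (x, 0))"
    by (rule continuous_on_compose2[OF Q.continuous_on_pot[of UNIV]]) (auto intro!: continuous_intros)
  then show ?thesis unfolding hpot_def[abs_def] .
qed

lemma borel_measurable_hpot [measurable]: "hpot l w \<in> borel_measurable borel"
  by (rule borel_measurable_continuous_onI[OF continuous_on_hpot])

lemma hpot_le: "hpot l w x \<le> hi * (\<integral>y. wgt (- (b - l)) y \<partial>(hs :: ((real^'m) \<times> real) measure)) * wgt l x"
proof -
  have "hpot l w x \<le> wgt l (x, 0::real) * (\<integral>y. wgt l y * w y \<partial>hs)"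
    unfolding hpot_def using Q.pot_le[of "(x, 0)"] w_nonneg by simp
  also have "\<dots> \<le> wgt l (x, 0::real) * (\<integral>y. hi * wgt (- (b - l)) y \<partial>(hs :: ((real^'m) \<times> real) measure))"
    by (intro mult_left_mono integral_mono wgt_w_integrable integrable_mult_right wgt_integrable_hs bl wgt_w_le) simp
  finally show ?thesis by (simp add: mult_ac)
qed

text \<open>Only the contribution of one fixed ball is kept, on which the kernel is at least a
  multiple of \<open>wgt l x\<close>. Hence \<open>w\<close> enters the bound through
  \<open>lo\<close> alone, as needed for uniformity along a sequence.\<close>

lemma hpot_ge:
  assumes lo: "lo > 0" "\<And>y. y \<in> half_space \<Longrightarrow> lo * wgt (- b) y \<le> w y"
  shows "lo * ((1 / 3) powr l * (\<integral>y. indicator (ball (0, 4) 1) y * wgt (- b) y \<partial>(hs :: ((real^'m) \<times> real) measure))) * wgt l x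
    \<le> hpot l w x" (is "lo * (?k * ?I) * _ \<le> _")
    and "0 < (1 / 3) powr l * (\<integral>y. indicator (ball (0, 4) 1) y * wgt (- b) y \<partial>(hs :: ((real^'m) \<times> real) measure))"
proof -
  let ?B = "ball (0, 4) 1 :: ((real^'m) \<times> real) set"
  have int: "integrable hs (\<lambda>y. indicator ?B y * wgt (- b) y)"
  proof (rule integrable_real_boundI)
    show "integrable hs (\<lambda>y :: (real^'m) \<times> real. wgt (- b) y)"
      using bl l0 by (intro wgt_integrable_hs) simp
    show "(\<lambda>y. indicator ?B y * wgt (- b) y) \<in> borel_measurable hs"
      by (intro borel_measurable_hs borel_measurable_times borel_measurable_indicator borel_measurable_wgt) auto
  qed (auto simp: indicator_def)
  have "0 < ?I"
    by (rule hs_integral_pos[OF int, of ?B]) (use half_space_ball in \<open>auto simp: indicator_def\<close>)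
  then show "0 < ?k * ?I" by simp
  have "lo * (?k * ?I) * wgt l x = (\<integral>y. lo * ?k * wgt l x * (indicator ?B y * wgt (- b) y) \<partial>hs)"
    by simp
  also have "\<dots> \<le> hpot l w x"
    unfolding hpot_eq
  proof (rule integral_mono[OF integrable_mult_right[OF int] hpot_integrable])
    fix y :: "(real^'m) \<times> real" assume "y \<in> space hs"
    then have y: "y \<in> half_space" by simp
    show "lo * ?k * wgt l x * (indicator ?B y * wgt (- b) y) \<le> norm (y - (x, 0)) powr l * w y"
    proof (cases "y \<in> ?B")
      case True
      have "\<bar>snd (y - (x, 0))\<bar> \<le> norm (y - (x, 0))" by (metis norm_snd_le real_norm_def prod.collapse)
      then have "3 \<le> norm (y - (x, 0))" using ball_snd_gt[OF True] by simp
      moreover have "norm x - 5 \<le> norm (y - (x, 0))"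
        using ball_norm_less[OF True] norm_triangle_ineq2[of "(x, 0::real)" y]
        by (simp add: norm_Pair norm_minus_commute)
      \<comment> \<open>The mean of the two preceding lower bounds with weights 2/3 and 1/3:
        \<open>2 + (norm x - 5) / 3\<close> is exactly \<open>(1 + norm x) / 3\<close>.\<close>
      ultimately have "1 / 3 * (1 + norm x) \<le> norm (y - (x, 0))" by (simp add: field_simps)
      then have "(1 / 3 * (1 + norm x)) powr l \<le> norm (y - (x, 0)) powr l"
        using l0 by (intro powr_mono2) (auto simp: add_nonneg_nonneg)
      then have "?k * wgt l x \<le> norm (y - (x, 0)) powr l"
        unfolding wgt_def powr_mult .
      then have "(?k * wgt l x) * (lo * wgt (- b) y) \<le> norm (y - (x, 0)) powr l * w y"
        using lo y by (intro mult_mono) auto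
      then show ?thesis using True by (simp add: mult_ac)
    qed (use w_nonneg in simp)
  qed
  finally show "lo * (?k * ?I) * wgt l x \<le> hpot l w x" .
qed

end

text \<open>Tonelli for nonnegative integrands. The left side is finite since the potential grows at
  most like \<open>wgt l\<close>, and the equality of the extended integrals passes finiteness to
  the right side.\<close>

lemma bpot_hpot_duality:
  fixes f :: "real^'m \<Rightarrow> real"
  assumes "dens l f" "half_space_weight l b hi w"
  shows "integrable hs (\<lambda>y. bpot l f y * w y)"
    and "integrable lborel (\<lambda>x. f x * hpot l w x)"
    and "(\<integral>y. bpot l f y * w y \<partial>hs) = (\<integral>x. f x * hpot l w x \<partial>lborel)"
proof -
  interpret F: boundary_density l f by unfold_locales (rule assms)
  interpret W: half_space_weight l b hi w by (rule assms)
  interpret H: sigma_finite_measure "hs :: ((real^'m) \<times> real) measure" by (rule sigma_finite_hs)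
  interpret PS: pair_sigma_finite "lborel :: (real^'m) measure" "hs :: ((real^'m) \<times> real) measure" ..
  define C where "C = (\<integral>x. wgt l x * f x \<partial>lborel)"
  have m[measurable]: "(\<lambda>y. y) \<in> borel_measurable hs" "w \<in> borel_measurable hs" "bpot l f \<in> borel_measurable hs"
    by (intro borel_measurable_hs; measurable)+
  have [measurable]: "(\<lambda>x::real^'m. (x, 0::real)) \<in> borel_measurable lborel" "f \<in> borel_measurable lborel"
    "hpot l w \<in> borel_measurable lborel"
    by (auto simp: measurable_lborel1)
  have bn: "0 \<le> bpot l f y" for y using F.bpot_pos[of y] by simp
  have hn: "0 \<le> hpot l w x" for x
    unfolding hpot_eq using W.w_nonneg by (intro integral_nonneg_AE AE_I2) auto
  show i1: "integrable hs (\<lambda>y. bpot l f y * w y)"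
  proof (rule integrable_real_boundI)
    show "integrable hs (\<lambda>y. C * (wgt l y * w y))"
      by (intro integrable_mult_right W.wgt_w_integrable)
    show "\<bar>bpot l f y * w y\<bar> \<le> C * (wgt l y * w y)" for y
    proof -
      have "bpot l f y * w y \<le> (wgt l y * C) * w y"
        unfolding C_def by (intro mult_right_mono F.bpot_le W.w_nonneg)
      then show ?thesis using bn[of y] W.w_nonneg[of y] by (simp add: mult_ac abs_mult)
    qed
  qed measurable
  have "(\<integral>\<^sup>+y. ennreal (bpot l f y * w y) \<partial>hs) = (\<integral>\<^sup>+y. (\<integral>\<^sup>+x. ennreal (norm (y - (x, 0)) powr l * f x * w y) \<partial>lborel) \<partial>hs)"
  proof (rule nn_integral_cong)
    fix y
    have "(\<integral>\<^sup>+x. ennreal (norm (y - (x, 0)) powr l * f x * w y) \<partial>lborel) = (\<integral>\<^sup>+x. ennreal (w y) * ennreal (norm ((x, 0) - y) powr l * f x) \<partial>lborel)"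
      using W.w_nonneg[of y] F.f_nonneg by (intro nn_integral_cong) (simp add: ennreal_mult[symmetric] mult_ac norm_minus_commute)
    also have "\<dots> = ennreal (w y) * ennreal (bpot l f y)"
    proof (subst nn_integral_cmult)
      have "(\<integral>\<^sup>+x. ennreal (norm ((x, 0) - y) powr l * f x) \<partial>lborel) = ennreal (bpot l f y)"
        unfolding bpot_eq using F.f_nonneg by (intro nn_integral_eq_integral F.bpot_integrable AE_I2) simp
      then show "ennreal (w y) * (\<integral>\<^sup>+x. ennreal (norm ((x, 0) - y) powr l * f x) \<partial>lborel) = ennreal (w y) * ennreal (bpot l f y)"
        by simp
    qed measurable
    also have "\<dots> = ennreal (bpot l f y * w y)"
      using W.w_nonneg[of y] bn[of y] by (simp add: ennreal_mult[symmetric] mult.commute)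
    finally show "ennreal (bpot l f y * w y) = (\<integral>\<^sup>+x. ennreal (norm (y - (x, 0)) powr l * f x * w y) \<partial>lborel)" ..
  qed
  also have "\<dots> = (\<integral>\<^sup>+x. (\<integral>\<^sup>+y. ennreal (norm (y - (x, 0)) powr l * f x * w y) \<partial>hs) \<partial>lborel)"
    by (rule PS.Fubini') measurable
  also have "\<dots> = (\<integral>\<^sup>+x. ennreal (f x * hpot l w x) \<partial>lborel)"
  proof (rule nn_integral_cong)
    fix x
    have "(\<integral>\<^sup>+y. ennreal (norm (y - (x, 0)) powr l * f x * w y) \<partial>hs) = (\<integral>\<^sup>+y. ennreal (f x) * ennreal (norm (y - (x, 0)) powr l * w y) \<partial>hs)"
      using W.w_nonneg F.f_nonneg by (intro nn_integral_cong) (simp add: ennreal_mult[symmetric] mult_ac)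
    also have "\<dots> = ennreal (f x) * ennreal (hpot l w x)"
    proof (subst nn_integral_cmult)
      have "(\<integral>\<^sup>+y. ennreal (norm (y - (x, 0)) powr l * w y) \<partial>hs) = ennreal (hpot l w x)"
        unfolding hpot_eq using W.w_nonneg by (intro nn_integral_eq_integral W.hpot_integrable AE_I2) simp
      then show "ennreal (f x) * (\<integral>\<^sup>+y. ennreal (norm (y - (x, 0)) powr l * w y) \<partial>hs) = ennreal (f x) * ennreal (hpot l w x)"
        by simp
    qed measurable
    also have "\<dots> = ennreal (f x * hpot l w x)"
      using F.f_nonneg[of x] hn[of x] by (simp add: ennreal_mult[symmetric])
    finally show "(\<integral>\<^sup>+y. ennreal (norm (y - (x, 0)) powr l * f x * w y) \<partial>hs) = ennreal (f x * hpot l w x)" .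
  qed
  finally have eq: "(\<integral>\<^sup>+y. ennreal (bpot l f y * w y) \<partial>hs) = (\<integral>\<^sup>+x. ennreal (f x * hpot l w x) \<partial>lborel)" .
  have nn1: "AE y in hs. 0 \<le> bpot l f y * w y" using bn W.w_nonneg by (intro AE_I2) simp
  have nn2: "AE x in lborel. 0 \<le> f x * hpot l w x" using hn F.f_nonneg by (intro AE_I2) simp
  show i2: "integrable lborel (\<lambda>x. f x * hpot l w x)"
  proof (rule integrableI_nonneg[OF _ nn2])
    have "(\<integral>\<^sup>+y. ennreal (bpot l f y * w y) \<partial>hs) < \<infinity>"
      using i1 nn1 by (simp add: nn_integral_eq_integral)
    then show "(\<integral>\<^sup>+x. ennreal (f x * hpot l w x) \<partial>lborel) < \<infinity>" unfolding eq .
  qed measurable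
  show "(\<integral>y. bpot l f y * w y \<partial>hs) = (\<integral>x. f x * hpot l w x \<partial>lborel)"
    using eq unfolding nn_integral_eq_integral[OF i1 nn1] nn_integral_eq_integral[OF i2 nn2]
    using integral_nonneg_AE[OF nn1] integral_nonneg_AE[OF nn2] by simp
qed

subsection \<open>The improving map\<close>

text \<open>Scaling to \<open>a = 1\<close> leaves Bernoulli's inequality, proved as a weighted mean
  inequality through \<open>ln x \<le> x - 1\<close>, whose equality case gives the second claim.
  The logarithm requires \<open>b = 0\<close> to be treated apart.\<close>

lemma powr_concave_tangent:
  fixes a b p :: real
  assumes "a > 0" "b \<ge> 0" "0 < p" "p < 1"
  shows "b powr p \<le> a powr p + p * a powr (p - 1) * (b - a)"
    and "b powr p = a powr p + p * a powr (p - 1) * (b - a) \<Longrightarrow> b = a"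
proof -
  have scale: "a powr p + p * a powr (p - 1) * (b - a) = a powr p * (1 + p * (b / a - 1))"
    using assms(1) by (simp add: powr_diff field_simps)
  have "b powr p \<le> a powr p + p * a powr (p - 1) * (b - a) \<and>
      (b powr p = a powr p + p * a powr (p - 1) * (b - a) \<longrightarrow> b = a)"
  proof (cases "b = 0")
    case True
    have "a powr p * (1 - p) > 0" using assms by simp
    then show ?thesis unfolding True scale[unfolded True] using assms by (auto simp: algebra_simps)
  next
    case False
    define t where "t = b / a"
    have t: "t > 0" unfolding t_def using False assms by simp
    \<comment> \<open>The weighted mean of \<open>t\<close> and 1 with weights \<open>p\<close> and
      \<open>1 - p\<close>; with this choice the right-hand sides of \<open>l1\<close> and
      \<open>l2\<close> average to 0.\<close>
    define v where "v = 1 + p * (t - 1)"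
    have v: "v > 0" unfolding v_def using assms t by (simp add: algebra_simps) (smt (verit) mult_pos_pos)
    have bt: "b powr p = a powr p * t powr p"
      unfolding t_def using assms by (simp add: powr_divide)
    have l1: "ln (t / v) \<le> t / v - 1" and l2: "ln (1 / v) \<le> 1 / v - 1"
      using t v by (intro ln_le_minus_one; simp)+
    have sum0: "p * (t / v - 1) + (1 - p) * (1 / v - 1) = 0"
      using v unfolding v_def by (simp add: field_simps)
    have lnx: "p * ln (t / v) + (1 - p) * ln (1 / v) = p * ln t - ln v"
      using t v by (simp add: ln_div algebra_simps)
    have "p * ln t - ln v \<le> 0"
      unfolding lnx[symmetric] sum0[symmetric]
      using l1 l2 assms by (intro add_mono mult_left_mono) auto
    then have le: "t powr p \<le> v"
      using t v by (metis diff_le_0_iff_le exp_le_cancel_iff exp_ln powr_def less_irrefl)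
    have eq: "t = 1" if "t powr p = v"
    proof -
      have "p * ln t = ln v" using that t by (metis ln_powr)
      then have "p * (t / v - 1 - ln (t / v)) + (1 - p) * (1 / v - 1 - ln (1 / v)) = 0"
        using sum0 lnx by (simp add: algebra_simps)
      moreover have "p * (t / v - 1 - ln (t / v)) \<ge> 0" "(1 - p) * (1 / v - 1 - ln (1 / v)) \<ge> 0"
        using l1 l2 assms by auto
      ultimately have "(1 - p) * (1 / v - 1 - ln (1 / v)) = 0" "p * (t / v - 1 - ln (t / v)) = 0" by linarith+
      then have "ln (1 / v) = 1 / v - 1" "ln (t / v) = t / v - 1" using assms by auto
      then have "1 / v = 1" "t / v = 1" using ln_eq_minus_one[of "1 / v"] ln_eq_minus_one[of "t / v"] t v by auto
      then show ?thesis using v by (simp add: field_simps)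
    qed
    show ?thesis
      unfolding scale bt t_def[symmetric] v_def[symmetric]
      using le eq assms(1) unfolding t_def by (auto simp: field_simps)
  qed
  then show "b powr p \<le> a powr p + p * a powr (p - 1) * (b - a)"
    and "b powr p = a powr p + p * a powr (p - 1) * (b - a) \<Longrightarrow> b = a" by blast+
qed

text \<open>Scaling to \<open>a = 1\<close> and combining \<open>1 + x \<le> exp x\<close> at
  \<open>x = - s * ln t\<close> with \<open>ln t \<le> t - 1\<close>. Equality overall forces
  equality in the latter, hence \<open>t = 1\<close>.\<close>

lemma powr_convex_tangent:
  fixes a b s :: real
  assumes "a > 0" "b > 0" "s > 0"
  shows "a powr (-s) + s * a powr (-s - 1) * (a - b) \<le> b powr (-s)"
    and "a powr (-s) + s * a powr (-s - 1) * (a - b) = b powr (-s) \<Longrightarrow> a = b"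
proof -
  define t where "t = b / a"
  have t: "t > 0" unfolding t_def using assms by simp
  have bt: "b powr (-s) = a powr (-s) * t powr (-s)"
    unfolding t_def using assms by (simp add: powr_divide)
  have scale: "a powr (-s) + s * a powr (-s - 1) * (a - b) = a powr (-s) * (1 + s * (1 - t))"
    unfolding t_def using assms(1) by (simp add: powr_diff field_simps)
  have "1 + (- s * ln t) \<le> exp (- s * ln t)" by (rule exp_ge_add_one_self)
  also have "\<dots> = t powr (-s)" using t by (simp add: powr_def)
  finally have le: "1 - s * ln t \<le> t powr (-s)" by simp
  have ln: "s * ln t \<le> s * (t - 1)" using t assms by (intro mult_left_mono ln_le_minus_one) auto
  have "1 + s * (1 - t) \<le> t powr (-s)" using le ln by (simp add: algebra_simps)
  then show "a powr (-s) + s * a powr (-s - 1) * (a - b) \<le> b powr (-s)"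
    unfolding scale bt by (rule mult_left_mono) simp
  assume "a powr (-s) + s * a powr (-s - 1) * (a - b) = b powr (-s)"
  then have "1 + s * (1 - t) = t powr (-s)"
    using assms(1) unfolding scale bt by simp
  then have "s * (t - 1) \<le> s * ln t" using le by (simp add: algebra_simps)
  then have "t - 1 \<le> ln t" using assms(3) by simp
  then have "ln t = t - 1" using ln_le_minus_one[OF t] by linarith
  then have "t = 1" using ln_eq_minus_one[OF t] by simp
  then show "a = b" unfolding t_def using assms by (simp add: field_simps)
qed

text \<open>The minimizer of \<open>\<integral> g \<phi>\<close> among nonnegative \<open>g\<close>
  with \<open>\<integral> g\<^sup>p = 1\<close>; the first factor is the normalisation. It is
  homogeneous of degree 0 in \<open>\<phi>\<close>.\<close>

definition hmap :: "real \<Rightarrow> (real^'m \<Rightarrow> real) \<Rightarrow> real^'m \<Rightarrow> real" where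
  "hmap p \<phi> x = (\<integral>x. \<phi> x powr (- p / (1 - p)) \<partial>lborel) powr (- 1 / p) * \<phi> x powr (- 1 / (1 - p))"

definition energy :: "real \<Rightarrow> real \<Rightarrow> (real^'m \<Rightarrow> real) \<Rightarrow> real" where
  "energy l s f = (\<integral>y. bpot l f y powr (- s) \<partial>hs)"

text \<open>The parameter \<open>tm\<close> only fixes the type of the boundary, whose dimension enters the balance condition.\<close>

locale hls =
  fixes l p s :: real and tm :: "'m::finite itself"
  assumes l0: "0 < l" and p0: "0 < p" and p1: "p < 1" and s0: "0 < s"
    and bal: "s * (l - real CARD('m) * (1 / p - 1)) = real CARD('m) + 1"
begin

lemma lm: "l > real CARD('m) * (1 / p - 1)"
proof (rule ccontr)
  assume "\<not> ?thesis"
  then have "s * (l - real CARD('m) * (1 / p - 1)) \<le> 0"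
    using s0 by (intro mult_nonneg_nonpos) auto
  then show False unfolding bal by simp
qed

text \<open>This and \<open>ls_gt\<close> are the decay conditions for \<open>\<phi>\<close> to the
  power \<open>-p / (1 - p)\<close> on the boundary and for the power \<open>-s\<close> of the
  extension on the half-space, both bases being comparable with \<open>wgt l\<close>.\<close>

lemma lp_gt: "l * p / (1 - p) > real CARD('m)"
  using lm p0 p1 by (simp add: field_simps)

lemma ls_gt: "l * s > real CARD('m) + 1"
proof -
  have "s * (real CARD('m) * (1 / p - 1)) > 0"
    using s0 p0 p1 by (intro mult_pos_pos) (auto simp: field_simps)
  moreover have "l * s = s * (l - real CARD('m) * (1 / p - 1)) + s * (real CARD('m) * (1 / p - 1))"
    by (simp add: algebra_simps)
  ultimately show ?thesis unfolding bal by linarith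
qed

lemma ls1: "l * (s + 1) - l > real CARD('m) + 1"
  using ls_gt by (simp add: algebra_simps)

end

text \<open>\<open>hmap\<close> involves only negative powers of \<open>\<phi>\<close>, so a lower
  bound suffices. As \<open>\<phi>\<close> need not be a potential, limits of potentials and
  \<open>wgt l\<close> itself are instances too.\<close>

locale hls_weight = hls l p s tm for l p s and tm :: "'m::finite itself" +
  fixes \<phi> :: "real^'m \<Rightarrow> real" and lo :: real
  assumes phi_borel [measurable]: "\<phi> \<in> borel_measurable borel" and lo: "lo > 0" and phi_ge: "lo * wgt l x \<le> \<phi> x"
begin

lemma phi_pos: "\<phi> x > 0"
proof -
  have "0 < lo * wgt l x" using lo by simp
  then show ?thesis using phi_ge[of x] by linarith
qed

lemma phi_powr_le: "a \<ge> 0 \<Longrightarrow> \<phi> x powr (- a) \<le> lo powr (- a) * wgt (- (l * a)) x"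
proof -
  assume "a \<ge> 0"
  then have "\<phi> x powr (- a) \<le> (lo * wgt l x) powr (- a)"
    using phi_ge[of x] lo by (intro powr_mono2') auto
  then show ?thesis by (simp add: powr_mult wgt_powr)
qed

definition "mass = (\<integral>x. \<phi> x powr (- p / (1 - p)) \<partial>lborel)"

lemma integrable_phi: "integrable lborel (\<lambda>x. \<phi> x powr (- p / (1 - p)))"
proof (rule integrable_real_boundI)
  show "integrable lborel (\<lambda>x::real^'m. lo powr (- (p / (1 - p))) * wgt (- (l * (p / (1 - p)))) x)"
    by (intro integrable_mult_right wgt_integrable) (use lp_gt in simp)
  show "\<bar>\<phi> x powr (- p / (1 - p))\<bar> \<le> lo powr (- (p / (1 - p))) * wgt (- (l * (p / (1 - p)))) x" for x
    using phi_powr_le[of "p / (1 - p)" x] p0 p1 by simp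
qed measurable

lemma lborel_integral_pos:
  fixes f :: "real^'m \<Rightarrow> real"
  assumes "integrable lborel f" "\<And>x. f x > 0"
  shows "integral\<^sup>L lborel f > 0"
proof (rule ccontr)
  assume "\<not> integral\<^sup>L lborel f > 0"
  moreover have nn: "AE x in lborel. 0 \<le> f x" using assms(2) by (intro AE_I2) (simp add: less_imp_le)
  ultimately have "integral\<^sup>L lborel f = 0" using integral_nonneg_AE[OF nn] by linarith
  then have "AE x in lborel. f x = 0" using integral_nonneg_eq_0_iff_AE[OF assms(1) nn] by simp
  then have "AE x in lborel. x \<notin> (UNIV :: (real^'m) set)"
    by eventually_elim (use assms(2) in \<open>metis less_irrefl\<close>)
  then show False using AE_lborel_notin_openD[of "UNIV :: (real^'m) set"] by simp
qed

lemma mass_pos: "mass > 0"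
  unfolding mass_def
  by (rule lborel_integral_pos[OF integrable_phi]) (use phi_pos in \<open>simp add: less_imp_neq[symmetric]\<close>)

lemma hmap_eq: "hmap p \<phi> x = mass powr (- 1 / p) * \<phi> x powr (- 1 / (1 - p))"
  unfolding hmap_def mass_def ..

lemma hmap_pos: "hmap p \<phi> x > 0"
  unfolding hmap_eq using mass_pos phi_pos[of x] by simp

lemma hmap_borel [measurable]: "hmap p \<phi> \<in> borel_measurable borel"
  unfolding hmap_eq[abs_def] by measurable

lemma hmap_powr: "hmap p \<phi> x powr p = \<phi> x powr (- p / (1 - p)) / mass"
proof -
  have "hmap p \<phi> x powr p = mass powr (- 1 / p * p) * \<phi> x powr (- 1 / (1 - p) * p)"
    unfolding hmap_eq by (simp only: powr_mult powr_powr)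
  also have "- 1 / p * p = - 1" using p0 by simp
  also have "- 1 / (1 - p) * p = - p / (1 - p)" by simp
  finally show ?thesis using mass_pos by (simp add: powr_minus field_simps)
qed

lemma hmap_powr_integrable: "integrable lborel (\<lambda>x. hmap p \<phi> x powr p)"
  unfolding hmap_powr using integrable_phi by simp

lemma hmap_powr_integral: "(\<integral>x. hmap p \<phi> x powr p \<partial>lborel) = 1"
  unfolding hmap_powr using mass_pos by (simp add: mass_def)

text \<open>The Euler equation of the constrained minimization: the slope of the tangent to the
  \<open>p\<close>-th power at \<open>hmap p \<phi> x\<close> is proportional to
  \<open>\<phi> x\<close>.\<close>

lemma hmap_powr_minus: "hmap p \<phi> x powr (p - 1) = mass powr ((1 - p) / p) * \<phi> x"
proof -
  have "hmap p \<phi> x powr (p - 1) = mass powr (- 1 / p * (p - 1)) * \<phi> x powr (- 1 / (1 - p) * (p - 1))"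
    unfolding hmap_eq using mass_pos by (simp add: powr_mult powr_powr)
  also have "- 1 / p * (p - 1) = (1 - p) / p" using p0 by (simp add: field_simps)
  also have "- 1 / (1 - p) * (p - 1) = 1" using p1 by (simp add: field_simps)
  finally show ?thesis using phi_pos[of x] by simp
qed

lemma hmap_le: "hmap p \<phi> x \<le> mass powr (- 1 / p) * lo powr (- (1 / (1 - p))) * wgt (- (l / (1 - p))) x"
proof -
  have "hmap p \<phi> x \<le> mass powr (- 1 / p) * (lo powr (- (1 / (1 - p))) * wgt (- (l * (1 / (1 - p)))) x)"
    unfolding hmap_eq using phi_powr_le[of "1 / (1 - p)" x] p1 by (intro mult_left_mono) auto
  then show ?thesis by simp
qed

lemma dens_hmap: "dens l (hmap p \<phi>)"
  unfolding dens_def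
proof (intro conjI allI)
  define K where "K = mass powr (- 1 / p) * lo powr (- (1 / (1 - p)))"
  \<comment> \<open>The growth \<open>l\<close> of the weight uses up part of the decay
    \<open>l / (1 - p)\<close>; what remains exceeds the boundary dimension by
    \<open>lp_gt\<close>.\<close>
  have e: "- (l / (1 - p)) + l = - (l * p / (1 - p))" using p1 by (simp add: field_simps)
  show int: "integrable lborel (\<lambda>x. wgt l x * hmap p \<phi> x)"
  proof (rule integrable_real_boundI)
    show "integrable lborel (\<lambda>x::real^'m. K * wgt (- (l * p / (1 - p))) x)"
      by (intro integrable_mult_right wgt_integrable) (use lp_gt in simp)
    show "\<bar>wgt l x * hmap p \<phi> x\<bar> \<le> K * wgt (- (l * p / (1 - p))) x" for x
    proof -
      have "wgt l x * hmap p \<phi> x \<le> wgt l x * (K * wgt (- (l / (1 - p))) x)"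
        unfolding K_def by (intro mult_left_mono hmap_le) simp
      also have "\<dots> = K * (wgt (- (l / (1 - p))) x * wgt l x)" by (simp only: mult_ac)
      also have "\<dots> = K * wgt (- (l * p / (1 - p))) x"
        unfolding wgt_mult e ..
      finally show ?thesis using hmap_pos[of x] by simp
    qed
  qed measurable
  interpret P: potential l lborel "\<lambda>x. (x::real^'m)" "hmap p \<phi>"
    using l0 int by unfold_locales (auto simp: measurable_lborel1)
  show "0 < integral\<^sup>L lborel (hmap p \<phi>)"
    by (rule lborel_integral_pos[OF P.w_integrable hmap_pos])
qed (use l0 hmap_pos hmap_borel in \<open>auto simp: less_imp_le\<close>)

end

lemma (in hls) bpot_powr_le:
  assumes "dens l f" "k > 0" "k * wgt l y \<le> bpot l f y" "a \<ge> 0"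
  shows "bpot l f y powr (- a) \<le> k powr (- a) * wgt (- (l * a)) y"
proof -
  have "bpot l f y powr (- a) \<le> (k * wgt l y) powr (- a)"
    using assms by (intro powr_mono2') auto
  then show ?thesis by (simp add: powr_mult wgt_powr)
qed

lemma (in hls) energy_integrable:
  fixes f :: "real^'m \<Rightarrow> real"
  assumes "dens l f"
  shows "integrable hs (\<lambda>y. bpot l f y powr (- s))"
proof -
  interpret F: boundary_density l f by unfold_locales (rule assms)
  obtain k where k: "k > 0" "\<And>z. k * wgt l z \<le> bpot l f z" using F.bpot_ge by blast
  show ?thesis
  proof (rule integrable_real_boundI)
    show "integrable hs (\<lambda>y :: (real^'m) \<times> real. k powr (- s) * wgt (- (l * s)) y)"
      by (intro integrable_mult_right wgt_integrable_hs ls_gt)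
    show "(\<lambda>y. bpot l f y powr (- s)) \<in> borel_measurable hs"
      by (rule borel_measurable_hs) measurable
    show "\<bar>bpot l f y powr (- s)\<bar> \<le> k powr (- s) * wgt (- (l * s)) y" for y
      using bpot_powr_le[OF assms k(1) k(2), of s y] s0 by simp
  qed
qed

locale hls_density = hls l p s tm for l p s and tm :: "'m::finite itself" +
  fixes f :: "real^'m \<Rightarrow> real" and c :: real
  assumes densf: "dens l f" and c0: "c > 0"
    and fp_int: "integrable lborel (\<lambda>x. f x powr p)" and fp1: "(\<integral>x. f x powr p \<partial>lborel) = 1"
begin

sublocale F: boundary_density l f by unfold_locales (rule densf)

text \<open>The factor \<open>c\<close> rescales \<open>\<phi>\<close> without changing its image
  under \<open>hmap\<close>. It is 1 for the study of a maximizer and a power of the mass for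
  sequences, where bounds uniform in the index are required.\<close>

definition "wfn y = c * bpot l f y powr (- s - 1)"

lemma wfn_weight_ex: "\<exists>hi. half_space_weight l (l * (s + 1)) hi wfn"
proof -
  obtain k where k: "k > 0" "\<And>z. k * wgt l z \<le> bpot l f z" using F.bpot_ge by blast
  have "half_space_weight l (l * (s + 1)) (c * k powr (- (s + 1))) wfn"
  proof
    show "wfn \<in> borel_measurable borel" unfolding wfn_def[abs_def] by measurable
    show "wfn y \<le> c * k powr (- (s + 1)) * wgt (- (l * (s + 1))) y" for y
      unfolding wfn_def using bpot_powr_le[OF densf k(1) k(2), of "s + 1" y] s0 c0 by simp
  qed (use ls1 l0 c0 in \<open>auto simp: wfn_def\<close>)
  then show ?thesis by blast
qed

text \<open>A choice, since a sublocale needs a term for its parameter. The bound depends on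
  \<open>f\<close>; uniform bounds are derived separately in \<open>existence_limit\<close>.\<close>

definition "hi = (SOME hi. half_space_weight l (l * (s + 1)) hi wfn)"

sublocale W: half_space_weight l "l * (s + 1)" hi wfn
  unfolding hi_def by (rule someI_ex[OF wfn_weight_ex])

definition "phi = hpot l wfn"

lemma phi_ge_ex: "\<exists>lo>0. \<forall>x. lo * wgt l x \<le> phi x"
proof -
  define C where "C = (\<integral>x. wgt l x * f x \<partial>lborel)"
  have le: "bpot l f y \<le> C * wgt l y" for y
    unfolding C_def using F.bpot_le[of y] by (simp add: mult.commute)
  have C: "C > 0" using order_less_le_trans[OF F.bpot_pos le[of 0]]
    by (rule zero_less_mult_pos2) simp
  define lo where "lo = c * C powr (- (s + 1))"
  have lo: "lo > 0" unfolding lo_def using c0 C by simp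
  have lw: "lo * wgt (- (l * (s + 1))) y \<le> wfn y" for y
  proof -
    have "(C * wgt l y) powr (- (s + 1)) \<le> bpot l f y powr (- (s + 1))"
      using le[of y] F.bpot_pos[of y] s0 by (intro powr_mono2') auto
    then have "c * (C * wgt l y) powr (- (s + 1)) \<le> c * bpot l f y powr (- (s + 1))"
      using c0 by simp
    moreover have "(C * wgt l y) powr (- (s + 1)) = C powr (- (s + 1)) * wgt (- (l * (s + 1))) y"
      unfolding powr_mult wgt_powr mult_minus_right ..
    ultimately show ?thesis unfolding lo_def wfn_def by (simp add: mult.assoc)
  qed
  show ?thesis
    using mult_pos_pos[OF lo W.hpot_ge(2)[OF lo lw]] W.hpot_ge(1)[OF lo lw] unfolding phi_def by blast
qed

definition "lo = (SOME lo. lo > 0 \<and> (\<forall>x. lo * wgt l x \<le> phi x))"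

sublocale H: hls_weight l p s tm phi lo
proof -
  have "lo > 0 \<and> (\<forall>x. lo * wgt l x \<le> phi x)"
    unfolding lo_def by (rule someI_ex[OF phi_ge_ex])
  then show "hls_weight l p s phi lo"
    by unfold_locales (auto simp: phi_def W.borel_measurable_hpot)
qed

abbreviation "g \<equiv> hmap p phi"

sublocale G: boundary_density l g by unfold_locales (rule H.dens_hmap)

lemma phi_dual: "integrable hs (\<lambda>y. bpot l f y * wfn y)" "integrable lborel (\<lambda>x. f x * phi x)"
    "(\<integral>y. bpot l f y * wfn y \<partial>hs) = (\<integral>x. f x * phi x \<partial>lborel)"
    "integrable hs (\<lambda>y. bpot l g y * wfn y)" "integrable lborel (\<lambda>x. g x * phi x)"
    "(\<integral>y. bpot l g y * wfn y \<partial>hs) = (\<integral>x. g x * phi x \<partial>lborel)"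
  unfolding phi_def
  using bpot_hpot_duality[OF densf W.half_space_weight_axioms]
    bpot_hpot_duality[OF H.dens_hmap[unfolded phi_def] W.half_space_weight_axioms] by blast+

text \<open>The decrease of the linearised functional on passing from \<open>f\<close> to
  \<open>g\<close>. It is bounded below by the concave tangent inequality and bounds the gain of
  energy in the convex one.\<close>

definition "gap = (\<integral>x. f x * phi x \<partial>lborel) - (\<integral>x. g x * phi x \<partial>lborel)"
definition "\<kappa> = H.mass powr ((1 - p) / p)"

lemma kappa_pos: "\<kappa> > 0" unfolding \<kappa>_def using H.mass_pos by simp

text \<open>The integrand is the distance of \<open>f x powr p\<close> from its tangent at
  \<open>g x\<close>. Both functions have \<open>p\<close>-th powers of integral 1, so only the
  linear term survives integration.\<close>

lemma concave_gap:
  "integrable lborel (\<lambda>x. g x powr p + p * (\<kappa> * (f x * phi x - g x * phi x)) - f x powr p)"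
  "(\<integral>x. g x powr p + p * (\<kappa> * (f x * phi x - g x * phi x)) - f x powr p \<partial>lborel) = p * \<kappa> * gap"
  "0 \<le> g x powr p + p * (\<kappa> * (f x * phi x - g x * phi x)) - f x powr p"
  "g x powr p + p * (\<kappa> * (f x * phi x - g x * phi x)) - f x powr p = 0 \<Longrightarrow> f x = g x"
proof -
  have e: "p * (\<kappa> * (f x * phi x - g x * phi x)) = p * g x powr (p - 1) * (f x - g x)" for x
    unfolding H.hmap_powr_minus \<kappa>_def by (simp add: algebra_simps)
  show "integrable lborel (\<lambda>x. g x powr p + p * (\<kappa> * (f x * phi x - g x * phi x)) - f x powr p)"
    by (intro Bochner_Integration.integrable_add Bochner_Integration.integrable_diff integrable_mult_right
        phi_dual H.hmap_powr_integrable fp_int)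
  have "(\<integral>x. g x powr p + p * (\<kappa> * (f x * phi x - g x * phi x)) - f x powr p \<partial>lborel)
     = (\<integral>x. g x powr p \<partial>lborel) + p * (\<kappa> * ((\<integral>x. f x * phi x \<partial>lborel) - (\<integral>x. g x * phi x \<partial>lborel))) - (\<integral>x. f x powr p \<partial>lborel)"
    using phi_dual(2,5) H.hmap_powr_integrable fp_int by simp
  then show "(\<integral>x. g x powr p + p * (\<kappa> * (f x * phi x - g x * phi x)) - f x powr p \<partial>lborel) = p * \<kappa> * gap"
    unfolding H.hmap_powr_integral fp1 gap_def by simp
  show "0 \<le> g x powr p + p * (\<kappa> * (f x * phi x - g x * phi x)) - f x powr p"
    unfolding e using powr_concave_tangent(1)[OF H.hmap_pos[of x] F.f_nonneg[of x] p0 p1] by simp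
  show "g x powr p + p * (\<kappa> * (f x * phi x - g x * phi x)) - f x powr p = 0 \<Longrightarrow> f x = g x"
    unfolding e using powr_concave_tangent(2)[OF H.hmap_pos[of x] F.f_nonneg[of x] p0 p1] by simp
qed

lemma gap_nonneg: "gap \<ge> 0"
proof -
  have "0 \<le> p * \<kappa> * gap"
    unfolding concave_gap(2)[symmetric] using concave_gap(3) by (intro integral_nonneg_AE AE_I2)
  moreover have "0 < p * \<kappa>" using kappa_pos p0 by simp
  ultimately show ?thesis by (simp add: zero_le_mult_iff not_le)
qed

text \<open>The tangent of the power \<open>-s\<close> at the potential of \<open>f\<close>,
  evaluated at that of \<open>g\<close>. Its slope is \<open>wfn\<close> up to constants, so duality
  turns the integrated linear term into \<open>gap\<close>.\<close>

lemma energy_gap: "energy l s f + s / c * gap \<le> energy l s g"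
proof -
  have eq: "(\<integral>y. bpot l f y powr (- s) + s / c * (bpot l f y * wfn y - bpot l g y * wfn y) \<partial>hs)
     = energy l s f + s / c * gap"
    unfolding energy_def gap_def
    using phi_dual energy_integrable[OF densf] by simp
  have "(\<integral>y. bpot l f y powr (- s) + s / c * (bpot l f y * wfn y - bpot l g y * wfn y) \<partial>hs)
      \<le> energy l s g"
    unfolding energy_def
  proof (rule integral_mono)
    show "bpot l f y powr (- s) + s / c * (bpot l f y * wfn y - bpot l g y * wfn y) \<le> bpot l g y powr (- s)" for y
    proof -
      have "s / c * (bpot l f y * wfn y - bpot l g y * wfn y)
        = s * bpot l f y powr (- s - 1) * (bpot l f y - bpot l g y)"
        unfolding wfn_def using c0 by (simp add: field_simps)
      then show ?thesis
        using powr_convex_tangent(1)[OF F.bpot_pos[of y] G.bpot_pos[of y] s0] by simp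
    qed
  qed (intro Bochner_Integration.integrable_add Bochner_Integration.integrable_diff integrable_mult_right
      phi_dual energy_integrable densf H.dens_hmap)+
  then show ?thesis unfolding eq .
qed

lemma energy_improve: "energy l s f \<le> energy l s g"
proof -
  have "0 \<le> s / c * gap" using gap_nonneg s0 c0 by simp
  then show ?thesis using energy_gap by linarith
qed

text \<open>No gain forces \<open>gap = 0\<close>; a nonnegative function of integral 0 vanishes
  a.e., and this is the equality case of the concave tangent inequality.\<close>

lemma energy_improve_eq:
  assumes "energy l s g \<le> energy l s f"
  shows "AE x in lborel. f x = g x"
proof -
  have "s / c * gap \<le> 0" using energy_gap assms by linarith
  then have "gap = 0" using gap_nonneg s0 c0 by (simp add: mult_le_0_iff divide_le_0_iff)
  then have "(\<integral>x. g x powr p + p * (\<kappa> * (f x * phi x - g x * phi x)) - f x powr p \<partial>lborel) = 0"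
    unfolding concave_gap(2) by simp
  then have "AE x in lborel. g x powr p + p * (\<kappa> * (f x * phi x - g x * phi x)) - f x powr p = 0"
    using integral_nonneg_eq_0_iff_AE[OF concave_gap(1)] concave_gap(3) by simp
  then show ?thesis
    by eventually_elim (rule concave_gap(4))
qed

end

subsection \<open>Dilations and maximizing sequences\<close>

lemma
  fixes F :: "'a::euclidean_space \<Rightarrow> real"
  assumes "t > 0" and [measurable]: "F \<in> borel_measurable borel"
  shows lborel_integrable_affine: "integrable lborel F \<Longrightarrow> integrable lborel (\<lambda>x. F (a + t *\<^sub>R x))"
    and lborel_integral_affine: "integral\<^sup>L lborel F = t ^ DIM('a) * (\<integral>x. F (a + t *\<^sub>R x) \<partial>lborel)"
proof -
  let ?D = "density (distr lborel borel (\<lambda>x::'a. a + t *\<^sub>R x)) (\<lambda>_. ennreal (t ^ DIM('a)))"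
  have D: "lborel = ?D" using lborel_affine[of t a] assms(1) by simp
  have [measurable]: "(\<lambda>x::'a. a + t *\<^sub>R x) \<in> borel_measurable lborel"
    unfolding measurable_lborel1 by measurable
  have td: "0 \<le> t ^ DIM('a)" "t ^ DIM('a) > 0" using assms(1) by auto
  show "integrable lborel (\<lambda>x. F (a + t *\<^sub>R x))" if "integrable lborel F"
  proof -
    have "integrable ?D F" using that D by simp
    then have "integrable (distr lborel borel (\<lambda>x::'a. a + t *\<^sub>R x)) (\<lambda>x. t ^ DIM('a) *\<^sub>R F x)"
      by (subst (asm) integrable_density) (use td in auto)
    then have "integrable lborel (\<lambda>x. t ^ DIM('a) *\<^sub>R F (a + t *\<^sub>R x))"
      by (subst (asm) integrable_distr_eq) (auto simp: measurable_lborel1)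
    then show ?thesis using assms(1) by simp
  qed
  have "integral\<^sup>L lborel F = integral\<^sup>L ?D F" using D by simp
  also have "\<dots> = (\<integral>x. t ^ DIM('a) *\<^sub>R F x \<partial>distr lborel borel (\<lambda>x::'a. a + t *\<^sub>R x))"
    by (subst integral_density) (use td in auto)
  also have "\<dots> = (\<integral>x. t ^ DIM('a) *\<^sub>R F (a + t *\<^sub>R x) \<partial>lborel)"
    by (subst integral_distr) (auto simp: measurable_lborel1)
  finally show "integral\<^sup>L lborel F = t ^ DIM('a) * (\<integral>x. F (a + t *\<^sub>R x) \<partial>lborel)" by simp
qed

lemma hs_integral_affine:
  fixes G :: "(real^'m) \<times> real \<Rightarrow> real"
  assumes "t > 0" and [measurable]: "G \<in> borel_measurable borel"
  shows "integral\<^sup>L hs G = t ^ (CARD('m) + 1) * (\<integral>y. G ((a, 0) + t *\<^sub>R y) \<partial>hs)"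
proof -
  have mem: "(a, 0) + t *\<^sub>R y \<in> half_space \<longleftrightarrow> y \<in> half_space" for y :: "(real^'m) \<times> real"
    unfolding half_space_def using assms(1) by (simp add: zero_less_mult_iff)
  have hsb[measurable]: "(half_space :: ((real^'m) \<times> real) set) \<in> sets borel"
    by (rule borel_open[OF open_half_space])
  have "integral\<^sup>L hs G = (\<integral>y. indicator half_space y *\<^sub>R G y \<partial>lborel)"
    unfolding hs_def by (rule integral_restrict_space[OF sets_hs_Int])
  also have "\<dots> = t ^ DIM((real^'m) \<times> real) *
      (\<integral>y. indicator half_space ((a, 0) + t *\<^sub>R y) *\<^sub>R G ((a, 0) + t *\<^sub>R y) \<partial>lborel)"
    by (rule lborel_integral_affine[OF assms(1)]) measurable
  also have "(\<integral>y. indicator half_space ((a, 0) + t *\<^sub>R y) *\<^sub>R G ((a, 0) + t *\<^sub>R y) \<partial>lborel)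
      = (\<integral>y. indicator half_space y *\<^sub>R G ((a, 0) + t *\<^sub>R y) \<partial>lborel)"
    by (intro Bochner_Integration.integral_cong refl) (simp add: indicator_def mem)
  also have "\<dots> = (\<integral>y. G ((a, 0) + t *\<^sub>R y) \<partial>hs)"
    unfolding hs_def by (rule integral_restrict_space[OF sets_hs_Int, symmetric])
  finally show ?thesis by simp
qed

context hls
begin

definition unit_dens :: "(real^'m \<Rightarrow> real) \<Rightarrow> bool" where
  "unit_dens f \<longleftrightarrow> dens l f \<and> integrable lborel (\<lambda>x. f x powr p) \<and> (\<integral>x. f x powr p \<partial>lborel) = 1"

definition centred :: "(real^'m \<Rightarrow> real) \<Rightarrow> bool" where
  "centred f \<longleftrightarrow> bpot l f 0 = integral\<^sup>L lborel f \<and> (\<forall>z. bpot l f 0 \<le> bpot l f z)"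

text \<open>The exponent \<open>CARD('m) / p\<close> makes the factor cancel the Jacobian in the
  integral of the \<open>p\<close>-th power.\<close>

definition rescale :: "real^'m \<Rightarrow> real \<Rightarrow> (real^'m \<Rightarrow> real) \<Rightarrow> real^'m \<Rightarrow> real" where
  "rescale a t f x = t powr (CARD('m) / p) * f (a + t *\<^sub>R x)"

lemma rescale_mass:
  assumes "t > 0" "f \<in> borel_measurable borel"
  shows "integral\<^sup>L lborel (rescale a t f) = t powr (CARD('m) / p) * t powr (- real CARD('m)) * integral\<^sup>L lborel f"
proof -
  have "integral\<^sup>L lborel f = t ^ CARD('m) * (\<integral>x. f (a + t *\<^sub>R x) \<partial>lborel)"
    using lborel_integral_affine[OF assms(1,2), of a] by simp
  then have "(\<integral>x. f (a + t *\<^sub>R x) \<partial>lborel) = t powr (- real CARD('m)) * integral\<^sup>L lborel f"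
    using assms(1) by (simp add: powr_minus powr_realpow field_simps)
  then show ?thesis unfolding rescale_def by simp
qed

lemma rescale_bpot:
  assumes "t > 0" "f \<in> borel_measurable borel"
  shows "bpot l (rescale a t f) z = t powr (CARD('m) / p) * t powr (- real CARD('m) - l) * bpot l f ((a, 0) + t *\<^sub>R z)"
proof -
  let ?F = "\<lambda>x. norm ((x, 0) - ((a, 0) + t *\<^sub>R z)) powr l * f x"
  have n: "norm ((a + t *\<^sub>R x, 0) - ((a, 0) + t *\<^sub>R z)) = t * norm ((x, 0) - z)" for x
  proof -
    have "(a + t *\<^sub>R x, 0) - ((a, 0) + t *\<^sub>R z) = t *\<^sub>R ((x, 0) - z)"
      by (simp add: prod_eq_iff scaleR_right_diff_distrib)
    then show ?thesis using assms(1) by simp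
  qed
  have [measurable]: "?F \<in> borel_measurable borel" using assms(2) by measurable
  have "bpot l f ((a, 0) + t *\<^sub>R z) = t ^ CARD('m) * (\<integral>x. ?F (a + t *\<^sub>R x) \<partial>lborel)"
    unfolding bpot_eq using lborel_integral_affine[OF assms(1), of ?F a] by simp
  also have "(\<integral>x. ?F (a + t *\<^sub>R x) \<partial>lborel) = t powr l * (\<integral>x. norm ((x, 0) - z) powr l * f (a + t *\<^sub>R x) \<partial>lborel)"
    unfolding n using assms(1) by (simp add: powr_mult mult.assoc)
  finally have "bpot l f ((a, 0) + t *\<^sub>R z) = t powr (real CARD('m) + l) * (\<integral>x. norm ((x, 0) - z) powr l * f (a + t *\<^sub>R x) \<partial>lborel)"
    using assms(1) by (simp add: powr_add powr_realpow mult.assoc)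
  then have "(\<integral>x. norm ((x, 0) - z) powr l * f (a + t *\<^sub>R x) \<partial>lborel) = t powr (- real CARD('m) - l) * bpot l f ((a, 0) + t *\<^sub>R z)"
    using assms(1) by (simp add: powr_add powr_diff powr_minus field_simps)
  moreover have "bpot l (rescale a t f) z = t powr (CARD('m) / p) * (\<integral>x. norm ((x, 0) - z) powr l * f (a + t *\<^sub>R x) \<partial>lborel)"
    unfolding bpot_eq rescale_def by (simp add: mult.left_commute)
  ultimately show ?thesis by simp
qed

lemma rescale_unit_dens:
  assumes "t > 0" "unit_dens f"
  shows "unit_dens (rescale a t f)"
proof -
  have d: "dens l f" using assms(2) unfolding unit_dens_def by simp
  interpret F: boundary_density l f by unfold_locales (rule d)
  have [measurable]: "rescale a t f \<in> borel_measurable borel"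
    unfolding rescale_def[abs_def] by measurable
  have nn: "0 \<le> rescale a t f x" for x unfolding rescale_def using F.f_nonneg by simp
  have "integrable lborel (\<lambda>x. wgt l x * rescale a t f x)"
  proof (rule integrable_real_boundI)
    have "integrable lborel (\<lambda>x. wgt l (a + t *\<^sub>R x) * f (a + t *\<^sub>R x))"
      using lborel_integrable_affine[OF assms(1), of "\<lambda>x. wgt l x * f x" a] F.f_int by simp
    then show "integrable lborel (\<lambda>x. ((1 + norm (- (1 / t) *\<^sub>R a)) * (1 + \<bar>1 / t\<bar>)) powr l * t powr (CARD('m) / p) * (wgt l (a + t *\<^sub>R x) * f (a + t *\<^sub>R x)))"
      by (rule integrable_mult_right)
    show "\<bar>wgt l x * rescale a t f x\<bar> \<le> ((1 + norm (- (1 / t) *\<^sub>R a)) * (1 + \<bar>1 / t\<bar>)) powr l * t powr (CARD('m) / p) * (wgt l (a + t *\<^sub>R x) * f (a + t *\<^sub>R x))" for x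
    proof -
      have x: "x = - (1 / t) *\<^sub>R a + (1 / t) *\<^sub>R (a + t *\<^sub>R x)" using assms(1) by (simp add: scaleR_right_distrib)
      have "wgt l x \<le> ((1 + norm (- (1 / t) *\<^sub>R a)) * (1 + \<bar>1 / t\<bar>)) powr l * wgt l (a + t *\<^sub>R x)"
        by (subst x, rule wgt_affine_le) (use l0 in simp)
      then have "wgt l x * rescale a t f x \<le> ((1 + norm (- (1 / t) *\<^sub>R a)) * (1 + \<bar>1 / t\<bar>)) powr l * wgt l (a + t *\<^sub>R x) * rescale a t f x"
        by (rule mult_right_mono) (rule nn)
      then show ?thesis using nn[of x] F.f_nonneg unfolding rescale_def by (simp add: abs_mult mult_ac)
    qed
  qed measurable
  moreover have "0 < integral\<^sup>L lborel (rescale a t f)"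
    unfolding rescale_mass[OF assms(1) F.f_borel] using assms(1) F.mass_pos by simp
  ultimately have "dens l (rescale a t f)"
    unfolding dens_def using l0 nn by auto
  moreover have rp: "rescale a t f x powr p = t ^ CARD('m) * f (a + t *\<^sub>R x) powr p" for x
    unfolding rescale_def using assms(1) p0 by (simp add: powr_mult powr_powr powr_realpow)
  moreover have "integrable lborel (\<lambda>x. rescale a t f x powr p)"
    unfolding rp using assms lborel_integrable_affine[OF assms(1), of "\<lambda>x. f x powr p" a]
    unfolding unit_dens_def by simp
  moreover have "(\<integral>x. rescale a t f x powr p \<partial>lborel) = 1"
    unfolding rp using assms lborel_integral_affine[OF assms(1), of "\<lambda>x. f x powr p" a]
    unfolding unit_dens_def by simp
  ultimately show ?thesis unfolding unit_dens_def by simp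
qed

text \<open>The potential acquires the factor \<open>t powr e\<close>. By \<open>bal\<close> its
  power \<open>-s\<close> is \<open>t\<close> to the dimension of the half-space, which is exactly
  the Jacobian there.\<close>

lemma rescale_energy:
  assumes "t > 0" "unit_dens f"
  shows "energy l s (rescale a t f) = energy l s f"
proof -
  have d: "dens l f" using assms(2) unfolding unit_dens_def by simp
  interpret F: boundary_density l f by unfold_locales (rule d)
  define e where "e = CARD('m) / p - real CARD('m) - l"
  have "t powr (CARD('m) / p) * t powr (- real CARD('m) - l) = t powr e"
    unfolding e_def powr_add[symmetric] by (simp add: algebra_simps)
  then have u: "bpot l (rescale a t f) z = t powr e * bpot l f ((a, 0) + t *\<^sub>R z)" for z
    unfolding rescale_bpot[OF assms(1) F.f_borel] by simp
  have "e * (- s) = s * (l - real CARD('m) * (1 / p - 1))"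
    unfolding e_def by (simp add: algebra_simps)
  then have es: "e * (- s) = real CARD('m) + 1" unfolding bal .
  have tp: "t powr (real CARD('m) + 1) = t ^ (CARD('m) + 1)"
    using assms(1) by (simp add: powr_add powr_realpow)
  have "energy l s (rescale a t f) = (\<integral>y. t powr (e * (- s)) * bpot l f ((a, 0) + t *\<^sub>R y) powr (- s) \<partial>hs)"
    unfolding energy_def u powr_mult powr_powr ..
  also have "\<dots> = t ^ (CARD('m) + 1) * (\<integral>y. bpot l f ((a, 0) + t *\<^sub>R y) powr (- s) \<partial>hs)"
    unfolding es tp by simp
  also have "\<dots> = energy l s f"
    unfolding energy_def using hs_integral_affine[OF assms(1), of "\<lambda>y. bpot l f y powr (- s)" a] by simp
  finally show ?thesis .
qed

section \<open>Centred densities and limits of improved sequences\<close>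

lemma ex_centred:
  assumes "unit_dens f"
  shows "\<exists>f'. unit_dens f' \<and> centred f' \<and> energy l s f' = energy l s f"
proof -
  have d: "dens l f" using assms unfolding unit_dens_def by simp
  interpret F: boundary_density l f by unfold_locales (rule d)
  obtain a where a: "\<And>z. bpot l f (a, 0) \<le> bpot l f z" using F.bpot_attains_min by blast
  define M where "M = integral\<^sup>L lborel f"
  have M: "M > 0" unfolding M_def by (rule F.mass_pos)
  \<comment> \<open>The dilation multiplies the quotient of minimal potential and mass by
    \<open>t powr (- l)\<close>; this \<open>t\<close> makes the quotient 1.\<close>
  define t where "t = (bpot l f (a, 0) / M) powr (1 / l)"
  have t: "t > 0" unfolding t_def using M F.bpot_pos[of "(a, 0)"] by simp
  have "t powr l = bpot l f (a, 0) / M"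
    unfolding t_def using M F.bpot_pos[of "(a, 0)"] l0 by (simp add: powr_powr)
  then have tl: "t powr (- l) * bpot l f (a, 0) = M"
    using M F.bpot_pos[of "(a, 0)"] by (simp add: powr_minus)
  have "centred (rescale a t f)"
    unfolding centred_def
  proof (intro conjI allI)
    show "bpot l (rescale a t f) 0 = integral\<^sup>L lborel (rescale a t f)"
      unfolding rescale_bpot[OF t F.f_borel] rescale_mass[OF t F.f_borel] M_def[symmetric] tl[symmetric]
      by (simp add: powr_diff powr_minus divide_inverse)
    show "bpot l (rescale a t f) 0 \<le> bpot l (rescale a t f) z" for z
      unfolding rescale_bpot[OF t F.f_borel] using a by (intro mult_left_mono) auto
  qed
  then show ?thesis
    using rescale_unit_dens[OF t assms] rescale_energy[OF t assms] by blast
qed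

text \<open>For a centred density minimum, value at the origin and mass coincide, so in
  \<open>bpot_ge_aux\<close> and \<open>bpot_le_quasi\<close> everything but the mass becomes a
  number depending on \<open>l\<close>.\<close>

lemma centred_bounds:
  assumes "unit_dens f" "centred f"
  defines "M \<equiv> integral\<^sup>L lborel f"
  shows "M > 0" "wgt l z * M \<le> 2 powr l * (1 + 2 powr l * 2) * bpot l f z"
    and "bpot l f z \<le> 2 powr l * 2 * (wgt l z * M)"
proof -
  have d: "dens l f" using assms(1) unfolding unit_dens_def by simp
  interpret F: boundary_density l f by unfold_locales (rule d)
  show M: "M > 0" unfolding M_def by (rule F.mass_pos)
  have u0: "bpot l f 0 = M" and le: "M \<le> bpot l f z" for z
    using assms(2) unfolding centred_def M_def by metis+
  have "wgt l z \<le> 2 powr l * (1 / M + 2 powr l * (1 + bpot l f 0 / M) / M) * bpot l f z"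
    unfolding M_def by (rule F.bpot_ge_aux) (use M le in \<open>auto simp: M_def\<close>)
  also have "\<dots> = 2 powr l * (1 + 2 powr l * 2) * bpot l f z / M"
    unfolding u0 using M by (simp add: field_simps)
  finally show "wgt l z * M \<le> 2 powr l * (1 + 2 powr l * 2) * bpot l f z"
    using M by (simp add: field_simps)
  have "norm z powr l \<le> wgt l z" unfolding wgt_def using l0 by (intro powr_mono2) auto
  moreover have "1 \<le> wgt l z" using l0 by (intro wgt_ge_1) simp
  ultimately have "norm z powr l * M + M \<le> wgt l z * M + wgt l z * M"
    using M by (intro add_mono mult_right_mono) auto
  then have "2 powr l * (norm z powr l * M + M) \<le> 2 powr l * (wgt l z * M + wgt l z * M)"
    by (intro mult_left_mono) auto
  moreover have "2 powr l * (wgt l z * M + wgt l z * M) = 2 powr l * 2 * (wgt l z * M)"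
    by (simp add: algebra_simps)
  ultimately show "bpot l f z \<le> 2 powr l * 2 * (wgt l z * M)"
    using F.bpot_le_quasi[of z] unfolding u0 M_def[symmetric] by linarith
qed

text \<open>Up to a constant the image of \<open>wgt l\<close> under \<open>hmap\<close>; it serves
  as the common envelope, from above and from below, of the improved functions.\<close>

definition profile :: "real^'m \<Rightarrow> real" where
  "profile = wgt (- (l / (1 - p)))"

lemma dens_profile: "dens l profile"
proof -
  interpret H: hls_weight l p s tm "wgt l" 1
    by unfold_locales auto
  have h: "profile x = H.mass powr (1 / p) * hmap p (wgt l) x" for x
  proof -
    have "hmap p (wgt l) x = H.mass powr (- 1 / p) * profile x"
      unfolding H.hmap_eq profile_def wgt_powr by simp
    then show ?thesis using H.mass_pos by (simp add: powr_minus)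
  qed
  show ?thesis
    using H.dens_hmap H.mass_pos unfolding dens_def h[abs_def]
    by (auto simp: mult.left_commute[of "wgt l _"])
qed

text \<open>\<open>E n\<close> is the energy of the improved version of \<open>F (k n)\<close>. No
  maximality of \<open>F\<close> is assumed, so the lemma yields both the finiteness of the supremum
  and its attainment.\<close>

lemma existence_limit:
  fixes F :: "nat \<Rightarrow> real^'m \<Rightarrow> real"
  assumes F: "\<And>n. unit_dens (F n)" "\<And>n. centred (F n)"
  obtains g k E where "unit_dens g" "strict_mono (k :: nat \<Rightarrow> nat)" "\<And>n. energy l s (F (k n)) \<le> E n"
    "E \<longlonglongrightarrow> energy l s g"
proof -
  define M where "M n = integral\<^sup>L lborel (F n)" for n
  have M: "M n > 0" for n
    unfolding M_def by (rule centred_bounds(1)[OF F])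
  define C1 where "C1 = 2 powr l * (1 + 2 powr l * 2)"
  define C2 where "C2 = 2 powr l * 2"
  have C: "C1 > 0" "C2 > 0" unfolding C1_def C2_def by (auto intro!: mult_pos_pos add_pos_pos)
  \<comment> \<open>With this factor \<open>w n\<close> is the power \<open>-(s + 1)\<close> of the
    potential divided by the mass, which \<open>centred_bounds\<close> compares with
    \<open>wgt l\<close> uniformly in \<open>n\<close>.\<close>
  define c where "c n = M n powr (s + 1)" for n
  have c: "c n > 0" for n unfolding c_def using M[of n] by simp
  define b where "b = l * (s + 1)"
  define w where "w n y = c n * bpot l (F n) y powr (- s - 1)" for n y
  define \<phi> where "\<phi> n = hpot l (w n)" for n
  interpret D: hls_density l p s tm "F n" "c n" for n
    using F(1)[of n] c[of n] unfolding unit_dens_def by unfold_locales auto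
  have weq: "w n = D.wfn n" for n
    by (rule ext) (simp add: w_def D.wfn_def)
  have phieq: "\<phi> n = D.phi n" for n unfolding \<phi>_def weq D.phi_def ..
  have wn: "w n y = (bpot l (F n) y / M n) powr (- (s + 1))" for n y
  proof -
    have "M n powr (- (s + 1)) = inverse (M n powr (s + 1))" by (rule powr_minus)
    then show ?thesis unfolding w_def c_def powr_divide by (simp add: divide_inverse)
  qed
  have w_le: "w n y \<le> C1 powr (s + 1) * wgt (- b) y" for n y
  proof -
    have "wgt l y / C1 \<le> bpot l (F n) y / M n"
      using centred_bounds(2)[OF F(1)[of n] F(2)[of n], of y, folded M_def] M[of n] C unfolding C1_def[symmetric] by (simp add: field_simps)
    then have "w n y \<le> (wgt l y / C1) powr (- (s + 1))"
      unfolding wn using C s0 by (intro powr_mono2') auto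
    also have "\<dots> = C1 powr (s + 1) * wgt (- b) y"
      unfolding powr_divide wgt_powr b_def mult_minus_right powr_minus[of C1] by (simp add: divide_inverse mult.commute)
    finally show ?thesis .
  qed
  have w_ge: "C2 powr (- (s + 1)) * wgt (- b) y \<le> w n y" for n y
  proof -
    have "bpot l (F n) y / M n \<le> C2 * wgt l y"
      using centred_bounds(3)[OF F(1)[of n] F(2)[of n], of y, folded M_def] M[of n] unfolding C2_def[symmetric] by (simp add: field_simps)
    then have "(C2 * wgt l y) powr (- (s + 1)) \<le> w n y"
      unfolding wn using D.F.bpot_pos[of n y] M[of n] s0 by (intro powr_mono2') auto
    then show ?thesis unfolding powr_mult wgt_powr b_def mult_minus_right .
  qed
  have HW: "half_space_weight l b (C1 powr (s + 1)) (w n)" for n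
  proof
    show "w n \<in> borel_measurable borel" unfolding weq by (rule D.W.w_borel)
    show "0 \<le> w n y" for y unfolding weq by (rule D.W.w_nonneg)
    show "real CARD('m) + 1 < b - l" unfolding b_def by (rule ls1)
  qed (use l0 w_le in auto)
  interpret W: half_space_weight l b "C1 powr (s + 1)" "w n" for n by (rule HW)
  define I0 where "I0 = (1 / 3) powr l * (\<integral>y. indicator (ball (0, 4) 1) y * wgt (- b) y \<partial>(hs :: ((real^'m) \<times> real) measure))"
  define lo1 where "lo1 = C2 powr (- (s + 1)) * I0"
  have C2p: "C2 powr (- (s + 1)) > 0" using C by simp
  have I0: "I0 > 0" unfolding I0_def by (rule W.hpot_ge(2)[of _ 0, OF C2p]) (rule w_ge)
  have lo1: "lo1 > 0" unfolding lo1_def using C2p I0 by simp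
  have phi_ge: "lo1 * wgt l x \<le> \<phi> n x" for n x
    unfolding lo1_def I0_def \<phi>_def by (rule W.hpot_ge(1)[OF C2p]) (rule w_ge)
  define hi1 where "hi1 = C1 powr (s + 1) * (\<integral>y. wgt (- (b - l)) y \<partial>(hs :: ((real^'m) \<times> real) measure))"
  have phi_le: "\<phi> n x \<le> hi1 * wgt l x" for n x
    unfolding hi1_def \<phi>_def by (rule W.hpot_le)
  have hi1: "hi1 > 0"
  proof -
    have "0 < lo1 * wgt l (0 :: real^'m)" using lo1 by simp
    also have "\<dots> \<le> hi1 * wgt l (0 :: real^'m)" using phi_ge[of 0 0] phi_le[of 0 0] by linarith
    finally show ?thesis by (rule zero_less_mult_pos2) simp
  qed
  \<comment> \<open>One dominating weight for all \<open>w n\<close>; its \<open>modulus\<close> is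
    a modulus of continuity for all \<open>\<phi> n\<close> together.\<close>
  interpret P: potential l hs "\<lambda>y. y" "\<lambda>y :: (real^'m) \<times> real. C1 powr (s + 1) * wgt (- b) y"
  proof -
    interpret B: half_space_weight l b "C1 powr (s + 1)" "\<lambda>y :: (real^'m) \<times> real. C1 powr (s + 1) * wgt (- b) y"
      using W.bl l0 by unfold_locales auto
    show "potential l hs (\<lambda>y. y) (\<lambda>y :: (real^'m) \<times> real. C1 powr (s + 1) * wgt (- b) y)"
      by (rule B.Q.potential_axioms)
  qed
  have equi: "\<exists>d>0. \<forall>n y. dist y x < d \<longrightarrow> \<bar>\<phi> n y - \<phi> n x\<bar> < e" if e: "e > 0" for x e
  proof -
    have "\<forall>\<^sub>F z in at (x, 0). dist (P.modulus (x, 0) z) 0 < e"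
      using P.modulus_tendsto_0[of "(x, 0)"] e by (rule tendstoD)
    then obtain d where d: "d > 0" "\<And>z. z \<noteq> (x, 0) \<Longrightarrow> dist z (x, 0) < d \<Longrightarrow> dist (P.modulus (x, 0) z) 0 < e"
      unfolding eventually_at by blast
    have "\<bar>\<phi> n y - \<phi> n x\<bar> < e" if "dist y x < d" for n y
    proof (cases "y = x")
      case False
      have "\<bar>\<phi> n y - \<phi> n x\<bar> \<le> P.modulus (x, 0) (y, 0)"
        unfolding \<phi>_def hpot_def
      proof (rule P.pot_diff_le_modulus)
        show "w n \<in> borel_measurable hs" by (rule borel_measurable_hs) (rule W.w_borel)
        show "AE y in hs. \<bar>w n y\<bar> \<le> C1 powr (s + 1) * wgt (- b) y"
          using w_le W.w_nonneg by (intro AE_I2) simp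
      qed
      also have "\<dots> < e" using d(2)[of "(y, 0)"] False that by (simp add: dist_Pair_Pair)
      finally show ?thesis .
    qed (use e in simp)
    then show ?thesis using d(1) by blast
  qed
  have bdd: "\<bar>\<phi> n x\<bar> \<le> hi1 * wgt l x" for n x
  proof -
    have "0 \<le> lo1 * wgt l x" using lo1 by simp
    then show ?thesis using phi_le[of n x] phi_ge[of x n] by linarith
  qed
  obtain k where k: "strict_mono (k :: nat \<Rightarrow> nat)" "\<And>x. convergent (\<lambda>n. \<phi> (k n) x)"
    using equicontinuous_pointwise_convergent_subsequence[OF bdd equi] by blast
  define \<psi> where "\<psi> x = lim (\<lambda>n. \<phi> (k n) x)" for x
  have lim: "(\<lambda>n. \<phi> (k n) x) \<longlonglongrightarrow> \<psi> x" for x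
    unfolding \<psi>_def using k(2)[of x] by (simp add: convergent_LIMSEQ_iff)
  interpret H: hls_weight l p s tm "\<phi> (k n)" lo1 for n
    using lo1 phi_ge by unfold_locales (auto simp: \<phi>_def W.borel_measurable_hpot)
  interpret L: hls_weight l p s tm \<psi> lo1
  proof
    show "\<psi> \<in> borel_measurable borel"
      by (rule borel_measurable_LIMSEQ_real[OF lim]) (simp add: H.phi_borel)
    show "lo1 * wgt l x \<le> \<psi> x" for x
      by (rule LIMSEQ_le_const[OF lim]) (use phi_ge in auto)
  qed (rule lo1)
  have powlim: "(\<lambda>n. \<phi> (k n) x powr a) \<longlonglongrightarrow> \<psi> x powr a" for x a
    by (rule tendsto_powr[OF lim tendsto_const]) (use L.phi_pos[of x] in simp)
  have masslim: "H.mass \<longlonglongrightarrow> L.mass"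
    unfolding H.mass_def L.mass_def
  proof (rule integral_dominated_convergence)
    show "integrable lborel (\<lambda>x::real^'m. lo1 powr (- (p / (1 - p))) * wgt (- (l * (p / (1 - p)))) x)"
      by (intro integrable_mult_right wgt_integrable) (use lp_gt in simp)
    show "AE x in lborel. norm (\<phi> (k n) x powr (- p / (1 - p))) \<le> lo1 powr (- (p / (1 - p))) * wgt (- (l * (p / (1 - p)))) x" for n
      using H.phi_powr_le[of "p / (1 - p)" n] p0 p1 by (intro AE_I2) simp
  qed (use powlim L.phi_borel H.phi_borel in auto)
  \<comment> \<open>The normalising factors converge to a positive limit, so they are bounded above
    and away from 0. This gives two-sided bounds on \<open>h n\<close> by multiples of
    \<open>profile\<close>.\<close>
  define q where "q n = H.mass n powr (- 1 / p)" for n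
  have qlim: "q \<longlonglongrightarrow> L.mass powr (- 1 / p)"
    unfolding q_def by (rule tendsto_powr[OF masslim tendsto_const]) (use L.mass_pos in simp)
  have q: "q n > 0" for n unfolding q_def using H.mass_pos[of n] by simp
  have "Bseq q" using qlim by (rule convergent_imp_Bseq[OF convergentI])
  then obtain q1 where q1: "q1 > 0" "\<And>n. q n \<le> q1" unfolding Bseq_def by (auto simp: abs_le_iff)
  have "(\<lambda>n. inverse (q n)) \<longlonglongrightarrow> inverse (L.mass powr (- 1 / p))"
    by (rule tendsto_inverse[OF qlim]) (use L.mass_pos in simp)
  then have "Bseq (\<lambda>n. inverse (q n))" by (rule convergent_imp_Bseq[OF convergentI])
  then obtain q2 where q2: "q2 > 0" "\<And>n. inverse (q n) \<le> q2" unfolding Bseq_def using q by (auto simp: abs_of_pos)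
  have q_ge: "inverse q2 \<le> q n" for n
    using q2(2)[of n] q[of n] q2(1) by (metis inverse_inverse_eq le_imp_inverse_le positive_imp_inverse_positive)
  define h where "h n = hmap p (\<phi> (k n))" for n
  define g where "g = hmap p \<psi>"
  define B where "B = q1 * lo1 powr (- (1 / (1 - p)))"
  define A where "A = inverse q2 * hi1 powr (- (1 / (1 - p)))"
  have A: "A > 0" unfolding A_def using q2(1) hi1 by simp
  have h_le: "h n x \<le> B * profile x" for n x
  proof -
    have "h n x \<le> q n * lo1 powr (- (1 / (1 - p))) * wgt (- (l / (1 - p))) x"
      unfolding h_def q_def by (rule H.hmap_le)
    also have "\<dots> \<le> q1 * lo1 powr (- (1 / (1 - p))) * wgt (- (l / (1 - p))) x"
      by (intro mult_right_mono q1) auto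
    finally show ?thesis unfolding B_def profile_def .
  qed
  have h_ge: "A * profile x \<le> h n x" for n x
  proof -
    have "(hi1 * wgt l x) powr (- (1 / (1 - p))) \<le> \<phi> (k n) x powr (- (1 / (1 - p)))"
      using phi_le[of "k n" x] H.phi_pos[of n x] p1 by (intro powr_mono2') auto
    then have "inverse q2 * (hi1 * wgt l x) powr (- (1 / (1 - p))) \<le> q n * \<phi> (k n) x powr (- (1 / (1 - p)))"
      using q_ge[of n] q2(1) q[of n] by (intro mult_mono) auto
    then show ?thesis
      unfolding h_def H.hmap_eq q_def[symmetric] A_def profile_def powr_mult wgt_powr by (simp add: mult.assoc)
  qed
  have hlim: "(\<lambda>n. h n x) \<longlonglongrightarrow> g x" for x
    unfolding h_def g_def H.hmap_eq L.hmap_eq q_def[symmetric] by (intro tendsto_mult qlim powlim)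
  interpret R: boundary_density l profile by unfold_locales (rule dens_profile)
  have ulim: "(\<lambda>n. bpot l (h n) z) \<longlonglongrightarrow> bpot l g z" for z
    unfolding bpot_eq
  proof (rule integral_dominated_convergence)
    show "integrable lborel (\<lambda>x. B * (norm ((x, 0) - z) powr l * profile x))"
      by (intro integrable_mult_right R.bpot_integrable)
    show "AE x in lborel. (\<lambda>n. norm ((x, 0) - z) powr l * h n x) \<longlonglongrightarrow> norm ((x, 0) - z) powr l * g x"
      by (intro AE_I2 tendsto_mult tendsto_const hlim)
    show "AE x in lborel. norm (norm ((x, 0) - z) powr l * h n x) \<le> B * (norm ((x, 0) - z) powr l * profile x)" for n
    proof (rule AE_I2)
      fix x
      have "norm ((x, 0) - z) powr l * h n x \<le> norm ((x, 0) - z) powr l * (B * profile x)"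
        by (intro mult_left_mono h_le) simp
      moreover have "0 \<le> h n x" using H.hmap_pos[of n x] unfolding h_def by simp
      ultimately show "norm (norm ((x, 0) - z) powr l * h n x) \<le> B * (norm ((x, 0) - z) powr l * profile x)"
        by (simp add: mult_ac)
    qed
    show "(\<lambda>x. norm ((x, 0) - z) powr l * h n x) \<in> borel_measurable lborel" for n
      unfolding h_def measurable_lborel1 using H.hmap_borel[of n] by measurable
    show "(\<lambda>x. norm ((x, 0) - z) powr l * g x) \<in> borel_measurable lborel"
      unfolding g_def measurable_lborel1 using L.hmap_borel by measurable
  qed
  obtain r where r: "r > 0" "\<And>z. r * wgt l z \<le> bpot l profile z" using R.bpot_ge by blast
  \<comment> \<open>The lower bound on \<open>h n\<close> is needed here: it keeps the potentials
    uniformly large, which dominates their negative powers.\<close>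
  have u_ge: "A * r * wgt l z \<le> bpot l (h n) z" for n z
  proof -
    interpret N: boundary_density l "h n" unfolding h_def by unfold_locales (rule H.dens_hmap)
    have "A * (r * wgt l z) \<le> A * bpot l profile z" using A r(2) by (intro mult_left_mono) auto
    also have "\<dots> = (\<integral>x. A * (norm ((x, 0) - z) powr l * profile x) \<partial>lborel)" unfolding bpot_eq by simp
    also have "\<dots> \<le> bpot l (h n) z"
      unfolding bpot_eq
    proof (rule integral_mono[OF integrable_mult_right[OF R.bpot_integrable] N.bpot_integrable])
      fix x
      have "norm ((x, 0) - z) powr l * (A * profile x) \<le> norm ((x, 0) - z) powr l * h n x"
        by (intro mult_left_mono h_ge) simp
      then show "A * (norm ((x, 0) - z) powr l * profile x) \<le> norm ((x, 0) - z) powr l * h n x"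
        by (simp add: mult_ac)
    qed
    finally show ?thesis by (simp add: mult.assoc)
  qed
  have gd: "dens l g" and hd: "dens l (h n)" for n
    unfolding g_def h_def by (rule L.dens_hmap, rule H.dens_hmap)
  have elim: "(\<lambda>n. energy l s (h n)) \<longlonglongrightarrow> energy l s g"
    unfolding energy_def
  proof (rule integral_dominated_convergence)
    show "integrable hs (\<lambda>y :: (real^'m) \<times> real. (A * r) powr (- s) * wgt (- (l * s)) y)"
      by (intro integrable_mult_right wgt_integrable_hs ls_gt)
    show "AE y in hs. norm (bpot l (h n) y powr (- s)) \<le> (A * r) powr (- s) * wgt (- (l * s)) y" for n
      using bpot_powr_le[OF hd _ u_ge, of s n] A r(1) s0 by (intro AE_I2) simp
    show "AE y in hs. (\<lambda>n. bpot l (h n) y powr (- s)) \<longlonglongrightarrow> bpot l g y powr (- s)"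
    proof (rule AE_I2)
      interpret G: boundary_density l g by unfold_locales (rule gd)
      fix y show "(\<lambda>n. bpot l (h n) y powr (- s)) \<longlonglongrightarrow> bpot l g y powr (- s)"
        by (rule tendsto_powr[OF ulim tendsto_const]) (use G.bpot_pos[of y] in simp)
    qed
  qed (rule borel_measurable_integrable, rule energy_integrable, rule gd hd)+
  show ?thesis
  proof (rule that[OF _ k(1) _ elim])
    show "unit_dens g"
      unfolding unit_dens_def using gd L.hmap_powr_integrable L.hmap_powr_integral unfolding g_def by simp
    show "energy l s (F (k n)) \<le> energy l s (h n)" for n
      unfolding h_def phieq by (rule D.energy_improve)
  qed
qed

end

subsection \<open>Functions compared with all their reflections\<close>

definition refl_hyp :: "'a::real_inner \<Rightarrow> real \<Rightarrow> 'a \<Rightarrow> 'a" where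
  "refl_hyp e t x = x - (2 * (x \<bullet> e - t)) *\<^sub>R e"

lemma refl_hyp_side:
  assumes "norm e = 1" shows "refl_hyp e t x \<bullet> e - t = - (x \<bullet> e - t)"
proof -
  have "e \<bullet> e = 1" using assms by (simp add: norm_eq_1)
  then show ?thesis unfolding refl_hyp_def by (simp add: inner_diff_left algebra_simps)
qed

lemma refl_hyp_involution:
  assumes "norm e = 1" shows "refl_hyp e t (refl_hyp e t x) = x"
  unfolding refl_hyp_def[of e t "refl_hyp e t x"] refl_hyp_side[OF assms]
  by (simp add: refl_hyp_def flip: scaleR_minus_left)

lemma refl_hyp_uminus: "refl_hyp (- e) (- t) x = refl_hyp e t x"
  unfolding refl_hyp_def by (simp add: algebra_simps)

lemma refl_hyp_fixed: "x \<bullet> e = t \<Longrightarrow> refl_hyp e t x = x"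
  unfolding refl_hyp_def by simp

definition reflection_ordered :: "('a::real_inner \<Rightarrow> real) \<Rightarrow> bool" where
  "reflection_ordered F \<longleftrightarrow> (\<forall>e t. norm e = 1 \<longrightarrow>
     (\<forall>x. x \<bullet> e > t \<longrightarrow> F x > F (refl_hyp e t x)) \<or>
     (\<forall>x. x \<bullet> e > t \<longrightarrow> F x < F (refl_hyp e t x)) \<or>
     (\<forall>x. F x = F (refl_hyp e t x)))"

lemma reflection_orderedD:
  assumes "reflection_ordered F" "norm e = 1"
  shows "(\<forall>x. x \<bullet> e > t \<longrightarrow> F x > F (refl_hyp e t x)) \<or>
     (\<forall>x. x \<bullet> e > t \<longrightarrow> F x < F (refl_hyp e t x)) \<or> (\<forall>x. F x = F (refl_hyp e t x))"
  using assms unfolding reflection_ordered_def by blast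

text \<open>Once the maximum point is unique, a reflection exchanging two given points is decided by
  the side on which that point lies.\<close>

lemma reflection_ordered_radial:
  fixes F :: "'a::euclidean_space \<Rightarrow> real"
  assumes cont: "continuous_on UNIV F" and pos: "\<And>x. F x > 0" and lim: "(F \<longlongrightarrow> 0) at_infinity"
    and ord: "reflection_ordered F"
  obtains h x0 where "\<And>t. 0 \<le> h t" "strict_antimono_on {0..} h" "\<And>x. F x = h (norm (x + x0))"
proof -
  have small: "\<exists>R. \<forall>x. norm x \<ge> R \<longrightarrow> F x < c" if "c > 0" for c
    using order_tendstoD(2)[OF lim that] unfolding eventually_at_infinity by blast
  obtain R where R: "\<And>x. norm x \<ge> R \<Longrightarrow> F x < F 0" using small[OF pos[of 0]] by blast
  have R0: "R > 0" using R[of 0] by (cases "R > 0") auto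
  obtain x0 where x0: "x0 \<in> cball 0 R" "\<And>x. x \<in> cball 0 R \<Longrightarrow> F x \<le> F x0"
    using continuous_attains_sup[OF compact_cball, of 0 R F] R0 continuous_on_subset[OF cont] by auto
  have max: "F x \<le> F x0" for x
  proof (cases "norm x \<le> R")
    case False
    then have "F x < F 0" using R[of x] by simp
    also have "\<dots> \<le> F x0" using x0(2)[of 0] R0 by simp
    finally show ?thesis by simp
  qed (use x0(2) in simp)
  have unique: "F b < F x0" if "b \<noteq> x0" for b
  proof (rule ccontr)
    assume "\<not> F b < F x0"
    then have b: "F b = F x0" using max[of b] by simp
    define L where "L = norm (b - x0)"
    have L: "L > 0" unfolding L_def using that by simp
    define e where "e = (1 / L) *\<^sub>R (b - x0)"
    have e: "norm e = 1" unfolding e_def using L unfolding L_def by simp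
    then have ee: "e \<bullet> e = 1" by (simp add: norm_eq_1)
    define k where "k r = F (x0 + r *\<^sub>R e)" for r
    have kmax: "k r \<le> k 0" for r unfolding k_def using max by simp
    have kL: "k L = k 0" unfolding k_def e_def using L b by simp
    have rf: "refl_hyp e (x0 \<bullet> e + d) (x0 + r *\<^sub>R e) = x0 + (2 * d - r) *\<^sub>R e" for d r
    proof -
      have 1: "(x0 + r *\<^sub>R e) \<bullet> e - (x0 \<bullet> e + d) = r - d" by (simp add: inner_add_left ee)
      have "refl_hyp e (x0 \<bullet> e + d) (x0 + r *\<^sub>R e) = x0 + (r - 2 * (r - d)) *\<^sub>R e"
        unfolding refl_hyp_def 1 by (simp only: scaleR_diff_left add_diff_eq)
      then show ?thesis by simp
    qed
    have tri: "(\<forall>r>d. k r > k (2 * d - r)) \<or> (\<forall>r>d. k r < k (2 * d - r)) \<or> (\<forall>r. k r = k (2 * d - r))" for d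
    proof -
      have i: "(x0 + r *\<^sub>R e) \<bullet> e > x0 \<bullet> e + d \<longleftrightarrow> r > d" for r by (simp add: inner_add_left ee)
      show ?thesis
        using reflection_orderedD[OF ord e, of "x0 \<bullet> e + d"] unfolding k_def rf[symmetric] using i by blast
    qed
    \<comment> \<open>On the line through two maximum points at parameters 0 and \<open>L\<close>,
      the midpoints \<open>L / 4\<close> and \<open>L / 2\<close> are tested. At
      \<open>L / 4\<close>, the value at \<open>L / 2\<close> cannot exceed that at 0, nor the value
      at \<open>- L / 2\<close> that at \<open>L\<close>, so symmetry remains. Two symmetry centres
      give the period \<open>L / 2\<close>, against decay at infinity.\<close>
    have s1: "k r = k (L / 2 - r)" for r
    proof -
      have "\<not> (\<forall>r>L/4. k r > k (2 * (L / 4) - r))"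
        using kmax[of "L / 2"] L by (auto intro!: exI[of _ "L / 2"] simp: not_less)
      moreover have "\<not> (\<forall>r>L/4. k r < k (2 * (L / 4) - r))"
        using kmax[of "2 * (L / 4) - L"] kL L by (auto intro!: exI[of _ L] simp: not_less)
      ultimately have "\<forall>r. k r = k (2 * (L / 4) - r)" using tri[of "L / 4"] by blast
      then show ?thesis by simp
    qed
    have s2: "k r = k (L - r)" for r
    proof -
      have "\<not> (\<forall>r>L/2. k r > k (2 * (L / 2) - r))"
        using kL L by (auto intro!: exI[of _ L] simp: not_less)
      moreover have "\<not> (\<forall>r>L/2. k r < k (2 * (L / 2) - r))"
        using kL L by (auto intro!: exI[of _ L] simp: not_less)
      ultimately have "\<forall>r. k r = k (2 * (L / 2) - r)" using tri[of "L / 2"] by blast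
      then show ?thesis by simp
    qed
    have per: "k (r + L / 2) = k r" for r
      using s2[of "r + L / 2"] s1[of r] by (simp add: algebra_simps)
    have kn: "k (real n * (L / 2)) = k 0" for n
    proof (induction n)
      case (Suc n)
      have "real (Suc n) * (L / 2) = real n * (L / 2) + L / 2" by (simp add: algebra_simps)
      then show ?case using per[of "real n * (L / 2)"] Suc by metis
    qed simp
    obtain R' where R': "\<And>x. norm x \<ge> R' \<Longrightarrow> F x < F x0" using small[OF pos[of x0]] by blast
    obtain n :: nat where n: "real n > (R' + norm x0) / (L / 2)" using reals_Archimedean2 by blast
    have "R' + norm x0 < real n * (L / 2)" using n L by (simp add: field_simps)
    also have "\<dots> = norm ((real n * (L / 2)) *\<^sub>R e)" using e L by simp
    also have "\<dots> \<le> norm (x0 + (real n * (L / 2)) *\<^sub>R e) + norm x0"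
      by (metis add.commute add_diff_cancel_left' norm_triangle_ineq4)
    finally have "F (x0 + (real n * (L / 2)) *\<^sub>R e) < F x0" by (intro R') simp
    then show False using kn[of n] unfolding k_def by simp
  qed
  \<comment> \<open>The hyperplane is the perpendicular bisector of \<open>a\<close> and
    \<open>b\<close>; \<open>x0\<close> lies strictly on the side of \<open>a\<close>, and strict
    maximality at \<open>x0\<close> selects the alternative of
    \<open>reflection_ordered\<close>.\<close>
  have dec: "F b < F a" if lt: "norm (a - x0) < norm (b - x0)" for a b
  proof -
    define L where "L = norm (a - b)"
    have L: "L > 0" unfolding L_def using lt by auto
    define e where "e = (1 / L) *\<^sub>R (a - b)"
    have e: "norm e = 1" unfolding e_def using L unfolding L_def by simp
    define t where "t = (a + b) \<bullet> e / 2"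
    have LL: "L * L = (a - b) \<bullet> (a - b)" unfolding L_def by (metis dot_square_norm power2_eq_square)
    have ae: "2 * (a \<bullet> e - t) = L"
    proof -
      have "2 * (a \<bullet> e - t) = (a - b) \<bullet> e" unfolding t_def by (simp add: algebra_simps)
      also have "\<dots> = L" unfolding e_def inner_scaleR_right LL[symmetric] using L by simp
      finally show ?thesis .
    qed
    have ref: "refl_hyp e t a = b"
      unfolding refl_hyp_def ae using L unfolding e_def by simp
    have "(norm (a - x0))\<^sup>2 < (norm (b - x0))\<^sup>2" using lt by (intro power_strict_mono) auto
    then have "(a + b) \<bullet> (a - b) < 2 * (x0 \<bullet> (a - b))"
      unfolding power2_norm_eq_inner by (simp add: algebra_simps inner_commute)
    then have side: "x0 \<bullet> e > t"
      unfolding t_def e_def inner_scaleR_right using L by (simp add: divide_simps mult.commute)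
    have "refl_hyp e t x0 \<noteq> x0" using side e unfolding refl_hyp_def by auto
    then have "F x0 > F (refl_hyp e t x0)" by (rule unique)
    then have "\<forall>x. x \<bullet> e > t \<longrightarrow> F x > F (refl_hyp e t x)"
      using reflection_orderedD[OF ord e, of t] side by (metis less_irrefl less_asym)
    moreover have "a \<bullet> e > t"
    proof -
      have "0 < 2 * (a \<bullet> e - t)" unfolding ae by (rule L)
      then show ?thesis by simp
    qed
    ultimately show ?thesis using ref by metis
  qed
  \<comment> \<open>At equal distance, \<open>a\<close> is approached along its ray by points
    strictly closer to \<open>x0\<close> than \<open>b\<close>, and continuity passes to the
    limit.\<close>
  have le: "F b \<le> F a" if eq: "norm (a - x0) = norm (b - x0)" for a b
  proof (cases "b = x0")
    case False
    have nb: "norm (b - x0) > 0" using False by simp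
    define X where "X n = x0 + (1 - 1 / real (Suc n)) *\<^sub>R (a - x0)" for n
    have "X \<longlonglongrightarrow> x0 + (1 - 0) *\<^sub>R (a - x0)"
      unfolding X_def by (intro tendsto_intros LIMSEQ_Suc[OF lim_1_over_n])
    then have "X \<longlonglongrightarrow> a" by simp
    moreover have "isCont F a" using cont by (simp add: continuous_on_eq_continuous_at)
    ultimately have "(\<lambda>n. F (X n)) \<longlonglongrightarrow> F a" by (rule isCont_tendsto_compose[rotated])
    moreover have "F b \<le> F (X n)" for n
    proof -
      have "norm (X n - x0) = (1 - 1 / real (Suc n)) * norm (b - x0)"
        unfolding X_def using eq by simp
      also have "\<dots> < norm (b - x0)" using nb by (simp add: field_simps)
      finally show ?thesis using dec[of "X n" b] by simp
    qed
    ultimately show ?thesis by (intro LIMSEQ_le_const) auto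
  qed (use eq in simp)
  obtain e0 :: 'a where e0: "e0 \<in> Basis" using nonempty_Basis by blast
  define h where "h r = F (x0 + r *\<^sub>R e0)" for r
  show ?thesis
  proof (rule that)
    show "0 \<le> h t" for t unfolding h_def using pos[of "x0 + t *\<^sub>R e0"] by simp
    show "strict_antimono_on {0..} h"
      unfolding monotone_on_def h_def using e0 by (auto intro!: dec)
    show "F x = h (norm (x + (- x0)))" for x
      unfolding h_def using e0 by (intro antisym le) auto
  qed
qed


subsection \<open>Linear isometries preserve Lebesgue measure\<close>

lemma nn_integral_lborel_affine:
  fixes F :: "'a::euclidean_space \<Rightarrow> ennreal"
  assumes "c \<noteq> 0" and [measurable]: "F \<in> borel_measurable borel"
  shows "(\<integral>\<^sup>+x. F x \<partial>lborel) = ennreal (\<bar>c\<bar> ^ DIM('a)) * (\<integral>\<^sup>+x. F (t + c *\<^sub>R x) \<partial>lborel)"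
proof -
  have [measurable]: "(\<lambda>x::'a. t + c *\<^sub>R x) \<in> borel_measurable lborel"
    unfolding measurable_lborel1 by measurable
  have "(\<integral>\<^sup>+x. F x \<partial>lborel) = (\<integral>\<^sup>+x. F x \<partial>density (distr lborel borel (\<lambda>x::'a. t + c *\<^sub>R x)) (\<lambda>_. ennreal (\<bar>c\<bar> ^ DIM('a))))"
    using lborel_affine[OF assms(1), of t] by simp
  also have "\<dots> = (\<integral>\<^sup>+x. ennreal (\<bar>c\<bar> ^ DIM('a)) * F x \<partial>distr lborel borel (\<lambda>x::'a. t + c *\<^sub>R x))"
    by (rule nn_integral_density) auto
  also have "\<dots> = (\<integral>\<^sup>+x. ennreal (\<bar>c\<bar> ^ DIM('a)) * F (t + c *\<^sub>R x) \<partial>lborel)"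
    by (rule nn_integral_distr) auto
  also have "\<dots> = ennreal (\<bar>c\<bar> ^ DIM('a)) * (\<integral>\<^sup>+x. F (t + c *\<^sub>R x) \<partial>lborel)"
    by (rule nn_integral_cmult) auto
  finally show ?thesis .
qed

lemma distr_lborel_isometry:
  fixes T :: "'a::euclidean_space \<Rightarrow> 'a"
  assumes lin: "linear T" and iso: "\<And>x. norm (T x) = norm x"
  shows "distr lborel borel T = lborel"
proof (rule measure_eqI)
  have Tm[measurable]: "T \<in> borel_measurable borel"
    by (intro borel_measurable_continuous_onI linear_continuous_on linear_conv_bounded_linear[THEN iffD1] lin)
  have Tml: "T \<in> borel_measurable lborel" using Tm by (simp add: measurable_lborel1)
  show "sets (distr lborel borel T) = sets lborel" by simp
  fix A assume "A \<in> sets (distr lborel borel T)"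
  then have A[measurable]: "A \<in> sets borel" by simp
  have "inj T"
    using linear_injective_0[OF lin] iso by (metis norm_eq_zero)
  then have surj: "surj T" using linear_injective_imp_surjective[OF lin] by blast
  define B where "B = (ball 0 1 :: 'a set)"
  have B[measurable]: "B \<in> sets borel" unfolding B_def by simp
  have BT: "indicator B (T z) = (indicator B z :: ennreal)" for z
    unfolding B_def by (simp add: indicator_def iso)
  have shift: "(\<integral>\<^sup>+y. indicator C (y - a) \<partial>lborel) = emeasure lborel C" if [measurable]: "C \<in> sets borel" for C and a :: 'a
    using nn_integral_lborel_affine[of 1 "indicator C" "- a"] by simp
  text \<open>As in the uniqueness proof for Haar measure, \<open>\<integral>\<integral> 1\<^sub>A(T z) 1\<^sub>B(y - T z)\<close> is evaluated in both orders,
    for the unit ball \<open>B\<close>, which \<open>T\<close> preserves.\<close>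
  have inner: "(\<integral>\<^sup>+z. indicator A (T z) * indicator B (y - T z) \<partial>lborel)
      = (\<integral>\<^sup>+z. indicator B z * indicator A (y - T z) \<partial>lborel)" for y
  proof -
    \<comment> \<open>Surjectivity writes \<open>y - T z\<close> as \<open>T (d - z)\<close>;
      replacing \<open>z\<close> by \<open>d - z\<close> exchanges the two indicators, and
      \<open>BT\<close> removes \<open>T\<close> from the one of \<open>B\<close>.\<close>
    obtain d where d: "T d = y" using surj by (metis surjD)
    have "(\<integral>\<^sup>+z. indicator A (T z) * indicator B (y - T z) \<partial>lborel)
        = (\<integral>\<^sup>+z. indicator A (T (d + (-1) *\<^sub>R z)) * indicator B (y - T (d + (-1) *\<^sub>R z)) \<partial>lborel)"
      using nn_integral_lborel_affine[of "-1" "\<lambda>z. indicator A (T z) * indicator B (y - T z)" d] by simp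
    also have "\<dots> = (\<integral>\<^sup>+z. indicator B z * indicator A (y - T z) \<partial>lborel)"
      by (intro nn_integral_cong) (simp add: linear_diff[OF lin] d BT mult.commute)
    finally show ?thesis .
  qed
  have m1: "(\<lambda>(y, z). indicator A (T z) * indicator B (y - T z) :: ennreal) \<in> borel_measurable (lborel \<Otimes>\<^sub>M lborel)"
    by (subst measurable_cong_sets[OF sets_pair_measure_cong[OF sets_lborel sets_lborel] refl]) measurable
  have m2: "(\<lambda>(y, z). indicator B z * indicator A (y - T z) :: ennreal) \<in> borel_measurable (lborel \<Otimes>\<^sub>M lborel)"
    by (subst measurable_cong_sets[OF sets_pair_measure_cong[OF sets_lborel sets_lborel] refl]) measurable
  have "emeasure lborel B * emeasure (distr lborel borel T) A = emeasure lborel B * (\<integral>\<^sup>+z. indicator A (T z) \<partial>lborel)"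
    using nn_integral_distr[OF Tml, of "indicator A"] by simp
  also have "\<dots> = (\<integral>\<^sup>+z. emeasure lborel B * indicator A (T z) \<partial>lborel)"
    by (rule nn_integral_cmult[symmetric]) (simp add: measurable_lborel1)
  also have "\<dots> = (\<integral>\<^sup>+z. (\<integral>\<^sup>+y. indicator A (T z) * indicator B (y - T z) \<partial>lborel) \<partial>lborel)"
  proof (intro nn_integral_cong)
    fix z
    have "(\<integral>\<^sup>+y. indicator A (T z) * indicator B (y - T z) \<partial>lborel)
        = indicator A (T z) * (\<integral>\<^sup>+y. indicator B (y - T z) \<partial>lborel)"
      by (rule nn_integral_cmult) (simp add: measurable_lborel1)
    then show "emeasure lborel B * indicator A (T z) = (\<integral>\<^sup>+y. indicator A (T z) * indicator B (y - T z) \<partial>lborel)"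
      using shift[OF B, of "T z"] by (simp add: mult.commute)
  qed
  also have "\<dots> = (\<integral>\<^sup>+y. (\<integral>\<^sup>+z. indicator A (T z) * indicator B (y - T z) \<partial>lborel) \<partial>lborel)"
    using lborel_pair.Fubini'[OF m1] by simp
  also have "\<dots> = (\<integral>\<^sup>+y. (\<integral>\<^sup>+z. indicator B z * indicator A (y - T z) \<partial>lborel) \<partial>lborel)"
    unfolding inner ..
  also have "\<dots> = (\<integral>\<^sup>+z. (\<integral>\<^sup>+y. indicator B z * indicator A (y - T z) \<partial>lborel) \<partial>lborel)"
    using lborel_pair.Fubini'[OF m2] by simp
  also have "\<dots> = (\<integral>\<^sup>+z. emeasure lborel A * indicator B z \<partial>lborel)"
  proof (intro nn_integral_cong)
    fix z
    have "(\<integral>\<^sup>+y. indicator B z * indicator A (y - T z) \<partial>lborel)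
        = indicator B z * (\<integral>\<^sup>+y. indicator A (y - T z) \<partial>lborel)"
      by (rule nn_integral_cmult) (simp add: measurable_lborel1)
    then show "(\<integral>\<^sup>+y. indicator B z * indicator A (y - T z) \<partial>lborel) = emeasure lborel A * indicator B z"
      using shift[OF A, of "T z"] by (simp add: mult.commute)
  qed
  also have "\<dots> = emeasure lborel B * emeasure lborel A"
    by (subst nn_integral_cmult) (auto simp: mult.commute)
  finally have "emeasure lborel B * emeasure (distr lborel borel T) A = emeasure lborel B * emeasure lborel A" .
  moreover have "emeasure lborel B \<noteq> 0"
    unfolding B_def using emeasure_ball[of 1 "0::'a"] unit_ball_vol_pos[of "real DIM('a)"]
    by (simp del: unit_ball_vol_pos)
  moreover have "emeasure lborel B \<noteq> \<infinity>"
    unfolding B_def using emeasure_lborel_ball_finite[of "0::'a" 1] by simp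
  ultimately show "emeasure (distr lborel borel T) A = emeasure lborel A"
    by (simp add: ennreal_mult_cancel_left)
qed

lemma refl_hyp_borel [measurable]: "refl_hyp e t \<in> borel_measurable (borel :: 'a::euclidean_space measure)"
  unfolding refl_hyp_def[abs_def] by measurable

text \<open>The reflection is the linear isometry for \<open>t = 0\<close> followed by the
  translation by \<open>(2 * t) *\<^sub>R e\<close>.\<close>

lemma distr_lborel_refl_hyp:
  fixes e :: "'a::euclidean_space"
  assumes e: "norm e = 1"
  shows "distr lborel borel (refl_hyp e t) = lborel"
proof -
  have ee: "e \<bullet> e = 1" using e by (simp add: norm_eq_1)
  have lin: "linear (refl_hyp e 0)"
    unfolding refl_hyp_def[abs_def] by (rule linearI) (simp_all add: algebra_simps)
  have "norm (refl_hyp e 0 x) = norm x" for x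
    unfolding norm_eq_sqrt_inner refl_hyp_def by (simp add: inner_diff_left inner_diff_right inner_commute ee)
  note 1 = distr_lborel_isometry[OF lin this]
  have "refl_hyp e t = (+) ((2 * t) *\<^sub>R e) \<circ> refl_hyp e 0"
    by (rule ext) (simp add: refl_hyp_def algebra_simps)
  then have "distr lborel borel (refl_hyp e t) = distr (distr lborel borel (refl_hyp e 0)) borel ((+) ((2 * t) *\<^sub>R e))"
    by (subst distr_distr) (auto simp: measurable_lborel1)
  also have "\<dots> = lborel" unfolding 1 by (rule lborel_distr_plus)
  finally show ?thesis .
qed

lemma
  fixes e :: "'a::euclidean_space" and F :: "'a \<Rightarrow> real"
  assumes e: "norm e = 1" and [measurable]: "F \<in> borel_measurable borel"
  shows integrable_refl_hyp: "integrable lborel F \<Longrightarrow> integrable lborel (\<lambda>x. F (refl_hyp e t x))"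
    and integral_refl_hyp: "(\<integral>x. F (refl_hyp e t x) \<partial>lborel) = integral\<^sup>L lborel F"
proof -
  have r: "refl_hyp e t \<in> lborel \<rightarrow>\<^sub>M borel" by (simp add: measurable_lborel1)
  show "integrable lborel F \<Longrightarrow> integrable lborel (\<lambda>x. F (refl_hyp e t x))"
    using integrable_distr_eq[OF r assms(2)] unfolding distr_lborel_refl_hyp[OF e] by simp
  show "(\<integral>x. F (refl_hyp e t x) \<partial>lborel) = integral\<^sup>L lborel F"
    using integral_distr[OF r assms(2)] unfolding distr_lborel_refl_hyp[OF e] by simp
qed

lemma refl_hyp_Pair: "refl_hyp (e, 0) t (x, r) = (refl_hyp e t x, r)"
  unfolding refl_hyp_def by simp

lemma refl_hyp_half_space: "refl_hyp (e, 0) t y \<in> half_space \<longleftrightarrow> y \<in> half_space"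
  unfolding half_space_def refl_hyp_def by simp

lemma
  fixes e :: "real^'m" and F :: "(real^'m) \<times> real \<Rightarrow> real"
  assumes e: "norm e = 1" and F[measurable]: "F \<in> borel_measurable borel"
  shows hs_integrable_refl_hyp: "integrable hs F \<Longrightarrow> integrable hs (\<lambda>x. F (refl_hyp (e, 0) t x))"
    and hs_integral_refl_hyp: "(\<integral>y. F (refl_hyp (e, 0) t y) \<partial>hs) = integral\<^sup>L hs F"
proof -
  let ?r = "refl_hyp (e, 0::real) t"
  have e': "norm (e, 0::real) = 1" using e by (simp add: norm_Pair)
  have [measurable]: "(half_space :: ((real^'m) \<times> real) set) \<in> sets borel"
    by (rule borel_open[OF open_half_space])
  have i: "indicator half_space (?r y) *\<^sub>R F (?r y) = indicator half_space y *\<^sub>R F (?r y)" for y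
    using refl_hyp_half_space[of e t y] by (simp add: indicator_def)
  have m: "(\<lambda>y. indicator half_space y *\<^sub>R F y) \<in> borel_measurable borel" by measurable
  show "integrable hs F \<Longrightarrow> integrable hs (\<lambda>x. F (?r x))"
    unfolding hs_def integrable_restrict_space[OF sets_hs_Int]
    using integrable_refl_hyp[OF e' m, of t] unfolding i by blast
  show "(\<integral>y. F (?r y) \<partial>hs) = integral\<^sup>L hs F"
    unfolding hs_def integral_restrict_space[OF sets_hs_Int]
    using integral_refl_hyp[OF e' m, of t] unfolding i .
qed

subsection \<open>Polarization\<close>

text \<open>Both values move by the same amount in opposite directions. The slope of the convex
  power is steeper at the smaller argument, so the gain there outweighs the loss at the other;
  strictness comes from the tangent at \<open>a\<close>.\<close>

lemma two_point_aux:
  fixes a b a' b' s :: real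
  assumes "0 < a'" "a' \<le> a" "a \<le> b" "a' + b' = a + b" "s > 0"
  shows "a powr (-s) + b powr (-s) \<le> a' powr (-s) + b' powr (-s)"
    and "a powr (-s) + b powr (-s) = a' powr (-s) + b' powr (-s) \<Longrightarrow> a = a'"
proof -
  have pos: "0 < a" "0 < b" "0 < b'" and d: "b - b' = - (a - a')" using assms by auto
  have m: "b powr (-s - 1) \<le> a powr (-s - 1)" using assms pos by (intro powr_mono2') auto
  have 1: "a powr (-s) + s * a powr (-s - 1) * (a - a') \<le> a' powr (-s)"
    using powr_convex_tangent(1)[OF pos(1) assms(1,5)] .
  have 2: "b powr (-s) - s * b powr (-s - 1) * (a - a') \<le> b' powr (-s)"
    using powr_convex_tangent(1)[OF pos(2,3) assms(5)] unfolding d mult_minus_right by linarith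
  have 3: "s * b powr (-s - 1) * (a - a') \<le> s * a powr (-s - 1) * (a - a')"
    using m assms by (intro mult_right_mono mult_left_mono) auto
  show "a powr (-s) + b powr (-s) \<le> a' powr (-s) + b' powr (-s)" using 1 2 3 by linarith
  assume "a powr (-s) + b powr (-s) = a' powr (-s) + b' powr (-s)"
  then have "a powr (-s) + s * a powr (-s - 1) * (a - a') = a' powr (-s)" using 1 2 3 by linarith
  then show "a = a'" by (rule powr_convex_tangent(2)[OF pos(1) assms(1,5)])
qed

lemma two_point:
  fixes a b a' b' s :: real
  assumes "0 < a'" "0 < b'" "0 < a" "0 < b" "a' + b' = a + b" "\<bar>a - b\<bar> \<le> \<bar>a' - b'\<bar>" "s > 0"
  shows "a powr (-s) + b powr (-s) \<le> a' powr (-s) + b' powr (-s)"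
    and "a powr (-s) + b powr (-s) = a' powr (-s) + b' powr (-s) \<Longrightarrow> \<bar>a - b\<bar> = \<bar>a' - b'\<bar>"
proof -
  define u v u' v' where "u = min a b" and "v = max a b" and "u' = min a' b'" and "v' = max a' b'"
  have uv: "0 < u'" "u' \<le> u" "u \<le> v" "u' + v' = u + v"
    unfolding u_def v_def u'_def v'_def using assms by (auto simp: min_def max_def abs_if split: if_splits)
  have e: "a powr (-s) + b powr (-s) = u powr (-s) + v powr (-s)" "a' powr (-s) + b' powr (-s) = u' powr (-s) + v' powr (-s)"
    unfolding u_def v_def u'_def v'_def by (auto simp: min_def max_def)
  show "a powr (-s) + b powr (-s) \<le> a' powr (-s) + b' powr (-s)"
    unfolding e by (rule two_point_aux[OF uv assms(7)])
  assume "a powr (-s) + b powr (-s) = a' powr (-s) + b' powr (-s)"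
  then have "u = u'" unfolding e by (rule two_point_aux(2)[OF uv assms(7)])
  then show "\<bar>a - b\<bar> = \<bar>a' - b'\<bar>"
    using uv(4) unfolding u_def v_def u'_def v'_def by (auto simp: min_def max_def split: if_splits)
qed

text \<open>The added product is positive exactly when both points lie strictly on the same side, so
  reflecting one of them then moves them apart.\<close>

lemma norm_diff_refl_hyp_sq:
  assumes "norm e = 1"
  shows "(norm (a - refl_hyp e t b))\<^sup>2 = (norm (a - b))\<^sup>2 + 4 * (a \<bullet> e - t) * (b \<bullet> e - t)"
proof -
  have ee: "e \<bullet> e = 1" using assms by (simp add: norm_eq_1)
  define c where "c = b \<bullet> e - t"
  have d: "a - refl_hyp e t b = (a - b) + (2 * c) *\<^sub>R e"
    unfolding refl_hyp_def c_def by simp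
  have "(norm (v + (2 * c) *\<^sub>R e))\<^sup>2 = (norm v)\<^sup>2 + 4 * c * (v \<bullet> e) + 4 * c * c" for v
    unfolding power2_norm_eq_inner
    by (simp add: inner_add_left inner_add_right inner_commute[of e v] ee distrib_left)
  then have "(norm (a - refl_hyp e t b))\<^sup>2 = (norm (a - b))\<^sup>2 + 4 * c * ((a - b) \<bullet> e) + 4 * c * c"
    unfolding d .
  also have "\<dots> = (norm (a - b))\<^sup>2 + 4 * (a \<bullet> e - t) * (b \<bullet> e - t)"
    unfolding c_def by (simp add: inner_diff_left algebra_simps)
  finally show ?thesis .
qed

lemma norm_refl_hyp_diff:
  assumes "norm e = 1"
  shows "norm (refl_hyp e t a - b) = norm (a - refl_hyp e t b)"
proof -
  have "(norm (refl_hyp e t a - b))\<^sup>2 = (norm (a - refl_hyp e t b))\<^sup>2"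
    unfolding norm_minus_commute[of "refl_hyp e t a"] norm_diff_refl_hyp_sq[OF assms]
    by (simp only: norm_minus_commute[of b a] mult_ac)
  then show ?thesis by simp
qed

lemma integral_pos_continuous:
  fixes f :: "'a::euclidean_space \<Rightarrow> real"
  assumes "integrable lborel f" "continuous_on UNIV f" "\<And>x. 0 \<le> f x" "0 < f x1"
  shows "0 < integral\<^sup>L lborel f"
proof (rule ccontr)
  assume "\<not> ?thesis"
  moreover have nn: "AE x in lborel. 0 \<le> f x" using assms(3) by simp
  ultimately have "integral\<^sup>L lborel f = 0" using integral_nonneg_AE[OF nn] by linarith
  then have "AE x in lborel. f x = 0" using integral_nonneg_eq_0_iff_AE[OF assms(1) nn] by simp
  then have "AE x in lborel. x \<in> UNIV \<longrightarrow> f x = 0" by simp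
  then have "f x1 = 0" by (rule AE_lborel_continuous_eq_0D) (use assms(2) in auto)
  then show False using assms(4) by simp
qed

section \<open>Kernel differences under a reflection\<close>

definition kdiff :: "real \<Rightarrow> real^'m \<Rightarrow> real \<Rightarrow> real^'m \<Rightarrow> (real^'m) \<times> real \<Rightarrow> real" where
  "kdiff l e t x y = norm ((x, 0) - refl_hyp (e, 0) t y) powr l - norm ((x, 0) - y) powr l"

locale hyperplane =
  fixes e :: "real^'m" and t :: real
  assumes e1: "norm e = 1"
begin

abbreviation "R \<equiv> refl_hyp e t"
abbreviation "R' \<equiv> refl_hyp (e, 0::real) t"

lemma e1': "norm (e, 0::real) = 1" using e1 by (simp add: norm_Pair)

lemma R_invol: "R (R x) = x" by (rule refl_hyp_involution[OF e1])
lemma R'_invol: "R' (R' y) = y" by (rule refl_hyp_involution[OF e1'])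
lemma R_side: "R x \<bullet> e - t = - (x \<bullet> e - t)" by (rule refl_hyp_side[OF e1])

lemma norm_R: "norm ((R x, 0) - y) = norm ((x, 0) - R' y)"
proof -
  have "(R x, 0) = R' (x, 0)" by (rule refl_hyp_Pair[symmetric])
  then show ?thesis by (simp only: norm_refl_hyp_diff[OF e1'])
qed

text \<open>Squaring and the power \<open>l\<close> are both increasing on nonnegative numbers, so
  the sign may be read off the difference of squared distances.\<close>

lemma kdiff_sgn:
  assumes "l > 0"
  shows "sgn (kdiff l e t x y) = sgn (x \<bullet> e - t) * sgn (fst y \<bullet> e - t)"
proof -
  define u v where "u = norm ((x, 0) - R' y)" and "v = norm ((x, 0) - y)"
  have n: "u \<ge> 0" "v \<ge> 0" unfolding u_def v_def by auto
  have "u\<^sup>2 - v\<^sup>2 = 4 * (x \<bullet> e - t) * (fst y \<bullet> e - t)"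
    unfolding u_def v_def norm_diff_refl_hyp_sq[OF e1'] by (simp add: inner_prod_def)
  then have 1: "sgn (u\<^sup>2 - v\<^sup>2) = sgn (x \<bullet> e - t) * sgn (fst y \<bullet> e - t)"
    by (simp only: sgn_mult) simp
  have 2: "sgn (u powr l - v powr l) = sgn (u\<^sup>2 - v\<^sup>2)"
  proof (cases u v rule: linorder_cases)
    case less
    have "u powr l < v powr l" using less n assms by (intro powr_less_mono2) auto
    moreover have "u\<^sup>2 < v\<^sup>2" using less n by (intro power_strict_mono) auto
    ultimately show ?thesis by simp
  next
    case greater
    have "v powr l < u powr l" using greater n assms by (intro powr_less_mono2) auto
    moreover have "v\<^sup>2 < u\<^sup>2" using greater n by (intro power_strict_mono) auto
    ultimately show ?thesis by simp
  qed simp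
  show ?thesis unfolding kdiff_def u_def[symmetric] v_def[symmetric] 2 1 ..
qed

lemma continuous_on_kdiff: "l > 0 \<Longrightarrow> continuous_on S (\<lambda>x. kdiff l e t x y)"
  unfolding kdiff_def by (intro continuous_intros continuous_on_powr') auto

context
  fixes l :: real and G :: "real^'m \<Rightarrow> real"
  assumes G: "dens l G"
begin

interpretation B: boundary_density l G by unfold_locales (rule G)

lemma bpot_R'_integrable:
  "integrable lborel (\<lambda>x. norm ((x, 0) - y) powr l * G (R x))"
  "(\<integral>x. norm ((x, 0) - y) powr l * G (R x) \<partial>lborel) = bpot l G (R' y)"
proof -
  let ?F = "\<lambda>x. norm ((x, 0) - R' y) powr l * G x"
  have m: "?F \<in> borel_measurable borel" by measurable
  have FR: "?F (R x) = norm ((x, 0) - y) powr l * G (R x)" for x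
    unfolding norm_R R'_invol ..
  show "integrable lborel (\<lambda>x. norm ((x, 0) - y) powr l * G (R x))"
    using integrable_refl_hyp[OF e1 m B.bpot_integrable, of t] unfolding FR .
  show "(\<integral>x. norm ((x, 0) - y) powr l * G (R x) \<partial>lborel) = bpot l G (R' y)"
    unfolding bpot_eq using integral_refl_hyp[OF e1 m, of t] unfolding FR .
qed

text \<open>The sum involves \<open>G\<close> only through \<open>G x + G (R x)\<close>, which
  polarization leaves alone.\<close>

lemma bpot_R'_sum: "bpot l G y + bpot l G (R' y) = (\<integral>x. norm ((x, 0) - y) powr l * (G x + G (R x)) \<partial>lborel)"
  unfolding bpot_R'_integrable(2)[symmetric] distrib_left
  by (subst Bochner_Integration.integral_add[OF B.bpot_integrable bpot_R'_integrable(1)]) (simp add: bpot_eq)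

text \<open>\<open>kdiff\<close> changes sign when \<open>x\<close> is reflected, so averaging the
  integral with its reflected form leaves only the antisymmetric part of \<open>G\<close>.\<close>

lemma bpot_R'_diff:
  "integrable lborel (\<lambda>x. kdiff l e t x y * (G x - G (R x)))"
  "bpot l G (R' y) - bpot l G y = (\<integral>x. kdiff l e t x y * (G x - G (R x)) \<partial>lborel) / 2"
proof -
  have e: "kdiff l e t x y * (G x - G (R x)) =
      (norm ((x, 0) - R' y) powr l * G x - norm ((x, 0) - y) powr l * G x)
      - (norm ((x, 0) - R' y) powr l * G (R x) - norm ((x, 0) - y) powr l * G (R x))" for x
    unfolding kdiff_def by (simp add: algebra_simps)
  show "integrable lborel (\<lambda>x. kdiff l e t x y * (G x - G (R x)))"
    unfolding e by (intro Bochner_Integration.integrable_diff B.bpot_integrable bpot_R'_integrable)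
  show "bpot l G (R' y) - bpot l G y = (\<integral>x. kdiff l e t x y * (G x - G (R x)) \<partial>lborel) / 2"
    unfolding e
    by (simp add: B.bpot_integrable bpot_R'_integrable bpot_eq[symmetric] R'_invol)
qed

end

context
  fixes l b hi :: real and w :: "(real^'m) \<times> real \<Rightarrow> real"
  assumes W: "half_space_weight l b hi w"
begin

interpretation W: half_space_weight l b hi w by (rule W)

lemma hpot_R_diff:
  "integrable hs (\<lambda>y. kdiff l e t x y * (w y - w (R' y)))"
  "hpot l w (R x) - hpot l w x = (\<integral>y. kdiff l e t x y * (w y - w (R' y)) \<partial>hs) / 2"
proof -
  have Ri: "integrable hs (\<lambda>y. norm ((z, 0) - y) powr l * w (R' y))"
    and Re: "(\<integral>y. norm ((z, 0) - y) powr l * w (R' y) \<partial>hs) = hpot l w (R z)" for z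
  proof -
    let ?F = "\<lambda>y. norm (y - (R z, 0)) powr l * w y"
    have m: "?F \<in> borel_measurable borel" by measurable
    have FR: "?F (R' y) = norm ((z, 0) - y) powr l * w (R' y)" for y
      unfolding norm_minus_commute[of "R' y"] norm_R R'_invol ..
    show "integrable hs (\<lambda>y. norm ((z, 0) - y) powr l * w (R' y))"
      using hs_integrable_refl_hyp[OF e1 m W.hpot_integrable, of t] unfolding FR .
    show "(\<integral>y. norm ((z, 0) - y) powr l * w (R' y) \<partial>hs) = hpot l w (R z)"
      unfolding hpot_eq using hs_integral_refl_hyp[OF e1 m, of t] unfolding FR .
  qed
  have Ii: "integrable hs (\<lambda>y. norm ((z, 0) - y) powr l * w y)"
    and Ie: "(\<integral>y. norm ((z, 0) - y) powr l * w y \<partial>hs) = hpot l w z" for z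
    using W.hpot_integrable[of z] unfolding hpot_eq norm_minus_commute[of _ "(z, 0)"] by auto
  have e: "kdiff l e t x y * (w y - w (R' y)) =
      (norm ((R x, 0) - y) powr l * w y - norm ((x, 0) - y) powr l * w y)
      - (norm ((R x, 0) - y) powr l * w (R' y) - norm ((x, 0) - y) powr l * w (R' y))" for y
    unfolding kdiff_def norm_R by (simp add: algebra_simps)
  show "integrable hs (\<lambda>y. kdiff l e t x y * (w y - w (R' y)))"
    unfolding e by (intro Bochner_Integration.integrable_diff Ri Ii)
  show "hpot l w (R x) - hpot l w x = (\<integral>y. kdiff l e t x y * (w y - w (R' y)) \<partial>hs) / 2"
    unfolding e by (simp add: Ri Ii Re Ie R_invol)
qed

end

text \<open>The larger of \<open>F x\<close> and \<open>F (R x)\<close> where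
  \<open>x \<bullet> e > t\<close>, the smaller where \<open>x \<bullet> e < t\<close>, and
  \<open>F x\<close> on the hyperplane. The form with \<open>sgn\<close> displays the symmetric and
  antisymmetric parts, the only quantities that enter the potentials.\<close>

definition "polar F x = (F x + F (R x)) / 2 + sgn (x \<bullet> e - t) * \<bar>F x - F (R x)\<bar> / 2"

lemma polar_cases:
  "(polar F x = F x \<and> polar F (R x) = F (R x)) \<or> (polar F x = F (R x) \<and> polar F (R x) = F x)"
proof -
  have 1: "polar F (R x) = (F x + F (R x)) / 2 - sgn (x \<bullet> e - t) * \<bar>F x - F (R x)\<bar> / 2"
    unfolding polar_def R_side R_invol sgn_minus by (simp add: abs_minus_commute add.commute)
  have 0: "polar F x = (F x + F (R x)) / 2 + sgn (x \<bullet> e - t) * \<bar>F x - F (R x)\<bar> / 2"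
    by (rule polar_def)
  consider "x \<bullet> e - t > 0" | "x \<bullet> e - t < 0" | "x \<bullet> e - t = 0" by linarith
  then show ?thesis
  proof cases
    case 3
    then have "R x = x" by (intro refl_hyp_fixed) simp
    then show ?thesis unfolding polar_def by simp
  qed (auto simp: 0 1 abs_if field_simps)
qed

lemma polar_sum: "polar F x + polar F (R x) = F x + F (R x)"
  using polar_cases[of F x] by auto

lemma polar_diff: "polar F x - polar F (R x) = sgn (x \<bullet> e - t) * \<bar>F x - F (R x)\<bar>"
  unfolding polar_def R_side R_invol sgn_minus by (simp add: abs_minus_commute add.commute)

end

lemma integral_refl_double:
  fixes F :: "real^'m \<Rightarrow> real"
  assumes "hyperplane e" "integrable lborel F" "F \<in> borel_measurable borel"
  shows "integral\<^sup>L lborel F = (\<integral>x. F x + F (refl_hyp e t x) \<partial>lborel) / 2"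
proof -
  interpret hyperplane e t by (rule assms)
  show ?thesis
    using assms(2,3) integrable_refl_hyp[OF e1 assms(3,2), of t] integral_refl_hyp[OF e1 assms(3), of t] by simp
qed

text \<open>Polarization only permutes the values at \<open>x\<close> and \<open>R x\<close>, so
  symmetrised integrals are unchanged; reflection alters the weight by a bounded factor.\<close>

lemma (in hls) unit_dens_polar:
  fixes F :: "real^'m \<Rightarrow> real"
  assumes F: "unit_dens F" and "hyperplane e"
  shows "unit_dens (hyperplane.polar e t F)"
proof -
  interpret hyperplane e t by (rule assms(2))
  have d: "dens l F" using F unfolding unit_dens_def by simp
  interpret B: boundary_density l F by unfold_locales (rule d)
  have [measurable]: "polar F \<in> borel_measurable borel"
    unfolding polar_def[abs_def] by measurable
  have nn: "0 \<le> polar F x" for x using polar_cases[of F x] B.f_nonneg by metis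
  have le: "polar F x \<le> F x + F (R x)" for x
    using polar_cases[of F x] B.f_nonneg[of x] B.f_nonneg[of "R x"] by auto
  have le_p: "polar F x powr p \<le> F x powr p + F (R x) powr p" for x
    using polar_cases[of F x] by auto
  have wR: "wgt l (R x) \<le> (1 + 2 * \<bar>t\<bar>) powr l * wgt l x" for x
  proof -
    have "R x = (2 * t) *\<^sub>R e + refl_hyp e 0 x" unfolding refl_hyp_def by (simp add: algebra_simps)
    moreover have "norm (refl_hyp e 0 x) = norm x"
      using norm_diff_refl_hyp_sq[OF e1, of 0 0 x] by simp
    ultimately have "norm (R x) \<le> 2 * \<bar>t\<bar> + norm x"
      using norm_triangle_ineq[of "(2 * t) *\<^sub>R e" "refl_hyp e 0 x"] e1 by simp
    moreover have "0 \<le> 2 * \<bar>t\<bar> * norm x" by simp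
    moreover have "(1 + 2 * \<bar>t\<bar>) * (1 + norm x) = 1 + 2 * \<bar>t\<bar> + norm x + 2 * \<bar>t\<bar> * norm x"
      by (simp add: algebra_simps)
    ultimately have "1 + norm (R x) \<le> (1 + 2 * \<bar>t\<bar>) * (1 + norm x)" by linarith
    then have "wgt l (R x) \<le> ((1 + 2 * \<bar>t\<bar>) * (1 + norm x)) powr l"
      unfolding wgt_def using l0 by (intro powr_mono2) auto
    then show ?thesis unfolding wgt_def by (simp add: powr_mult)
  qed
  have i1: "integrable lborel (\<lambda>x. wgt l (R x) * F (R x))"
    using integrable_refl_hyp[OF e1, of "\<lambda>x. wgt l x * F x" t] B.f_int by simp
  have i2: "integrable lborel (\<lambda>x. wgt l x * polar F x)"
  proof (rule integrable_real_boundI)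
    show "integrable lborel (\<lambda>x. wgt l x * F x + (1 + 2 * \<bar>t\<bar>) powr l * (wgt l (R x) * F (R x)))"
      by (intro Bochner_Integration.integrable_add integrable_mult_right B.f_int i1)
    show "\<bar>wgt l x * polar F x\<bar> \<le> wgt l x * F x + (1 + 2 * \<bar>t\<bar>) powr l * (wgt l (R x) * F (R x))" for x
    proof -
      have "wgt l x * polar F x \<le> wgt l x * (F x + F (R x))"
        by (intro mult_left_mono le) simp
      also have "\<dots> = wgt l x * F x + wgt l x * F (R x)" by (rule distrib_left)
      also have "wgt l x * F (R x) \<le> ((1 + 2 * \<bar>t\<bar>) powr l * wgt l (R x)) * F (R x)"
        using wR[of "R x"] unfolding R_invol by (intro mult_right_mono B.f_nonneg)
      finally show ?thesis using nn[of x] by (simp add: mult.assoc)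
    qed
  qed measurable
  interpret P: potential l lborel "\<lambda>x. (x::real^'m)" "polar F"
    using l0 i2 by unfold_locales (auto simp: measurable_lborel1)
  have "integral\<^sup>L lborel (polar F) = integral\<^sup>L lborel F"
    unfolding integral_refl_double[OF assms(2) P.w_integrable \<open>polar F \<in> _\<close>, of t]
      integral_refl_double[OF assms(2) B.mass_integrable B.f_borel, of t] polar_sum ..
  then have D: "dens l (polar F)"
    unfolding dens_def using l0 nn i2 B.mass_pos by simp
  have Fp: "integrable lborel (\<lambda>x. F x powr p)" "(\<integral>x. F x powr p \<partial>lborel) = 1"
    using F unfolding unit_dens_def by auto
  have pm: "(\<lambda>x. F x powr p) \<in> borel_measurable borel" "(\<lambda>x. polar F x powr p) \<in> borel_measurable borel"
    by measurable
  have i3: "integrable lborel (\<lambda>x. polar F x powr p)"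
  proof (rule integrable_real_boundI)
    show "integrable lborel (\<lambda>x. F x powr p + F (R x) powr p)"
      using Fp(1) integrable_refl_hyp[OF e1 pm(1) Fp(1)] by (rule Bochner_Integration.integrable_add)
    show "\<bar>polar F x powr p\<bar> \<le> F x powr p + F (R x) powr p" for x using le_p[of x] by simp
  qed measurable
  have "polar F x powr p + polar F (R x) powr p = F x powr p + F (R x) powr p" for x
    using polar_cases[of F x] by auto
  then have "(\<integral>x. polar F x powr p \<partial>lborel) = (\<integral>x. F x powr p \<partial>lborel)"
    unfolding integral_refl_double[OF assms(2) i3 pm(2), of t]
      integral_refl_double[OF assms(2) Fp(1) pm(1), of t] by simp
  then show ?thesis unfolding unit_dens_def using D i3 Fp(2) by simp
qed

text \<open>For \<open>y\<close> and \<open>R' y\<close>, polarization keeps the sum of the two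
  potentials and replaces the modulus of the integral of \<open>kdiff * D\<close> by the integral of
  its modulus. By \<open>two_point\<close> the summed powers can only grow, and maximality forces
  equality for a.e. \<open>y\<close>.\<close>

lemma (in hls) reflection_dichotomy:
  fixes F :: "real^'m \<Rightarrow> real"
  assumes F: "unit_dens F" and cont: "continuous_on UNIV F"
    and max: "\<And>G. unit_dens G \<Longrightarrow> energy l s G \<le> energy l s F" and hyp: "hyperplane e"
  shows "(\<forall>x. x \<bullet> e > t \<longrightarrow> F (refl_hyp e t x) \<le> F x) \<or> (\<forall>x. x \<bullet> e > t \<longrightarrow> F x \<le> F (refl_hyp e t x))"
proof -
  interpret hyperplane e t by (rule hyp)
  let ?P = "polar F"
  have P: "unit_dens ?P" by (rule unit_dens_polar[OF F hyp])
  have dF: "dens l F" and dP: "dens l ?P" using F P unfolding unit_dens_def by auto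
  interpret B: boundary_density l F by unfold_locales (rule dF)
  interpret C: boundary_density l ?P by unfold_locales (rule dP)
  define D where "D x = F x - F (R x)" for x
  have sum: "bpot l ?P y + bpot l ?P (R' y) = bpot l F y + bpot l F (R' y)" for y
    unfolding bpot_R'_sum[OF dF] bpot_R'_sum[OF dP] polar_sum ..
  have dfF: "bpot l F (R' y) - bpot l F y = (\<integral>x. kdiff l e t x y * D x \<partial>lborel) / 2"
    and iF: "integrable lborel (\<lambda>x. kdiff l e t x y * D x)" for y
    unfolding D_def using bpot_R'_diff[OF dF] by auto
  have kk: "kdiff l e t x y * (sgn (x \<bullet> e - t) * d) = sgn (fst y \<bullet> e - t) * (\<bar>kdiff l e t x y\<bar> * d)" for x y d
  proof -
    have "kdiff l e t x y = sgn (x \<bullet> e - t) * sgn (fst y \<bullet> e - t) * \<bar>kdiff l e t x y\<bar>"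
      using kdiff_sgn[OF l0, of x y] by (metis sgn_mult_abs)
    then show ?thesis
      using kdiff_sgn[OF l0, of x y] by (cases "x \<bullet> e - t = 0") (auto simp: sgn_if split: if_splits)
  qed
  have dfP: "bpot l ?P (R' y) - bpot l ?P y = sgn (fst y \<bullet> e - t) * (\<integral>x. \<bar>kdiff l e t x y * D x\<bar> \<partial>lborel) / 2" for y
    unfolding bpot_R'_diff(2)[OF dP] polar_diff kk D_def abs_mult by simp
  have ptw: "bpot l F y powr (-s) + bpot l F (R' y) powr (-s) \<le> bpot l ?P y powr (-s) + bpot l ?P (R' y) powr (-s)"
    and ptweq: "bpot l F y powr (-s) + bpot l F (R' y) powr (-s) = bpot l ?P y powr (-s) + bpot l ?P (R' y) powr (-s) \<Longrightarrow>
        \<bar>\<integral>x. kdiff l e t x y * D x \<partial>lborel\<bar> = (\<integral>x. \<bar>kdiff l e t x y * D x\<bar> \<partial>lborel)"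
    if y: "fst y \<bullet> e - t \<noteq> 0" for y
  proof -
    have aP: "\<bar>bpot l ?P y - bpot l ?P (R' y)\<bar> = (\<integral>x. \<bar>kdiff l e t x y * D x\<bar> \<partial>lborel) / 2"
    proof -
      have "\<bar>bpot l ?P y - bpot l ?P (R' y)\<bar> = \<bar>bpot l ?P (R' y) - bpot l ?P y\<bar>" by (rule abs_minus_commute)
      also have "\<dots> = \<bar>\<integral>x. \<bar>kdiff l e t x y * D x\<bar> \<partial>lborel\<bar> / 2"
        unfolding dfP using y by (simp add: abs_mult abs_sgn_eq)
      also have "\<bar>\<integral>x. \<bar>kdiff l e t x y * D x\<bar> \<partial>lborel\<bar> = (\<integral>x. \<bar>kdiff l e t x y * D x\<bar> \<partial>lborel)"
        by (intro abs_of_nonneg integral_nonneg_AE AE_I2) simp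
      finally show ?thesis .
    qed
    have aF: "\<bar>bpot l F y - bpot l F (R' y)\<bar> = \<bar>\<integral>x. kdiff l e t x y * D x \<partial>lborel\<bar> / 2"
      unfolding abs_minus_commute[of "bpot l F y"] dfF by simp
    have "\<bar>bpot l F y - bpot l F (R' y)\<bar> \<le> \<bar>bpot l ?P y - bpot l ?P (R' y)\<bar>"
      unfolding aP aF using integral_abs_bound[of lborel "\<lambda>x. kdiff l e t x y * D x"] by simp
    note tp = two_point[OF C.bpot_pos C.bpot_pos B.bpot_pos B.bpot_pos sum this s0]
    show "bpot l F y powr (-s) + bpot l F (R' y) powr (-s) \<le> bpot l ?P y powr (-s) + bpot l ?P (R' y) powr (-s)"
      by (rule tp)
    show "\<bar>\<integral>x. kdiff l e t x y * D x \<partial>lborel\<bar> = (\<integral>x. \<bar>kdiff l e t x y * D x\<bar> \<partial>lborel)"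
      if "bpot l F y powr (-s) + bpot l F (R' y) powr (-s) = bpot l ?P y powr (-s) + bpot l ?P (R' y) powr (-s)"
      using tp(2)[OF that] unfolding aP aF by simp
  qed
  define H where "H y = bpot l ?P y powr (-s) + bpot l ?P (R' y) powr (-s) - (bpot l F y powr (-s) + bpot l F (R' y) powr (-s))" for y
  have mF: "(\<lambda>y. bpot l F y powr (-s)) \<in> borel_measurable borel" "(\<lambda>y. bpot l ?P y powr (-s)) \<in> borel_measurable borel"
    by measurable
  note eF = energy_integrable[OF dF] and eP = energy_integrable[OF dP]
  note rF = hs_integrable_refl_hyp[OF e1 mF(1) eF, of t] hs_integral_refl_hyp[OF e1 mF(1), of t]
  note rP = hs_integrable_refl_hyp[OF e1 mF(2) eP, of t] hs_integral_refl_hyp[OF e1 mF(2), of t]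
  have iH: "integrable hs H" unfolding H_def
    by (intro Bochner_Integration.integrable_add Bochner_Integration.integrable_diff eF eP rF(1) rP(1))
  have "integral\<^sup>L hs H = 2 * (energy l s ?P - energy l s F)"
    unfolding H_def energy_def using eF eP rF rP by simp
  then have H0: "integral\<^sup>L hs H \<le> 0" using max[OF P] by simp
  have Hnn: "0 \<le> H y" for y
  proof (cases "fst y \<bullet> e - t = 0")
    case True
    then have "R' y = y" by (intro refl_hyp_fixed) (simp add: inner_prod_def)
    then show ?thesis using sum[of y] unfolding H_def by simp
  qed (use ptw[of y] in \<open>simp add: H_def\<close>)
  have "integral\<^sup>L hs H = 0" using H0 Hnn by (intro antisym integral_nonneg_AE AE_I2)
  then have "AE y in hs. H y = 0" using integral_nonneg_eq_0_iff_AE[OF iH] Hnn by simp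
  then have AEH: "AE y in lborel. y \<in> half_space \<longrightarrow> H y = 0" unfolding AE_hs_iff .
  define Q where "Q = {y \<in> half_space. t < fst y \<bullet> e}"
  \<comment> \<open>A single \<open>y\<close> strictly on one side is enough: for it
    \<open>kdiff\<close> has the sign of \<open>x \<bullet> e - t\<close> for every
    \<open>x\<close>, so it determines the sign of \<open>D\<close> on each side.\<close>
  have "\<exists>y\<in>Q. H y = 0"
  proof (rule ccontr)
    assume "\<not> ?thesis"
    then have "AE y in lborel. y \<notin> Q" using AEH unfolding Q_def by (auto elim: eventually_mono)
    moreover have "open Q"
    proof -
      have "Q = half_space \<inter> {y. t < fst y \<bullet> e}" unfolding Q_def by auto
      then show ?thesis by (auto intro!: open_Int open_half_space open_Collect_less continuous_intros)
    qed
    ultimately have "Q = {}" by (rule AE_lborel_notin_openD)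
    moreover have "((t + 1) *\<^sub>R e, 1) \<in> Q"
      unfolding Q_def half_space_def using e1 by (simp add: norm_eq_1)
    ultimately show False by blast
  qed
  then obtain y where y: "t < fst y \<bullet> e" "H y = 0" unfolding Q_def by auto
  define k where "k x = kdiff l e t x y" for x
  have sk: "sgn (k x) = sgn (x \<bullet> e - t)" for x
    unfolding k_def kdiff_sgn[OF l0] using y(1) by simp
  have kDi: "integrable lborel (\<lambda>x. k x * D x)" unfolding k_def by (rule iF)
  have eq: "\<bar>\<integral>x. k x * D x \<partial>lborel\<bar> = (\<integral>x. \<bar>k x * D x\<bar> \<partial>lborel)"
    unfolding k_def by (rule ptweq) (use y in \<open>auto simp: H_def\<close>)
  have cD: "continuous_on UNIV (\<lambda>x. k x * D x)"
  proof -
    have "continuous_on UNIV (\<lambda>x. F (R x))"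
      by (rule continuous_on_compose2[OF cont]) (auto simp: refl_hyp_def intro!: continuous_intros)
    then show ?thesis unfolding k_def D_def
      by (intro continuous_intros continuous_on_kdiff[OF l0] cont)
  qed
  \<comment> \<open>Equality in the triangle inequality for integrals, with a continuous integrand,
    leaves room for one sign only.\<close>
  have sgl: "(\<forall>x. k x * D x \<ge> 0) \<or> (\<forall>x. k x * D x \<le> 0)"
  proof (rule ccontr)
    assume "\<not> ?thesis"
    then obtain x1 x2 where x12: "k x1 * D x1 < 0" "k x2 * D x2 > 0" by (meson not_le)
    have "0 < (\<integral>x. \<bar>k x * D x\<bar> - k x * D x \<partial>lborel)"
    proof (rule integral_pos_continuous[where ?x1.0 = x1])
      show "0 < \<bar>k x1 * D x1\<bar> - k x1 * D x1" using x12(1) by linarith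
      show "0 \<le> \<bar>k x * D x\<bar> - k x * D x" for x by linarith
    qed (intro Bochner_Integration.integrable_diff integrable_abs kDi continuous_intros cD)+
    moreover have "0 < (\<integral>x. \<bar>k x * D x\<bar> + k x * D x \<partial>lborel)"
    proof (rule integral_pos_continuous[where ?x1.0 = x2])
      show "0 < \<bar>k x2 * D x2\<bar> + k x2 * D x2" using x12(2) by linarith
      show "0 \<le> \<bar>k x * D x\<bar> + k x * D x" for x by linarith
    qed (intro Bochner_Integration.integrable_add integrable_abs kDi continuous_intros cD)+
    moreover have "(\<integral>x. \<bar>k x * D x\<bar> - k x * D x \<partial>lborel) = (\<integral>x. \<bar>k x * D x\<bar> \<partial>lborel) - (\<integral>x. k x * D x \<partial>lborel)"
      "(\<integral>x. \<bar>k x * D x\<bar> + k x * D x \<partial>lborel) = (\<integral>x. \<bar>k x * D x\<bar> \<partial>lborel) + (\<integral>x. k x * D x \<partial>lborel)"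
      using kDi by simp_all
    ultimately show False using eq by linarith
  qed
  have kpos: "k x > 0" if "x \<bullet> e > t" for x
    using sk[of x] that by (simp add: sgn_if split: if_splits)
  show ?thesis
    using sgl
  proof
    assume a: "\<forall>x. k x * D x \<ge> 0"
    have "F (R x) \<le> F x" if "x \<bullet> e > t" for x
      using a[rule_format, of x] kpos[OF that] by (simp add: zero_le_mult_iff D_def)
    then show ?thesis by blast
  next
    assume a: "\<forall>x. k x * D x \<le> 0"
    have "F x \<le> F (R x)" if "x \<bullet> e > t" for x
      using a[rule_format, of x] kpos[OF that] by (simp add: mult_le_0_iff D_def)
    then show ?thesis by blast
  qed
qed

text \<open>One strict inequality spreads through the equation for \<open>F\<close>: near
  \<open>x1\<close> it makes the potential smaller at every \<open>y\<close> on the positive side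
  than at \<open>R' y\<close>, so \<open>w\<close> is larger there, so \<open>hpot l w\<close> is
  smaller at every such \<open>x\<close> than at \<open>R x\<close>, and the negative exponent
  reverses this for \<open>F\<close>.\<close>

lemma (in hls) reflection_strict:
  fixes F :: "real^'m \<Rightarrow> real"
  assumes dF: "dens l F" and cont: "continuous_on UNIV F" and hyp: "hyperplane e"
    and W: "half_space_weight l b hi w" and w: "\<And>y. w y = bpot l F y powr (-s - 1)"
    and hpos: "\<And>x. hpot l w x > 0"
    and Feq: "\<And>x. F x = c * hpot l w x powr (- 1 / (1 - p))" and c: "c > 0"
    and ge: "\<And>x. x \<bullet> e > t \<Longrightarrow> F (refl_hyp e t x) \<le> F x"
    and ne: "F x1 \<noteq> F (refl_hyp e t x1)" and x: "x \<bullet> e > t"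
  shows "F (refl_hyp e t x) < F x"
proof -
  interpret hyperplane e t by (rule hyp)
  interpret B: boundary_density l F by unfold_locales (rule dF)
  define D where "D x = F x - F (R x)" for x
  have Dsgn: "sgn (z \<bullet> e - t) * D z \<ge> 0" for z
  proof -
    consider "z \<bullet> e > t" | "z \<bullet> e < t" | "z \<bullet> e - t = 0" by linarith
    then show ?thesis
    proof cases
      case 2
      then have "R z \<bullet> e > t" using R_side[of z] by simp
      then show ?thesis using ge[of "R z"] 2 unfolding R_invol D_def by simp
    qed (use ge[of z] in \<open>auto simp: D_def\<close>)
  qed
  have D1: "D x1 \<noteq> 0" unfolding D_def using ne by simp
  have x1s: "x1 \<bullet> e - t \<noteq> 0"
    using ne refl_hyp_fixed[of x1 e t] by auto
  have cR: "continuous_on UNIV (\<lambda>x. F (R x))"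
    by (rule continuous_on_compose2[OF cont]) (auto simp: refl_hyp_def intro!: continuous_intros)
  have lt: "bpot l F y < bpot l F (R' y)" if y: "fst y \<bullet> e > t" for y
  proof -
    have sk: "sgn (kdiff l e t z y) = sgn (z \<bullet> e - t)" for z
      unfolding kdiff_sgn[OF l0] using y by simp
    have kD: "kdiff l e t z y * D z = \<bar>kdiff l e t z y\<bar> * (sgn (z \<bullet> e - t) * D z)" for z
      unfolding sk[symmetric] by (metis mult.assoc mult.commute sgn_mult_abs)
    have "0 < (\<integral>z. kdiff l e t z y * D z \<partial>lborel)"
    proof (rule integral_pos_continuous[where ?x1.0 = x1])
      show "integrable lborel (\<lambda>z. kdiff l e t z y * D z)"
        unfolding D_def by (rule bpot_R'_diff(1)[OF dF])
      show "continuous_on UNIV (\<lambda>z. kdiff l e t z y * D z)"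
        unfolding D_def by (intro continuous_intros continuous_on_kdiff[OF l0] cont cR)
      show "0 \<le> kdiff l e t z y * D z" for z unfolding kD using Dsgn by simp
      moreover have "kdiff l e t x1 y \<noteq> 0" using sk[of x1] x1s by (metis sgn_eq_0_iff)
      ultimately show "0 < kdiff l e t x1 y * D x1"
        using D1 by (metis mult_eq_0_iff order_le_less)
    qed
    then show ?thesis using bpot_R'_diff(2)[OF dF, of y] unfolding D_def by simp
  qed
  have wlt: "w (R' y) < w y" if "fst y \<bullet> e > t" for y
    unfolding w using lt[OF that] B.bpot_pos[of y] s0 by (intro powr_less_mono2_neg) auto
  have fR: "fst (R' y) = R (fst y)" for y by (metis refl_hyp_Pair fst_conv prod.collapse)
  have pos: "0 < kdiff l e t x y * (w y - w (R' y))" if ny: "fst y \<bullet> e - t \<noteq> 0" for y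
  proof (cases "fst y \<bullet> e > t")
    case True
    have "sgn (kdiff l e t x y) = 1" unfolding kdiff_sgn[OF l0] using True x by simp
    then show ?thesis using wlt[OF True] by (simp add: sgn_if split: if_splits)
  next
    case False
    then have lt0: "fst y \<bullet> e < t" using ny by simp
    then have "fst (R' y) \<bullet> e > t" unfolding fR using R_side[of "fst y"] by simp
    then have "w y < w (R' y)" using wlt[of "R' y"] unfolding R'_invol by simp
    moreover have "sgn (kdiff l e t x y) = - 1" unfolding kdiff_sgn[OF l0] using lt0 x by simp
    ultimately show ?thesis by (simp add: sgn_if mult_neg_neg split: if_splits)
  qed
  have "0 < (\<integral>y. kdiff l e t x y * (w y - w (R' y)) \<partial>hs)"
  proof (rule hs_integral_pos[OF hpot_R_diff(1)[OF W]])
    let ?Q = "half_space \<inter> {y. t < fst y \<bullet> e}"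
    show "open ?Q" by (auto intro!: open_Int open_half_space open_Collect_less continuous_intros)
    have "((t + 1) *\<^sub>R e, 1) \<in> ?Q"
      unfolding half_space_def using e1 by (simp add: norm_eq_1)
    then show "?Q \<noteq> {}" by blast
    show "0 < kdiff l e t x y * (w y - w (R' y))" if "y \<in> ?Q" for y
      using that by (intro pos) auto
    show "0 \<le> kdiff l e t x y * (w y - w (R' y))" for y
    proof (cases "fst y \<bullet> e - t = 0")
      case True
      then have "R' y = y" by (intro refl_hyp_fixed) (simp add: inner_prod_def)
      then show ?thesis by simp
    qed (use pos[of y] in simp)
  qed auto
  then have "hpot l w x < hpot l w (R x)" using hpot_R_diff(2)[OF W, of x] by simp
  then have "hpot l w (R x) powr (- 1 / (1 - p)) < hpot l w x powr (- 1 / (1 - p))"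
    using hpos[of x] p1 by (intro powr_less_mono2_neg) auto
  then show ?thesis unfolding Feq using c by simp
qed

subsection \<open>Maximizers of the energy\<close>

context hls
begin

lemma ex_unit_dens: "\<exists>f. unit_dens f"
proof -
  interpret H: hls_weight l p s tm "wgt l" 1
    by unfold_locales auto
  show ?thesis
    using H.dens_hmap H.hmap_powr_integrable H.hmap_powr_integral unfolding unit_dens_def by blast
qed

lemma energy_pos:
  fixes f :: "real^'m \<Rightarrow> real"
  assumes "dens l f" shows "energy l s f > 0"
proof -
  interpret F: boundary_density l f by unfold_locales (rule assms)
  show ?thesis
    unfolding energy_def
    by (rule hs_integral_pos[OF energy_integrable[OF assms], of "ball (0, 4) 1"])
       (use F.bpot_pos half_space_ball in \<open>auto simp: less_imp_neq[symmetric]\<close>)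
qed

lemma energy_limit:
  fixes F :: "nat \<Rightarrow> real^'m \<Rightarrow> real"
  assumes F: "\<And>n. unit_dens (F n)"
  obtains g k E where "unit_dens g" "strict_mono (k :: nat \<Rightarrow> nat)" "\<And>n. energy l s (F (k n)) \<le> E n"
    "E \<longlonglongrightarrow> energy l s g"
proof -
  have "\<forall>n. \<exists>f'. unit_dens f' \<and> centred f' \<and> energy l s f' = energy l s (F n)"
    using ex_centred[OF F] by blast
  then obtain F' where F': "\<And>n. unit_dens (F' n)" "\<And>n. centred (F' n)" "\<And>n. energy l s (F' n) = energy l s (F n)"
    by metis
  show ?thesis
    by (rule existence_limit[OF F'(1,2)]) (rule that, auto simp: F'(3))
qed

text \<open>Applied to energies exceeding every integer, the limit lemma contradicts convergence of
  \<open>E\<close>; applied to energies approaching the supremum, it produces a density that attains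
  it.\<close>

lemma ex_maximizer: "\<exists>g. unit_dens g \<and> (\<forall>f. unit_dens f \<longrightarrow> energy l s f \<le> energy l s g)"
proof -
  define A where "A = energy l s ` {f :: real^'m \<Rightarrow> real. unit_dens f}"
  have ne: "A \<noteq> {}" unfolding A_def using ex_unit_dens by blast
  have bdd: "bdd_above A"
  proof (rule ccontr)
    assume "\<not> bdd_above A"
    then have "\<forall>n::nat. \<exists>f. unit_dens f \<and> real n < energy l s f"
      unfolding A_def bdd_above_def by (simp add: not_le)
    then obtain F where F: "\<And>n. unit_dens (F n)" "\<And>n. real n < energy l s (F n)" by metis
    obtain g k E where "unit_dens g" and g: "strict_mono (k :: nat \<Rightarrow> nat)" "\<And>n. energy l s (F (k n)) \<le> E n" "E \<longlonglongrightarrow> energy l s g"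
      by (rule energy_limit[OF F(1)]) (rule that)
    have "real n \<le> E n" for n
      using g(2)[of n] F(2)[of "k n"] seq_suble[OF g(1), of n] by linarith
    then have "filterlim E at_top sequentially"
      by (intro filterlim_at_top_mono[OF filterlim_real_sequentially]) auto
    then show False using g(3) not_tendsto_and_filterlim_at_infinity[OF sequentially_bot g(3)]
        filterlim_at_top_imp_at_infinity by blast
  qed
  have "\<exists>f. unit_dens f \<and> Sup A - 1 / real (Suc n) < energy l s f" for n
  proof -
    have "Sup A - 1 / real (Suc n) < Sup A" by simp
    then show ?thesis using less_cSupD[OF ne] unfolding A_def by fastforce
  qed
  then obtain F where F: "\<And>n. unit_dens (F n)" "\<And>n. Sup A - 1 / real (Suc n) < energy l s (F n)" by metis
  obtain g k E where g: "unit_dens g" "strict_mono (k :: nat \<Rightarrow> nat)" "\<And>n. energy l s (F (k n)) \<le> E n" "E \<longlonglongrightarrow> energy l s g"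
    by (rule energy_limit[OF F(1)]) (rule that)
  have "Sup A - 1 / real (Suc n) \<le> E n" for n
  proof -
    have "1 / real (Suc (k n)) \<le> 1 / real (Suc n)"
      using seq_suble[OF g(2), of n] by (intro divide_left_mono) auto
    then show ?thesis using g(3)[of n] F(2)[of "k n"] by linarith
  qed
  moreover have "(\<lambda>n. Sup A - 1 / real (Suc n)) \<longlonglongrightarrow> Sup A - 0"
    by (intro tendsto_intros LIMSEQ_Suc[OF lim_1_over_n])
  ultimately have "Sup A \<le> energy l s g"
    using LIMSEQ_le[OF _ g(4)] by fastforce
  moreover have "energy l s f \<le> Sup A" if "unit_dens f" for f
    using that bdd unfolding A_def by (intro cSup_upper) auto
  ultimately show ?thesis using g(1) by force
qed

lemma maximizer_radial:
  fixes f :: "real^'m \<Rightarrow> real"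
  assumes f: "unit_dens f" and max: "\<And>G. unit_dens G \<Longrightarrow> energy l s G \<le> energy l s f"
  shows "\<exists>h x0. (\<forall>t. 0 \<le> h t) \<and> strict_antimono_on {0..} h \<and> (AE x in lborel. f x = h (norm (x + x0)))"
proof -
  interpret D: hls_density l p s tm f 1
    using f unfolding unit_dens_def by unfold_locales auto
  \<comment> \<open>The continuous representative of \<open>f\<close>. Equality a.e. gives equal
    potentials everywhere, so the weight built from \<open>f\<close> is also the one built from
    \<open>F\<close>, and the fixed-point equation for \<open>F\<close> holds at every
    point.\<close>
  define F where "F = hmap p D.phi"
  have F: "unit_dens F"
    unfolding F_def unit_dens_def using D.H.dens_hmap D.H.hmap_powr_integrable D.H.hmap_powr_integral by blast
  have dF: "dens l F" using F unfolding unit_dens_def by simp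
  interpret B: boundary_density l F by unfold_locales (rule dF)
  have ae: "AE x in lborel. f x = F x"
    unfolding F_def by (rule D.energy_improve_eq) (rule max[OF F[unfolded F_def]])
  have bp: "bpot l f z = bpot l F z" for z
    unfolding bpot_eq
  proof (rule integral_cong_AE)
    show "(\<lambda>x. norm ((x, 0) - z) powr l * f x) \<in> borel_measurable lborel"
      "(\<lambda>x. norm ((x, 0) - z) powr l * F x) \<in> borel_measurable lborel"
      using D.F.bpot_integrable[of z] B.bpot_integrable[of z] by (blast dest: borel_measurable_integrable)+
    show "AE x in lborel. norm ((x, 0) - z) powr l * f x = norm ((x, 0) - z) powr l * F x"
      using ae by eventually_elim simp
  qed
  have maxF: "energy l s G \<le> energy l s F" if "unit_dens G" for G
    using max[OF that] unfolding energy_def bp .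
  have w: "D.wfn y = bpot l F y powr (- s - 1)" for y
    unfolding D.wfn_def bp by simp
  have hpos: "hpot l D.wfn x > 0" for x
    using D.H.phi_pos[of x] unfolding D.phi_def .
  have Feq: "F x = D.H.mass powr (- 1 / p) * hpot l D.wfn x powr (- 1 / (1 - p))" for x
    unfolding F_def D.H.hmap_eq unfolding D.phi_def ..
  have mp: "D.H.mass powr (- 1 / p) > 0" using D.H.mass_pos by simp
  have cont: "continuous_on UNIV F"
    unfolding Feq[abs_def] using hpos
    by (intro continuous_intros D.W.continuous_on_hpot continuous_on_powr) (auto simp: less_imp_neq[symmetric])
  have strict: "F (refl_hyp e t x) < F x"
    if "hyperplane e" "\<And>x. x \<bullet> e > t \<Longrightarrow> F (refl_hyp e t x) \<le> F x" "F x1 \<noteq> F (refl_hyp e t x1)" "x \<bullet> e > t"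
    for e t x x1
    by (rule reflection_strict[OF dF cont that(1) D.W.half_space_weight_axioms w hpos Feq mp that(2,3,4)])
  have ord: "reflection_ordered F"
    unfolding reflection_ordered_def
  proof (intro allI impI)
    fix e :: "real^'m" and t :: real
    assume e1: "norm e = 1"
    interpret hyperplane e t by unfold_locales (rule e1)
    show "(\<forall>x. x \<bullet> e > t \<longrightarrow> F x > F (R x)) \<or> (\<forall>x. x \<bullet> e > t \<longrightarrow> F x < F (R x)) \<or> (\<forall>x. F x = F (R x))"
    proof (cases "\<forall>x. F x = F (R x)")
      case False
      then obtain x1 where x1: "F x1 \<noteq> F (R x1)" by blast
      consider (ge) "\<forall>x. x \<bullet> e > t \<longrightarrow> F (R x) \<le> F x" | (le) "\<forall>x. x \<bullet> e > t \<longrightarrow> F x \<le> F (R x)"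
        using reflection_dichotomy[OF F cont maxF hyperplane_axioms] by blast
      then show ?thesis
      proof cases
        case ge
        then show ?thesis using strict[OF hyperplane_axioms _ x1] by blast
      next
        case le
        \<comment> \<open>The pair \<open>- e\<close>, \<open>- t\<close> describes the same
          reflection with the sides exchanged.\<close>
        have h': "hyperplane (- e)" by unfold_locales (simp add: e1)
        have ge': "F (R x) \<le> F x" if "x \<bullet> (- e) > - t" for x
        proof -
          have "R x \<bullet> e > t" using R_side[of x] that by simp
          then show ?thesis using le R_invol[of x] by metis
        qed
        have "F x < F (R x)" if x: "x \<bullet> e > t" for x
        proof -
          have "R x \<bullet> (- e) > - t" using R_side[of x] x by simp
          then have "F (R (R x)) < F (R x)"
            using strict[OF h', of "- t" x1 "R x"] ge' x1 unfolding refl_hyp_uminus by blast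
          then show ?thesis unfolding R_invol .
        qed
        then show ?thesis by blast
      qed
    qed blast
  qed
  have pos: "F x > 0" for x unfolding F_def by (rule D.H.hmap_pos)
  have lim: "(F \<longlongrightarrow> 0) at_infinity"
  proof -
    define C where "C = D.H.mass powr (- 1 / p) * D.lo powr (- (1 / (1 - p)))"
    have "filterlim (\<lambda>x::real^'m. 1 + norm x) at_top at_infinity"
      by (rule filterlim_tendsto_add_at_top[OF tendsto_const filterlim_norm_at_top])
    then have "((\<lambda>x::real^'m. wgt (- (l / (1 - p))) x) \<longlongrightarrow> 0) at_infinity"
      unfolding wgt_def by (rule tendsto_neg_powr[rotated]) (use l0 p1 in simp)
    then have C: "((\<lambda>x::real^'m. C * wgt (- (l / (1 - p))) x) \<longlongrightarrow> 0) at_infinity"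
      by (rule tendsto_mult_right_zero)
    show ?thesis
    proof (rule tendsto_sandwich[OF _ _ tendsto_const C])
      show "\<forall>\<^sub>F x in at_infinity. 0 \<le> F x"
        using pos by (intro always_eventually allI less_imp_le)
      show "\<forall>\<^sub>F x in at_infinity. F x \<le> C * wgt (- (l / (1 - p))) x"
        unfolding F_def C_def by (intro always_eventually allI D.H.hmap_le)
    qed
  qed
  show ?thesis
  proof (rule reflection_ordered_radial[OF cont pos lim ord])
    fix h :: "real \<Rightarrow> real" and x0 :: "real^'m"
    assume h: "\<And>t. 0 \<le> h t" "strict_antimono_on {0..} h" "\<And>x. F x = h (norm (x + x0))"
    have "AE x in lborel. f x = h (norm (x + x0))" using ae unfolding h(3) .
    then show ?thesis using h(1,2) by blast
  qed
qed

end

subsection \<open>From the energy to the minimization problem\<close>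

lemma epowr_ennreal_pos: "u > 0 \<Longrightarrow> epowr (ennreal u) a = ennreal (u powr a)"
  unfolding epowr_def by (auto simp: ennreal_eq_0_iff)

lemma epowr_ennreal_nonneg: "u \<ge> 0 \<Longrightarrow> a > 0 \<Longrightarrow> epowr (ennreal u) a = ennreal (u powr a)"
  unfolding epowr_def by (auto simp: ennreal_eq_0_iff)

lemma epowr_top_neg: "a < 0 \<Longrightarrow> epowr top a = 0"
  unfolding epowr_def by auto

text \<open>Order reversal also at 0 and \<open>\<infinity>\<close>, which a negative power
  interchanges. This turns minimizing the \<open>L\<^sup>q\<close> functional into maximizing the
  integral inside it.\<close>

lemma epowr_neg_le_iff:
  assumes "a < 0"
  shows "epowr x a \<le> epowr y a \<longleftrightarrow> y \<le> x"
proof -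
  have r: "ennreal (u powr a) \<le> ennreal (v powr a) \<longleftrightarrow> ennreal v \<le> ennreal u" if "u > 0" "v > 0" for u v :: real
  proof -
    have "u powr a \<le> v powr a \<longleftrightarrow> v \<le> u"
    proof
      assume le: "u powr a \<le> v powr a"
      show "v \<le> u"
      proof (rule ccontr)
        assume "\<not> v \<le> u"
        then have "v powr a < u powr a" using assms that by (intro powr_less_mono2_neg) auto
        then show False using le by simp
      qed
    qed (use assms that in \<open>intro powr_mono2', auto\<close>)
    then show ?thesis using that by (simp add: ennreal_le_iff)
  qed
  have c: "x = 0 \<or> x = \<infinity> \<or> (\<exists>u>0. x = ennreal u)" for x :: ennreal
    by (cases x) (auto simp: less_le ennreal_eq_0_iff)
  consider "x = 0" | "x = \<infinity>" | u where "u > 0" "x = ennreal u" using c[of x] by blast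
  then show ?thesis
  proof cases
    case 3
    consider "y = 0" | "y = \<infinity>" | v where "v > 0" "y = ennreal v" using c[of y] by blast
    then show ?thesis
    proof cases
      case 3
      then show ?thesis using r \<open>u > 0\<close> \<open>x = ennreal u\<close> by (simp add: epowr_ennreal_pos)
    qed (use assms 3 in \<open>auto simp: epowr_ennreal_pos epowr_def[of 0] epowr_top_neg top_unique\<close>)
  next
    case 1
    consider "y = 0" | "y = \<infinity>" | v where "v > 0" "y = ennreal v" using c[of y] by blast
    then show ?thesis
      by cases (use assms 1 in \<open>auto simp: epowr_ennreal_pos epowr_def[of 0] epowr_top_neg top_unique\<close>)
  next
    case 2
    then show ?thesis using assms by (simp add: epowr_top_neg)
  qed
qed

lemma epowr_eq_1_iff:
  assumes "a > 0" shows "epowr x a = 1 \<longleftrightarrow> x = 1"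
proof (cases x)
  case (real u)
  show ?thesis
  proof (cases "u = 0")
    case False
    then have u: "u > 0" using real by simp
    have "u powr a = 1 \<longleftrightarrow> u = 1"
      using u assms by (metis powr_one_eq_one powr_eq_one_iff_gen less_irrefl)
    then show ?thesis using real u by (simp add: epowr_ennreal_pos)
  qed (use assms real in \<open>simp add: epowr_def\<close>)
qed (use assms in \<open>simp add: epowr_def\<close>)

definition dual_objective :: "real \<Rightarrow> real \<Rightarrow> (real^'m \<Rightarrow> real) \<Rightarrow> ennreal" where
  "dual_objective l q f = (\<integral>\<^sup>+ y. epowr (ext_op l (\<lambda>x. ennreal (f x)) y) q \<partial>(lebesgue_on half_space))"

lemma is_minimizer_iff:
  fixes f :: "real^'m \<Rightarrow> real"
  assumes "q < 0"
  shows "is_minimizer l p q f \<longleftrightarrow> f \<in> admissible p \<and> (\<forall>g\<in>(admissible p :: (real^'m \<Rightarrow> real) set). dual_objective l q g \<le> dual_objective l q f)"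
proof -
  have le: "objective l q f \<le> objective l q g \<longleftrightarrow> dual_objective l q g \<le> dual_objective l q f" for g :: "real^'m \<Rightarrow> real"
    unfolding objective_def Lnorm_def dual_objective_def using assms by (intro epowr_neg_le_iff) simp
  show ?thesis
  proof (cases "f \<in> admissible p")
    case True
    then have "(INF g\<in>(admissible p :: (real^'m \<Rightarrow> real) set). objective l q g) \<le> objective l q f" by (rule INF_lower)
    then have "objective l q f = (INF g\<in>(admissible p :: (real^'m \<Rightarrow> real) set). objective l q g) \<longleftrightarrow> (\<forall>g\<in>(admissible p :: (real^'m \<Rightarrow> real) set). objective l q f \<le> objective l q g)"
      unfolding le_INF_iff[symmetric] by auto
    then show ?thesis unfolding is_minimizer_def le using True by simp
  qed (simp add: is_minimizer_def)
qed

lemma nn_integral_lebesgue_on_half_space: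
  "(\<integral>\<^sup>+ y. G y \<partial>(lebesgue_on half_space)) = (\<integral>\<^sup>+ y. G y \<partial>(hs :: ((real^'m) \<times> real) measure))"
proof -
  have h: "half_space \<in> sets (lborel :: ((real^'m) \<times> real) measure)" using borel_open[OF open_half_space] by simp
  then have "half_space \<inter> space lebesgue \<in> sets (lebesgue :: ((real^'m) \<times> real) measure)"
    by (simp add: sets_completionI_sets)
  then show ?thesis
    unfolding hs_def by (simp add: nn_integral_restrict_space borel_open[OF open_half_space] nn_integral_completion)
qed

lemma admissible_iff:
  assumes "p > 0"
  shows "f \<in> admissible p \<longleftrightarrow> f \<in> borel_measurable lebesgue \<and> (\<forall>x. 0 \<le> f x) \<and> (\<integral>\<^sup>+x. ennreal (f x powr p) \<partial>lborel) = 1"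
proof (cases "\<forall>x. 0 \<le> f x")
  case True
  have "(\<integral>\<^sup>+x. epowr (ennreal \<bar>f x\<bar>) p \<partial>lebesgue) = (\<integral>\<^sup>+x. ennreal (f x powr p) \<partial>lborel)"
    using True assms by (simp add: nn_integral_completion epowr_ennreal_nonneg)
  then show ?thesis
    unfolding admissible_def Lspace_def Lnorm_def
    using True assms by (auto simp: epowr_eq_1_iff)
qed (auto simp: admissible_def)

context hls
begin

lemma dual_objective_unit_dens:
  fixes f :: "real^'m \<Rightarrow> real"
  assumes "dens l f"
  shows "dual_objective l (- s) f = ennreal (energy l s f)"
proof -
  interpret B: boundary_density l f by unfold_locales (rule assms)
  have e: "ext_op l (\<lambda>x. ennreal (f x)) y = ennreal (bpot l f y)" for y
  proof -
    have "ext_op l (\<lambda>x. ennreal (f x)) y = (\<integral>\<^sup>+x. ennreal (norm ((x, 0) - y) powr l * f x) \<partial>lborel)"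
      unfolding ext_op_def nn_integral_completion using B.f_nonneg by (simp add: ennreal_mult)
    also have "\<dots> = ennreal (bpot l f y)"
      unfolding bpot_eq using B.f_nonneg by (intro nn_integral_eq_integral B.bpot_integrable) simp
    finally show ?thesis .
  qed
  have "dual_objective l (- s) f = (\<integral>\<^sup>+ y. ennreal (bpot l f y powr (- s)) \<partial>hs)"
    unfolding dual_objective_def nn_integral_lebesgue_on_half_space e epowr_ennreal_pos[OF B.bpot_pos] ..
  also have "\<dots> = ennreal (energy l s f)"
    unfolding energy_def by (intro nn_integral_eq_integral energy_integrable assms) simp
  finally show ?thesis .
qed

lemma unit_dens_admissible:
  assumes "unit_dens f" shows "f \<in> admissible p"
proof -
  have i: "integrable lborel (\<lambda>x. f x powr p)" "(\<integral>x. f x powr p \<partial>lborel) = 1"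
    and f: "f \<in> borel_measurable borel" "\<forall>x. 0 \<le> f x"
    using assms unfolding unit_dens_def dens_def by auto
  have "(\<integral>\<^sup>+x. ennreal (f x powr p) \<partial>lborel) = 1"
    using nn_integral_eq_integral[OF i(1)] i(2) by simp
  moreover have "f \<in> borel_measurable lebesgue"
    using f(1) by (simp add: measurable_completion measurable_lborel1)
  ultimately show ?thesis using f(2) admissible_iff[OF p0] by blast
qed

text \<open>An admissible function is merely Lebesgue measurable and its extension may be infinite
  on the whole half-space, which gives the value 0. Otherwise one finite value bounds the weighted
  integral, and a Borel representative is a unit density.\<close>

lemma admissible_cases:
  fixes f :: "real^'m \<Rightarrow> real"
  assumes f: "f \<in> admissible p" and ne: "dual_objective l (- s) f \<noteq> 0"
  obtains f' where "unit_dens f'" "AE x in lborel. f x = f' x" "dual_objective l (- s) f = ennreal (energy l s f')"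
proof -
  have m: "f \<in> borel_measurable (completion lborel)" and nn: "\<And>x. 0 \<le> f x"
    and fp: "(\<integral>\<^sup>+x. ennreal (f x powr p) \<partial>lborel) = 1"
    using f unfolding admissible_iff[OF p0] by auto
  obtain f1 where f1: "f1 \<in> borel_measurable lborel" "AE x in lborel. f x = f1 x"
    using completion_ex_borel_measurable_real[OF m] by blast
  \<comment> \<open>The absolute value makes the representative nonnegative everywhere and not just
    a.e.\<close>
  define f' where "f' x = \<bar>f1 x\<bar>" for x
  have b[measurable]: "f' \<in> borel_measurable borel"
    using f1(1) unfolding f'_def[abs_def] measurable_lborel1 by measurable
  have nn': "0 \<le> f' x" for x unfolding f'_def by simp
  have ae: "AE x in lborel. f x = f' x"
    using f1(2) unfolding f'_def by eventually_elim (metis nn abs_of_nonneg)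
  have fp': "(\<integral>\<^sup>+x. ennreal (f' x powr p) \<partial>lborel) = 1"
    unfolding fp[symmetric] using ae by (intro nn_integral_cong_AE) (auto elim: eventually_mono)
  have ext: "ext_op l (\<lambda>x. ennreal (f x)) = ext_op l (\<lambda>x. ennreal (f' x))"
    unfolding ext_op_def nn_integral_completion using ae by (intro ext nn_integral_cong_AE) (auto elim: eventually_mono)
  have dual: "dual_objective l (- s) f = dual_objective l (- s) f'"
    unfolding dual_objective_def ext ..
  have "\<exists>y\<in>half_space. ext_op l (\<lambda>x. ennreal (f' x)) y \<noteq> \<infinity>"
  proof (rule ccontr)
    assume "\<not> ?thesis"
    then have "dual_objective l (- s) f' = (\<integral>\<^sup>+ y. 0 \<partial>(hs :: ((real^'m) \<times> real) measure))"
      unfolding dual_objective_def nn_integral_lebesgue_on_half_space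
      using s0 by (intro nn_integral_cong) (simp add: epowr_top_neg)
    then show False using ne dual by simp
  qed
  then obtain y where y: "snd y > 0" "ext_op l (\<lambda>x. ennreal (f' x)) y \<noteq> \<infinity>"
    unfolding half_space_def by blast
  \<comment> \<open>Since \<open>norm ((x, 0) - y)\<close> is at least \<open>snd y > 0\<close>, the
    constant in \<open>1 + norm x \<le> (1 + norm y) + norm ((x, 0) - y)\<close> can be absorbed
    into the distance.\<close>
  define C where "C = (1 + norm y) / snd y + 1"
  have C: "C > 0" unfolding C_def using y(1) by (intro add_nonneg_pos divide_nonneg_pos) auto
  have wle: "wgt l x \<le> C powr l * norm ((x, 0) - y) powr l" for x
  proof -
    have "\<bar>snd ((x, 0) - y)\<bar> \<le> norm ((x, 0) - y)" by (metis norm_snd_le real_norm_def prod.collapse)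
    then have 1: "snd y \<le> norm ((x, 0) - y)" using y(1) by simp
    have "norm (x, 0::real) \<le> norm ((x, 0) - y) + norm y" using norm_triangle_sub[of "(x, 0)" y] by simp
    then have "1 + norm x \<le> (1 + norm y) + norm ((x, 0) - y)" by (simp add: norm_Pair)
    also have "1 + norm y \<le> (1 + norm y) / snd y * norm ((x, 0) - y)"
    proof -
      have "(1 + norm y) * snd y \<le> (1 + norm y) * norm ((x, 0) - y)" using 1 by (intro mult_left_mono) auto
      then show ?thesis using y(1) by (simp add: field_simps)
    qed
    finally have "1 + norm x \<le> C * norm ((x, 0) - y)" unfolding C_def by (simp add: distrib_right)
    then have "wgt l x \<le> (C * norm ((x, 0) - y)) powr l"
      unfolding wgt_def using l0 by (intro powr_mono2) auto
    then show ?thesis by (simp add: powr_mult)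
  qed
  have int: "integrable lborel (\<lambda>x. wgt l x * f' x)"
  proof (rule integrableI_nonneg)
    have "(\<integral>\<^sup>+x. ennreal (wgt l x * f' x) \<partial>lborel) \<le> (\<integral>\<^sup>+x. ennreal (C powr l) * (ennreal (norm ((x, 0) - y) powr l) * ennreal (f' x)) \<partial>lborel)"
    proof (rule nn_integral_mono)
      fix x
      have "wgt l x * f' x \<le> (C powr l * norm ((x, 0) - y) powr l) * f' x"
        by (intro mult_right_mono wle nn')
      then show "ennreal (wgt l x * f' x) \<le> ennreal (C powr l) * (ennreal (norm ((x, 0) - y) powr l) * ennreal (f' x))"
        using nn'[of x] by (simp add: ennreal_mult[symmetric] mult.assoc ennreal_leI)
    qed
    also have "\<dots> = ennreal (C powr l) * ext_op l (\<lambda>x. ennreal (f' x)) y"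
      unfolding ext_op_def nn_integral_completion by (rule nn_integral_cmult) (simp add: measurable_lborel1)
    also have "\<dots> < \<infinity>"
      using y(2) by (simp add: ennreal_mult_less_top less_top)
    finally show "(\<integral>\<^sup>+x. ennreal (wgt l x * f' x) \<partial>lborel) < \<infinity>" .
  qed (use nn' in auto)
  interpret P: potential l lborel "\<lambda>x. (x::real^'m)" f'
    using l0 int by unfold_locales (auto simp: measurable_lborel1)
  have pint: "integrable lborel (\<lambda>x. f' x powr p)"
    by (rule integrableI_nonneg) (use fp' in auto)
  have p1: "(\<integral>x. f' x powr p \<partial>lborel) = 1"
    using nn_integral_eq_integral[OF pint] fp' by simp
  have "0 < integral\<^sup>L lborel f'"
  proof (rule ccontr)
    assume "\<not> ?thesis"
    moreover have "0 \<le> integral\<^sup>L lborel f'" using nn' by (intro integral_nonneg_AE AE_I2)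
    ultimately have "integral\<^sup>L lborel f' = 0" by linarith
    then have "AE x in lborel. f' x = 0"
      using integral_nonneg_eq_0_iff_AE[OF P.w_integrable] nn' by simp
    then have "(\<integral>x. f' x powr p \<partial>lborel) = (\<integral>x. 0 \<partial>(lborel :: (real^'m) measure))"
      by (intro integral_cong_AE) (auto elim: eventually_mono)
    then show False using p1 by simp
  qed
  then have d: "dens l f'" unfolding dens_def using l0 nn' int by auto
  then have "unit_dens f'" unfolding unit_dens_def using pint p1 by simp
  then show ?thesis
    using that[OF _ ae] dual dual_objective_unit_dens[OF d] by simp
qed

lemma minimizer_exists: "\<exists>f :: real^'m \<Rightarrow> real. is_minimizer l p (- s) f"
proof -
  obtain g :: "real^'m \<Rightarrow> real" where g: "unit_dens g" "\<And>f. unit_dens f \<Longrightarrow> energy l s f \<le> energy l s g"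
    using ex_maximizer by blast
  have dg: "dual_objective l (- s) g = ennreal (energy l s g)"
    using g(1) unfolding unit_dens_def by (intro dual_objective_unit_dens) simp
  have "dual_objective l (- s) f \<le> dual_objective l (- s) g" if f: "f \<in> admissible p" for f :: "real^'m \<Rightarrow> real"
  proof (cases "dual_objective l (- s) f = 0")
    case False
    show ?thesis
      by (rule admissible_cases[OF f False]) (auto simp: dg intro!: ennreal_leI g(2))
  qed simp
  then have "is_minimizer l p (- s) g"
    using unit_dens_admissible[OF g(1)] s0 is_minimizer_iff[of "- s" l p g] by simp
  then show ?thesis by blast
qed

lemma minimizer_radial:
  fixes f :: "real^'m \<Rightarrow> real"
  assumes "is_minimizer l p (- s) f"
  shows "\<exists>h x0. (\<forall>t\<ge>0. 0 \<le> h t) \<and> strict_antimono_on {0..} h \<and> (AE x in lebesgue. f x = h (norm (x + x0)))"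
proof -
  have f: "f \<in> admissible p"
    and max: "\<And>g :: real^'m \<Rightarrow> real. g \<in> admissible p \<Longrightarrow> dual_objective l (- s) g \<le> dual_objective l (- s) f"
    using assms is_minimizer_iff[of "- s" l p f] s0 by auto
  have dual: "dual_objective l (- s) g = ennreal (energy l s g)" "energy l s g > 0" if "unit_dens g" for g
    using that unfolding unit_dens_def by (auto intro: dual_objective_unit_dens energy_pos)
  obtain g :: "real^'m \<Rightarrow> real" where g: "unit_dens g" using ex_unit_dens by blast
  \<comment> \<open>Some competitor has a positive value, so a minimizer avoids the degenerate case
    of \<open>admissible_cases\<close>.\<close>
  have "0 < dual_objective l (- s) g" using dual[OF g] by (simp add: ennreal_less_zero_iff)
  also have "\<dots> \<le> dual_objective l (- s) f" by (rule max[OF unit_dens_admissible[OF g]])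
  finally have "dual_objective l (- s) f \<noteq> 0" by simp
  then obtain f' where f': "unit_dens f'" "AE x in lborel. f x = f' x" "dual_objective l (- s) f = ennreal (energy l s f')"
    using admissible_cases[OF f] by blast
  have "energy l s G \<le> energy l s f'" if "unit_dens G" for G
    using max[OF unit_dens_admissible[OF that]] dual[OF that] dual(2)[OF f'(1)]
    unfolding f'(3) by (simp add: ennreal_le_iff)
  then obtain h x0 where h: "\<forall>t. 0 \<le> h t" "strict_antimono_on {0..} h" "AE x in lborel. f' x = h (norm (x + x0))"
    using maximizer_radial[OF f'(1)] by blast
  have "AE x in lborel. f x = h (norm (x + x0))" using f'(2) h(3) by eventually_elim simp
  then have "AE x in lebesgue. f x = h (norm (x + x0))" by (rule AE_completion)
  then show ?thesis using h(1,2) by blast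
qed

end

theorem theorem4:
  fixes n :: nat and l p r q :: real
  assumes "n \<ge> 2" and "CARD('m::finite) = n - 1"
    and "l > 0" and "0 < p" "p < 1" and "0 < r" "r < 1"
    and "(real n - 1) / real n * (1 / p) + 1 / r - l / real n = 2 - 1 / real n"
    and "q = r / (r - 1)"
  shows "(\<exists>f :: real^'m \<Rightarrow> real. is_minimizer l p q f) \<and>
    (\<forall>f :: real^'m \<Rightarrow> real. is_minimizer l p q f \<longrightarrow>
      (\<exists>(h :: real \<Rightarrow> real) (x0 :: real^'m).
         (\<forall>t\<ge>0. 0 \<le> h t) \<and> strict_antimono_on {0..} h \<and>
         (AE x in lebesgue. f x = h (norm (x + x0)))))"
proof -
  \<comment> \<open>This is \<open>-q\<close>. Multiplied by \<open>n\<close>, the exponent relation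
    gives \<open>l - (n - 1) (1/p - 1) = n (1 - r) / r\<close>; since \<open>s\<close> is the
    inverse of \<open>(1 - r) / r\<close>, this is \<open>bal\<close> with
    \<open>CARD('m) + 1 = n\<close>.\<close>
  define s where "s = r / (1 - r)"
  have s: "s > 0" unfolding s_def using assms by simp
  have q: "q = - s" unfolding s_def assms(9) by (metis minus_diff_eq minus_divide_right)
  have m: "real CARD('m) = real n - 1" using assms(1,2) by simp
  have n0: "real n > 0" using assms(1) by simp
  have "real n * ((real n - 1) / real n * (1 / p) + 1 / r - l / real n) = real n * (2 - 1 / real n)"
    unfolding assms(8) ..
  moreover have "real n * ((real n - 1) / real n * (1 / p)) = (real n - 1) / p" "real n * (l / real n) = l"
    using n0 by simp_all
  moreover have "real n * (2 - 1 / real n) = 2 * real n - 1"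
    using n0 by (simp add: right_diff_distrib)
  ultimately have "(real n - 1) / p + real n / r - l = 2 * real n - 1"
    by (simp add: distrib_left right_diff_distrib)
  then have "l - (real n - 1) * (1 / p - 1) = real n / r - real n"
    by (simp add: algebra_simps diff_divide_distrib)
  also have "\<dots> = real n * ((1 - r) / r)" using assms(6) by (simp add: field_simps)
  finally have "s * (l - real CARD('m) * (1 / p - 1)) = real CARD('m) + 1"
    unfolding m s_def using assms(6,7) by simp
  then interpret hls l p s "TYPE('m)"
    using assms s by unfold_locales auto
  show ?thesis unfolding q using minimizer_exists minimizer_radial by blast
qed

end
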